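(* Let $R$ be an associative ring with identity. Then $R$ is quasi-Frobenius if and only if $R$ is right noetherian, left $2$-injective, and every nonzero complement left ideal of $R$ is not small.
   Context: Rings are associative with identity. A ring $R$ is quasi-Frobenius (QF) if $R$ is left or right noetherian and left or right self-injective (any choice of sides gives the same class of rings). For a positive integer $n$, $R$ is left $n$-injective if for every $n$-generated left ideal $I$ of $R$, every left $R$-homomorphism $I\to R$ extends to a left $R$-homomorphism $R\to R$. A left ideal $C$ of $R$ is a complement left ideal if there is a left ideal $S$ of $R$ such that $C$ is maximal among left ideals $C'$ with $C'\cap S=0$. A left ideal $I$ of $R$ is small if for every left ideal $K$ of $R$, $K+I=R$ implies $K=R$. *)

theory Defs
  imports "HOL-Algebra.Ideal" "HOL-Algebra.Module"
begin

section \<open>Left ideals\<close>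

locale left_ideal = additive_subgroup I R + ring R for I and R (structure) +
  assumes I_l_closed: "\<lbrakk>a \<in> I; x \<in> carrier R\<rbrakk> \<Longrightarrow> x \<otimes> a \<in> I"

definition gen_left_ideal :: "('a, 'r) ring_scheme \<Rightarrow> 'a set \<Rightarrow> 'a set" where
  "gen_left_ideal R S = \<Inter>{I. left_ideal I R \<and> S \<subseteq> I}"

text \<open>The \<open>n\<close> generators are a family and need not be distinct.\<close>

definition n_generated_left_ideal :: "('a, 'r) ring_scheme \<Rightarrow> nat \<Rightarrow> 'a set \<Rightarrow> bool" where
  "n_generated_left_ideal R n I \<longleftrightarrow>
     (\<exists>a \<in> {..<n} \<rightarrow> carrier R. I = gen_left_ideal R (a ` {..<n}))"

definition complement_left_ideal :: "('a, 'r) ring_scheme \<Rightarrow> 'a set \<Rightarrow> bool" where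
  "complement_left_ideal R C \<longleftrightarrow>
     (\<exists>S. left_ideal S R \<and> left_ideal C R \<and> C \<inter> S = {\<zero>\<^bsub>R\<^esub>} \<and>
        (\<forall>C'. left_ideal C' R \<and> C' \<inter> S = {\<zero>\<^bsub>R\<^esub>} \<and> C \<subseteq> C' \<longrightarrow> C' = C))"

definition small_left_ideal :: "('a, 'r) ring_scheme \<Rightarrow> 'a set \<Rightarrow> bool" where
  "small_left_ideal R I \<longleftrightarrow> left_ideal I R \<and>
     (\<forall>K. left_ideal K R \<and> K <+>\<^bsub>R\<^esub> I = carrier R \<longrightarrow> K = carrier R)"

definition left_noetherian :: "('a, 'r) ring_scheme \<Rightarrow> bool" where
  "left_noetherian R \<longleftrightarrow>
     (\<forall>C :: nat \<Rightarrow> 'a set. (\<forall>n. left_ideal (C n) R \<and> C n \<subseteq> C (Suc n)) \<longrightarrow>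
        (\<exists>N. \<forall>n\<ge>N. C n = C N))"


section \<open>Left modules\<close>

text \<open>
  The library locale \<^locale>\<open>module\<close> requires a commutative ring of scalars; the following one
  does not. The multiplication and unit fields inherited by the module record
  play no role.
\<close>

locale left_module = R?: ring R + M?: abelian_group M
  for R :: "('a, 'r) ring_scheme" (structure)
    and M :: "('a, 'c, 'x) module_scheme" (structure) +
  assumes smult_closed:
      "\<lbrakk>a \<in> carrier R; x \<in> carrier M\<rbrakk> \<Longrightarrow> a \<odot>\<^bsub>M\<^esub> x \<in> carrier M"
    and smult_l_distr:
      "\<lbrakk>a \<in> carrier R; b \<in> carrier R; x \<in> carrier M\<rbrakk> \<Longrightarrow>
       (a \<oplus> b) \<odot>\<^bsub>M\<^esub> x = a \<odot>\<^bsub>M\<^esub> x \<oplus>\<^bsub>M\<^esub> b \<odot>\<^bsub>M\<^esub> x"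
    and smult_r_distr:
      "\<lbrakk>a \<in> carrier R; x \<in> carrier M; y \<in> carrier M\<rbrakk> \<Longrightarrow>
       a \<odot>\<^bsub>M\<^esub> (x \<oplus>\<^bsub>M\<^esub> y) = a \<odot>\<^bsub>M\<^esub> x \<oplus>\<^bsub>M\<^esub> a \<odot>\<^bsub>M\<^esub> y"
    and smult_assoc:
      "\<lbrakk>a \<in> carrier R; b \<in> carrier R; x \<in> carrier M\<rbrakk> \<Longrightarrow>
       (a \<otimes> b) \<odot>\<^bsub>M\<^esub> x = a \<odot>\<^bsub>M\<^esub> (b \<odot>\<^bsub>M\<^esub> x)"
    and smult_one:
      "x \<in> carrier M \<Longrightarrow> \<one> \<odot>\<^bsub>M\<^esub> x = x"

definition left_module_hom ::
    "('a, 'r) ring_scheme \<Rightarrow> ('a, 'c, 'x) module_scheme \<Rightarrow> ('a, 'd, 'y) module_scheme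
      \<Rightarrow> ('c \<Rightarrow> 'd) set" where
  "left_module_hom R M N =
     {f \<in> carrier M \<rightarrow> carrier N.
        (\<forall>x\<in>carrier M. \<forall>y\<in>carrier M. f (x \<oplus>\<^bsub>M\<^esub> y) = f x \<oplus>\<^bsub>N\<^esub> f y) \<and>
        (\<forall>a\<in>carrier R. \<forall>x\<in>carrier M. f (a \<odot>\<^bsub>M\<^esub> x) = a \<odot>\<^bsub>N\<^esub> f x)}"

text \<open>A left ideal \<open>I\<close> viewed as a left module; \<open>I = carrier R\<close> gives the regular module.\<close>

definition left_ideal_module :: "('a, 'r) ring_scheme \<Rightarrow> 'a set \<Rightarrow> ('a, 'a) module" where
  "left_ideal_module R I =
     \<lparr>carrier = I, mult = mult R, one = one R, zero = zero R, add = add R, smult = mult R\<rparr>"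

abbreviation regular_left_module :: "('a, 'r) ring_scheme \<Rightarrow> ('a, 'a) module" where
  "regular_left_module R \<equiv> left_ideal_module R (carrier R)"

definition left_n_injective :: "('a, 'r) ring_scheme \<Rightarrow> nat \<Rightarrow> bool" where
  "left_n_injective R n \<longleftrightarrow>
     (\<forall>I. left_ideal I R \<and> n_generated_left_ideal R n I \<longrightarrow>
        (\<forall>f \<in> left_module_hom R (left_ideal_module R I) (regular_left_module R).
           \<exists>g \<in> left_module_hom R (regular_left_module R) (regular_left_module R).
             \<forall>x\<in>I. g x = f x))"

text \<open>
  Injectivity of \<open>E\<close> is tested on the monomorphisms between left modules whose carriers are
  sets over the type \<^typ>\<open>'c\<close>, since HOL cannot quantify over types inside a definition.
\<close>

definition injective_left_module ::
    "'c itself \<Rightarrow> ('a, 'r) ring_scheme \<Rightarrow> ('a, 'e, 'x) module_scheme \<Rightarrow> bool" where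
  "injective_left_module T R E \<longleftrightarrow> left_module R E \<and>
     (\<forall>(M :: ('a, 'c) module) (N :: ('a, 'c) module). left_module R M \<and> left_module R N \<longrightarrow>
        (\<forall>i \<in> left_module_hom R M N. inj_on i (carrier M) \<longrightarrow>
           (\<forall>f \<in> left_module_hom R M E.
              \<exists>g \<in> left_module_hom R N E. \<forall>x\<in>carrier M. g (i x) = f x)))"

text \<open>
  The test modules have carriers over \<^typ>\<open>'a + 'm\<close> with \<^typ>\<open>'m\<close> arbitrary. So
  every module with carrier over \<^typ>\<open>'m\<close> is covered up to isomorphism and, however
  small \<^typ>\<open>'m\<close> is, the inclusions of left ideals into \<open>R\<close> are among the tests; by
  Baer's criterion the notion does not depend on \<^typ>\<open>'m\<close>.
\<close>

definition left_self_injective :: "'m itself \<Rightarrow> ('a, 'r) ring_scheme \<Rightarrow> bool" where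
  "left_self_injective T R \<longleftrightarrow>
     injective_left_module TYPE('a + 'm) R (regular_left_module R)"


section \<open>Right-hand notions and quasi-Frobenius rings\<close>

text \<open>Right ideals and right modules over \<open>R\<close> are left ideals and left modules over \<open>opp_ring R\<close>.\<close>

definition opp_ring :: "('a, 'r) ring_scheme \<Rightarrow> ('a, 'r) ring_scheme" where
  "opp_ring R = R\<lparr>mult := \<lambda>x y. y \<otimes>\<^bsub>R\<^esub> x\<rparr>"

definition right_noetherian :: "('a, 'r) ring_scheme \<Rightarrow> bool" where
  "right_noetherian R \<longleftrightarrow> left_noetherian (opp_ring R)"

definition right_self_injective :: "'m itself \<Rightarrow> ('a, 'r) ring_scheme \<Rightarrow> bool" where
  "right_self_injective T R \<longleftrightarrow> left_self_injective T (opp_ring R)"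

definition quasi_Frobenius :: "'m itself \<Rightarrow> ('a, 'r) ring_scheme \<Rightarrow> bool" where
  "quasi_Frobenius T R \<longleftrightarrow>
     (left_noetherian R \<or> right_noetherian R) \<and>
     (left_self_injective T R \<or> right_self_injective T R)"

end

theory Submission
  imports Defs
begin

text \<open>
  Write \<open>l\<close> and \<open>r\<close> for left and right annihilators and let \<open>Z\<close> be the left singular ideal,
  the set of elements whose left annihilator is an essential left ideal. It takes the part of
  the Jacobson radical.

  Let \<open>R\<close> satisfy the three conditions. Left 2-injectivity is used through two of its
  consequences. First, \<open>l(a) \<subseteq> l(b)\<close> forces \<open>b \<in> aR\<close>. This makes \<open>Z\<close> semiprime and makes the ring
  \<open>fRf\<close> local whenever \<open>f\<close> is an idempotent with \<open>Rf\<close> uniform (any two nonzero left ideals inside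
  \<open>Rf\<close> meet). Secondly, \<open>Ra \<inter> Rb = 0\<close> yields an element \<open>c\<close> with \<open>ac = a\<close> and \<open>bc = 0\<close>.
  So if \<open>r(a)\<close> is maximal among the annihilators \<open>r(x)\<close> with \<open>x \<noteq> 0\<close>, a choice that the right
  noetherian condition offers inside every nonzero left ideal, then \<open>Ra\<close> is uniform. A uniform
  left ideal has a uniform complement left ideal \<open>C\<close> above it. If every \<open>c \<in> C\<close> killed some
  nonzero element of \<open>C\<close> on the right, then every \<open>1 - c\<close> would be a unit and \<open>C\<close> would be small;
  an element \<open>c\<close> that does not is von Neumann regular, and \<open>C = Rg\<close> for an idempotent \<open>g\<close>.
  Splitting off such summands, the right noetherian condition writes \<open>1\<close> as a sum of finitely many
  uniform idempotents. Moreover \<open>Z\<close> is nilpotent, because \<open>l(Z)\<close> is an essential left ideal.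

  It follows that the left socle \<open>r(Z)\<close> and the right socle \<open>l(Z)\<close> coincide, say with \<open>S\<close>, and that
  \<open>fS\<close> and \<open>Sf\<close> are simple or zero for each of the idempotents \<open>f\<close>. The inclusion
  \<open>l(Z) \<subseteq> r(Z)\<close> needs every \<open>fS\<close> to be nonzero: sending \<open>Rf\<close> to the projective cover
  of its simple socle is injective on the finite set of isomorphism classes, hence surjective.

  These facts make up the locale \<open>dual_socle\<close>, which is invariant under passage to the opposite
  ring. In it, annihilators turn a composition series of left ideals into a series of right ideals
  with simple or zero factors, and conversely. Hence one chain condition gives the other, and
  comparing lengths gives \<open>l(r(I)) = I\<close> and \<open>r(l(T)) = T\<close>. An argument of Ikeda and Nakayama then
  extends every homomorphism from a left ideal to \<open>R\<close>, and Baer's criterion makes \<open>R\<close> injective.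

  Conversely, let \<open>R\<close> be left self-injective and noetherian on some side. It is left
  \<open>n\<close>-injective for all \<open>n\<close>, and a complement left ideal is a direct summand, so a nonzero one is not
  small. On the right noetherian side nothing else has to be shown. A left noetherian \<open>R\<close>
  reaches the same locale \<open>dual_socle\<close>, with left-handed chain arguments for the uniform left ideals
  and for the nilpotency of \<open>Z\<close>. Since the locale is symmetric, the remaining side conditions in the
  definition of a quasi-Frobenius ring are covered by applying this to the opposite ring.
\<close>



section \<open>Left ideals, right ideals and annihilators\<close>

lemma opp_ring_simps [simp]:
  "carrier (opp_ring R) = carrier R"
  "x \<otimes>\<^bsub>opp_ring R\<^esub> y = y \<otimes>\<^bsub>R\<^esub> x"
  "x \<oplus>\<^bsub>opp_ring R\<^esub> y = x \<oplus>\<^bsub>R\<^esub> y"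
  "\<zero>\<^bsub>opp_ring R\<^esub> = \<zero>\<^bsub>R\<^esub>"
  "\<one>\<^bsub>opp_ring R\<^esub> = \<one>\<^bsub>R\<^esub>"
  by (simp_all add: opp_ring_def)

lemma opp_opp_ring [simp]: "opp_ring (opp_ring R) = R"
  by (simp add: opp_ring_def)

lemma ring_opp_ring:
  assumes "ring R" shows "ring (opp_ring R)"
proof -
  interpret ring R by fact
  show ?thesis
  proof (rule ringI)
    show "abelian_group (opp_ring R)"
      by (rule abelian_groupI) (use a_ac l_neg in auto)
    show "Group.monoid (opp_ring R)"
      by unfold_locales (auto simp: m_assoc)
  qed (auto simp: l_distr r_distr)
qed

text \<open>Closure under additive inverses is automatic, because \<open>\<ominus> a = (\<ominus> \<one>) \<otimes> a\<close>.\<close>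

lemma (in ring) left_ideal_iff:
  "left_ideal I R \<longleftrightarrow> I \<subseteq> carrier R \<and> \<zero> \<in> I \<and> (\<forall>a\<in>I. \<forall>b\<in>I. a \<oplus> b \<in> I)
     \<and> (\<forall>a\<in>I. \<forall>x\<in>carrier R. x \<otimes> a \<in> I)" (is "?L \<longleftrightarrow> ?R")
proof
  assume ?L
  then interpret left_ideal I R .
  show ?R using a_subset zero_closed a_closed I_l_closed by auto
next
  assume R: ?R
  have neg: "\<ominus> a \<in> I" if "a \<in> I" for a
  proof -
    have "(\<ominus> \<one>) \<otimes> a \<in> I" using R that by blast
    moreover have "(\<ominus> \<one>) \<otimes> a = \<ominus> a" using R that by (simp add: l_minus subset_iff)
    ultimately show ?thesis by simp
  qed
  have "additive_subgroup I R"
    by (rule additive_subgroupI, rule add.subgroupI) (use R neg in \<open>auto simp: a_inv_def\<close>)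
  then show ?L
    using R by (auto simp: left_ideal_def left_ideal_axioms_def ring_axioms)
qed

lemma (in ring) left_idealI:
  assumes "I \<subseteq> carrier R" "\<zero> \<in> I" "\<And>a b. a \<in> I \<Longrightarrow> b \<in> I \<Longrightarrow> a \<oplus> b \<in> I"
    "\<And>a x. a \<in> I \<Longrightarrow> x \<in> carrier R \<Longrightarrow> x \<otimes> a \<in> I"
  shows "left_ideal I R"
  using assms by (auto simp: left_ideal_iff)

lemma (in ring) left_idealD:
  assumes "left_ideal I R"
  shows "I \<subseteq> carrier R" "\<zero> \<in> I" "\<And>a b. a \<in> I \<Longrightarrow> b \<in> I \<Longrightarrow> a \<oplus> b \<in> I"
    "\<And>a x. a \<in> I \<Longrightarrow> x \<in> carrier R \<Longrightarrow> x \<otimes> a \<in> I"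
    "\<And>a. a \<in> I \<Longrightarrow> a \<in> carrier R"
    "\<And>a. a \<in> I \<Longrightarrow> \<ominus> a \<in> I"
    "\<And>a b. a \<in> I \<Longrightarrow> b \<in> I \<Longrightarrow> a \<ominus> b \<in> I"
proof -
  interpret left_ideal I R by fact
  show "I \<subseteq> carrier R" "\<zero> \<in> I" "\<And>a b. a \<in> I \<Longrightarrow> b \<in> I \<Longrightarrow> a \<oplus> b \<in> I"
    "\<And>a x. a \<in> I \<Longrightarrow> x \<in> carrier R \<Longrightarrow> x \<otimes> a \<in> I"
    "\<And>a. a \<in> I \<Longrightarrow> a \<in> carrier R" "\<And>a. a \<in> I \<Longrightarrow> \<ominus> a \<in> I"
    "\<And>a b. a \<in> I \<Longrightarrow> b \<in> I \<Longrightarrow> a \<ominus> b \<in> I"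
    using a_subset I_l_closed by (auto simp: minus_eq)
qed

lemma (in ring) right_ideal_iff:
  "left_ideal I (opp_ring R) \<longleftrightarrow> I \<subseteq> carrier R \<and> \<zero> \<in> I \<and> (\<forall>a\<in>I. \<forall>b\<in>I. a \<oplus> b \<in> I)
     \<and> (\<forall>a\<in>I. \<forall>x\<in>carrier R. a \<otimes> x \<in> I)"
  using ring.left_ideal_iff[OF ring_opp_ring[OF ring_axioms], of I] by simp

lemma (in ring) right_idealI:
  assumes "I \<subseteq> carrier R" "\<zero> \<in> I" "\<And>a b. a \<in> I \<Longrightarrow> b \<in> I \<Longrightarrow> a \<oplus> b \<in> I"
    "\<And>a x. a \<in> I \<Longrightarrow> x \<in> carrier R \<Longrightarrow> a \<otimes> x \<in> I"
  shows "left_ideal I (opp_ring R)"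
  using assms by (auto simp: right_ideal_iff)

lemma (in ring) right_idealD:
  assumes "left_ideal I (opp_ring R)"
  shows "I \<subseteq> carrier R" "\<zero> \<in> I" "\<And>a b. a \<in> I \<Longrightarrow> b \<in> I \<Longrightarrow> a \<oplus> b \<in> I"
    "\<And>a x. a \<in> I \<Longrightarrow> x \<in> carrier R \<Longrightarrow> a \<otimes> x \<in> I"
    "\<And>a. a \<in> I \<Longrightarrow> a \<in> carrier R"
    "\<And>a. a \<in> I \<Longrightarrow> \<ominus> a \<in> I"
    "\<And>a b. a \<in> I \<Longrightarrow> b \<in> I \<Longrightarrow> a \<ominus> b \<in> I"
proof -
  show r: "I \<subseteq> carrier R" "\<zero> \<in> I" "\<And>a b. a \<in> I \<Longrightarrow> b \<in> I \<Longrightarrow> a \<oplus> b \<in> I"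
    "\<And>a x. a \<in> I \<Longrightarrow> x \<in> carrier R \<Longrightarrow> a \<otimes> x \<in> I"
    "\<And>a. a \<in> I \<Longrightarrow> a \<in> carrier R"
    using assms by (auto simp: right_ideal_iff)
  show n: "\<ominus> a \<in> I" if "a \<in> I" for a
    using r(4)[OF that, of "\<ominus> \<one>"] r(5)[OF that] by (simp add: r_minus)
  show "\<And>a b. a \<in> I \<Longrightarrow> b \<in> I \<Longrightarrow> a \<ominus> b \<in> I"
    using n r(3) by (simp add: minus_eq)
qed

lemma (in ring) eq_of_minus_zero:
  assumes "a \<in> carrier R" "b \<in> carrier R" "a \<ominus> b = \<zero>" shows "a = b"
proof -
  have "a = (a \<ominus> b) \<oplus> b" using assms(1,2) by (simp add: minus_eq a_assoc l_neg)
  then show ?thesis using assms by simp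
qed

definition principal_left :: "('a, 'r) ring_scheme \<Rightarrow> 'a \<Rightarrow> 'a set" where
  "principal_left R a = {x \<otimes>\<^bsub>R\<^esub> a | x. x \<in> carrier R}"

definition adjoin_left :: "('a, 'r) ring_scheme \<Rightarrow> 'a set \<Rightarrow> 'a \<Rightarrow> 'a set" where
  "adjoin_left R I t = {i \<oplus>\<^bsub>R\<^esub> x \<otimes>\<^bsub>R\<^esub> t | i x. i \<in> I \<and> x \<in> carrier R}"

definition lann :: "('a, 'r) ring_scheme \<Rightarrow> 'a set \<Rightarrow> 'a set" where
  "lann R X = {a \<in> carrier R. \<forall>x\<in>X. a \<otimes>\<^bsub>R\<^esub> x = \<zero>\<^bsub>R\<^esub>}"

definition rann :: "('a, 'r) ring_scheme \<Rightarrow> 'a set \<Rightarrow> 'a set" where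
  "rann R X = {a \<in> carrier R. \<forall>x\<in>X. x \<otimes>\<^bsub>R\<^esub> a = \<zero>\<^bsub>R\<^esub>}"

lemma rann_opp_ring [simp]: "rann (opp_ring R) = lann R"
  and lann_opp_ring [simp]: "lann (opp_ring R) = rann R"
  by (auto simp: rann_def lann_def)

context ring
begin

lemma left_ideal_zero: "left_ideal {\<zero>} R"
  by (rule left_idealI) auto

lemma left_ideal_carrier: "left_ideal (carrier R) R"
  by (rule left_idealI) auto

lemma left_ideal_principal: "a \<in> carrier R \<Longrightarrow> left_ideal (principal_left R a) R"
proof (rule left_idealI)
  assume a: "a \<in> carrier R"
  show "principal_left R a \<subseteq> carrier R" using a by (auto simp: principal_left_def)
  show "\<zero> \<in> principal_left R a" 
    unfolding principal_left_def using l_null[OF a, symmetric] by blast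
  show "x \<oplus> y \<in> principal_left R a"
    if "x \<in> principal_left R a" "y \<in> principal_left R a" for x y
    using that a unfolding principal_left_def
    by clarsimp (metis l_distr add.m_closed)
  show "y \<otimes> x \<in> principal_left R a" if "x \<in> principal_left R a" "y \<in> carrier R" for x y
    using that a unfolding principal_left_def by clarsimp (metis m_assoc m_closed)
qed

lemma principal_left_self: "a \<in> carrier R \<Longrightarrow> a \<in> principal_left R a"
  unfolding principal_left_def using l_one[of a, symmetric] by blast

lemma principal_left_subset:
  "left_ideal I R \<Longrightarrow> a \<in> I \<Longrightarrow> principal_left R a \<subseteq> I"
  by (auto simp: principal_left_def left_ideal_iff)

lemma left_ideal_adjoin:
  assumes I: "left_ideal I R" and t: "t \<in> carrier R"
  shows "left_ideal (adjoin_left R I t) R" "I \<subseteq> adjoin_left R I t" "t \<in> adjoin_left R I t"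
proof -
  note IC = left_idealD[OF I]
  show "left_ideal (adjoin_left R I t) R"
  proof (rule left_idealI)
    show "adjoin_left R I t \<subseteq> carrier R" using IC t by (auto simp: adjoin_left_def)
    show "\<zero> \<in> adjoin_left R I t"
      using IC t unfolding adjoin_left_def by clarsimp (metis l_null l_zero zero_closed)
    show "x \<oplus> y \<in> adjoin_left R I t"
      if xy: "x \<in> adjoin_left R I t" "y \<in> adjoin_left R I t" for x y
    proof -
      obtain i a j b where *: "i \<in> I" "a \<in> carrier R" "j \<in> I" "b \<in> carrier R"
        "x = i \<oplus> a \<otimes> t" "y = j \<oplus> b \<otimes> t"
        using xy unfolding adjoin_left_def by blast
      then have "x \<oplus> y = (i \<oplus> j) \<oplus> (a \<oplus> b) \<otimes> t"
        using IC(5) t by (simp add: l_distr a_ac)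
      then show ?thesis using * IC(3) by (auto simp: adjoin_left_def)
    qed
    show "y \<otimes> x \<in> adjoin_left R I t" if xy: "x \<in> adjoin_left R I t" "y \<in> carrier R" for x y
    proof -
      obtain i a where *: "i \<in> I" "a \<in> carrier R" "x = i \<oplus> a \<otimes> t"
        using xy unfolding adjoin_left_def by blast
      then have "y \<otimes> x = y \<otimes> i \<oplus> (y \<otimes> a) \<otimes> t"
        using IC(5) t xy by (simp add: r_distr m_assoc)
      then show ?thesis using * IC(4) xy by (auto simp: adjoin_left_def)
    qed
  qed
  show "I \<subseteq> adjoin_left R I t"
  proof
    fix i assume "i \<in> I"
    then show "i \<in> adjoin_left R I t"
      using IC(5) t unfolding adjoin_left_def
      by clarsimp (metis l_null r_zero zero_closed)
  qed
  show "t \<in> adjoin_left R I t"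
    using IC(2) t unfolding adjoin_left_def
    by clarsimp (metis l_one l_zero one_closed)
qed

lemma adjoin_left_subset:
  "left_ideal K R \<Longrightarrow> I \<subseteq> K \<Longrightarrow> t \<in> K \<Longrightarrow> adjoin_left R I t \<subseteq> K"
  by (auto simp: adjoin_left_def left_ideal_iff)

lemma left_ideal_lann:
  assumes "X \<subseteq> carrier R" shows "left_ideal (lann R X) R"
  by (rule left_idealI) (use assms in \<open>auto simp: lann_def l_distr m_assoc subset_iff\<close>)

lemma right_ideal_rann:
  assumes "X \<subseteq> carrier R" shows "left_ideal (rann R X) (opp_ring R)"
  by (rule right_idealI)
    (use assms in \<open>auto simp: rann_def r_distr m_assoc[symmetric] subset_iff\<close>)

lemma left_ideal_vimage:
  assumes K: "left_ideal K R" and x: "x \<in> carrier R"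
  shows "left_ideal {a \<in> carrier R. a \<otimes> x \<in> K} R"
  by (rule left_idealI) (use left_idealD[OF K] x in \<open>auto simp: l_distr m_assoc\<close>)

end

lemma left_noetherian_maximal:
  assumes N: "left_noetherian R" and ne: "I0 \<in> A" and A: "\<And>I. I \<in> A \<Longrightarrow> left_ideal I R"
  obtains M where "M \<in> A" "\<And>I. I \<in> A \<Longrightarrow> M \<subseteq> I \<Longrightarrow> I = M"
proof -
  have "\<exists>M\<in>A. \<forall>I\<in>A. M \<subseteq> I \<longrightarrow> I = M"
  proof (rule ccontr)
    assume "\<not> ?thesis"
    then have ex: "\<exists>I. I \<in> A \<and> M \<subset> I" if "M \<in> A" for M
      using that by blast
    obtain C where C: "\<And>n. C n \<in> A" "\<And>n. C n \<subset> C (Suc n)"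
      using dependent_nat_choice[of "\<lambda>_ I. I \<in> A" "\<lambda>_ I K. I \<subset> K"] ne ex by metis
    then have "\<forall>n. left_ideal (C n) R \<and> C n \<subseteq> C (Suc n)" using A by blast
    then obtain k where "\<forall>n\<ge>k. C n = C k"
      using N unfolding left_noetherian_def by blast
    then show False using C(2)[of k] by (metis le_Suc_eq order_refl psubset_eq)
  qed
  then show ?thesis using that by blast
qed


section \<open>A self-dual socle structure\<close>

text \<open>The injectivity test of Baer's criterion: homomorphisms from left ideals to \<open>R\<close> are right
  multiplications.\<close>

definition baer_left :: "('a, 'r) ring_scheme \<Rightarrow> bool" where
  "baer_left R \<longleftrightarrow> (\<forall>I f. left_ideal I R \<longrightarrow> f \<in> I \<rightarrow> carrier R \<longrightarrow>
     (\<forall>x\<in>I. \<forall>y\<in>I. f (x \<oplus>\<^bsub>R\<^esub> y) = f x \<oplus>\<^bsub>R\<^esub> f y) \<longrightarrow>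
     (\<forall>a\<in>carrier R. \<forall>x\<in>I. f (a \<otimes>\<^bsub>R\<^esub> x) = a \<otimes>\<^bsub>R\<^esub> f x) \<longrightarrow>
     (\<exists>c\<in>carrier R. \<forall>x\<in>I. f x = x \<otimes>\<^bsub>R\<^esub> c))"

text \<open>Here \<open>Z\<close> stands for the radical of a semiprimary ring and \<open>F\<close> for a finite set of local
  idempotents such that \<open>1\<close> is a sum of elements of \<open>F\<close>. The two Loewy conditions say that nonzero cyclic
  submodules of \<open>R/K\<close> contain a nonzero element killed by \<open>Z\<close>; they replace the nilpotency of \<open>Z\<close>. The two simplicity
  conditions say that the \<open>f\<close>-components of the socles are simple or zero. Every other condition is
  its own mirror image.\<close>

locale dual_socle = ring R for R :: "('a, 'r) ring_scheme" (structure) +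
  fixes Z F :: "'a set"
  assumes Z_carrier: "Z \<subseteq> carrier R"
    and Z_mult: "\<And>z r. z \<in> Z \<Longrightarrow> r \<in> carrier R \<Longrightarrow> z \<otimes> r \<in> Z"
      "\<And>z r. z \<in> Z \<Longrightarrow> r \<in> carrier R \<Longrightarrow> r \<otimes> z \<in> Z"
    and F_carrier: "F \<subseteq> carrier R"
    and F_idem: "\<And>f. f \<in> F \<Longrightarrow> f \<otimes> f = f"
    and one_generated: "\<And>K. K \<subseteq> carrier R \<Longrightarrow> \<zero> \<in> K \<Longrightarrow>
      (\<And>a b. a \<in> K \<Longrightarrow> b \<in> K \<Longrightarrow> a \<oplus> b \<in> K) \<Longrightarrow> F \<subseteq> K \<Longrightarrow> \<one> \<in> K"
    and left_loewy: "\<And>K x. left_ideal K R \<Longrightarrow> x \<in> carrier R \<Longrightarrow> x \<notin> K \<Longrightarrow>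
      \<exists>r\<in>carrier R. r \<otimes> x \<notin> K \<and> (\<forall>z\<in>Z. z \<otimes> (r \<otimes> x) \<in> K)"
    and right_loewy: "\<And>K x. left_ideal K (opp_ring R) \<Longrightarrow> x \<in> carrier R \<Longrightarrow> x \<notin> K \<Longrightarrow>
      \<exists>r\<in>carrier R. x \<otimes> r \<notin> K \<and> (\<forall>z\<in>Z. (x \<otimes> r) \<otimes> z \<in> K)"
    and right_simple: "\<And>f k k'. f \<in> F \<Longrightarrow> k \<in> carrier R \<Longrightarrow> k' \<in> carrier R \<Longrightarrow>
      f \<otimes> k = k \<Longrightarrow> f \<otimes> k' = k' \<Longrightarrow> (\<And>z. z \<in> Z \<Longrightarrow> z \<otimes> k = \<zero>) \<Longrightarrow>
      (\<And>z. z \<in> Z \<Longrightarrow> z \<otimes> k' = \<zero>) \<Longrightarrow> k \<noteq> \<zero> \<Longrightarrow> \<exists>r\<in>carrier R. k' = k \<otimes> r"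
    and left_simple: "\<And>f k k'. f \<in> F \<Longrightarrow> k \<in> carrier R \<Longrightarrow> k' \<in> carrier R \<Longrightarrow>
      k \<otimes> f = k \<Longrightarrow> k' \<otimes> f = k' \<Longrightarrow> (\<And>z. z \<in> Z \<Longrightarrow> k \<otimes> z = \<zero>) \<Longrightarrow>
      (\<And>z. z \<in> Z \<Longrightarrow> k' \<otimes> z = \<zero>) \<Longrightarrow> k \<noteq> \<zero> \<Longrightarrow> \<exists>r\<in>carrier R. k' = r \<otimes> k"

lemma dual_socle_opp_ring:
  assumes "dual_socle R Z F" shows "dual_socle (opp_ring R) Z F"
proof -
  interpret dual_socle R Z F by fact
  show ?thesis
    unfolding dual_socle_def dual_socle_axioms_def opp_ring_simps opp_opp_ring
    using ring_opp_ring[OF ring_axioms] Z_carrier Z_mult F_carrier F_idem one_generated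
      left_loewy right_loewy right_simple left_simple
    by (intro conjI; blast)
qed

text \<open>One step of a composition series: the factor \<open>K/I\<close> is a nonzero image of \<open>Rf/Zf\<close>.\<close>

definition simple_step :: "('a, 'r) ring_scheme \<Rightarrow> 'a set \<Rightarrow> 'a set \<Rightarrow> 'a set \<Rightarrow> 'a set \<Rightarrow> bool" where
  "simple_step R Z F I K \<longleftrightarrow> left_ideal I R \<and> (\<exists>f\<in>F. \<exists>t\<in>carrier R. f \<otimes>\<^bsub>R\<^esub> t = t \<and> t \<notin> I \<and>
     (\<forall>z\<in>Z. z \<otimes>\<^bsub>R\<^esub> t \<in> I) \<and> K = adjoin_left R I t)"

context dual_socle
begin

lemma simple_step_ideals:
  assumes "simple_step R Z F I K" shows "left_ideal I R" "left_ideal K R" "I \<subset> K"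
proof -
  obtain t where t: "left_ideal I R" "t \<in> carrier R" "t \<notin> I" "K = adjoin_left R I t"
    using assms unfolding simple_step_def by blast
  show "left_ideal I R" "left_ideal K R" "I \<subset> K"
    using t left_ideal_adjoin[OF t(1,2)] by auto
qed

text \<open>Some \<open>y \<in> K - I\<close> has \<open>Zy \<subseteq> I\<close>, and some \<open>fy\<close> lies outside \<open>I\<close> because \<open>1\<close> is a sum of elements
  of \<open>F\<close>.\<close>

lemma simple_step_exists:
  assumes I: "left_ideal I R" and K: "left_ideal K R" and sub: "I \<subset> K"
  obtains M where "simple_step R Z F I M" "M \<subseteq> K"
proof -
  note IC = left_idealD[OF I] and KC = left_idealD[OF K]
  obtain x where x: "x \<in> K" "x \<notin> I" using sub by blast
  obtain r where r: "r \<in> carrier R" "r \<otimes> x \<notin> I" "\<forall>z\<in>Z. z \<otimes> (r \<otimes> x) \<in> I"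
    using left_loewy[OF I KC(5)[OF x(1)] x(2)] by blast
  define y where "y = r \<otimes> x"
  have y: "y \<in> carrier R" "y \<in> K" using x r KC(4,5) by (auto simp: y_def)
  have "\<exists>f\<in>F. f \<otimes> y \<notin> I"
  proof (rule ccontr)
    assume *: "\<not> ?thesis"
    have "\<one> \<in> {a \<in> carrier R. a \<otimes> y \<in> I}" (is "_ \<in> ?V")
    proof (rule one_generated)
      note V = left_idealD[OF left_ideal_vimage[OF I y(1)]]
      show "?V \<subseteq> carrier R" "\<zero> \<in> ?V" by (fact V(1), fact V(2))
      show "a \<oplus> b \<in> ?V" if "a \<in> ?V" "b \<in> ?V" for a b using that by (rule V(3))
      show "F \<subseteq> ?V" using * F_carrier by auto
    qed
    then show False using r y by (simp add: y_def)
  qed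
  then obtain f where f: "f \<in> F" "f \<otimes> y \<notin> I" by blast
  have fc: "f \<in> carrier R" using f F_carrier by auto
  have zf: "z \<otimes> (f \<otimes> y) \<in> I" if "z \<in> Z" for z
    using r(3) Z_mult(1)[OF that fc] Z_carrier that fc y
    by (simp add: y_def[symmetric] m_assoc[symmetric] subset_iff)
  have "f \<otimes> (f \<otimes> y) = f \<otimes> y" using F_idem f fc y by (simp add: m_assoc[symmetric])
  then have "simple_step R Z F I (adjoin_left R I (f \<otimes> y))"
    unfolding simple_step_def
    by (intro conjI I bexI[OF _ f(1)] bexI[of _ "f \<otimes> y"] ballI f(2) zf refl)
      (simp_all add: fc y)
  moreover have "adjoin_left R I (f \<otimes> y) \<subseteq> K"
    using adjoin_left_subset[OF K] sub KC(4) y fc by blast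
  ultimately show ?thesis using that by blast
qed

lemma simple_chain_exists:
  assumes N: "left_noetherian R" and I: "left_ideal I R" and K: "left_ideal K R" and sub: "I \<subseteq> K"
  obtains n where "(simple_step R Z F ^^ n) I K"
proof -
  define A where "A = {M. left_ideal M R \<and> M \<subseteq> K \<and> (\<exists>n. (simple_step R Z F ^^ n) I M)}"
  have "I \<in> A" using I sub unfolding A_def by (auto intro: exI[of _ 0])
  then obtain M where M: "M \<in> A" "\<And>L. L \<in> A \<Longrightarrow> M \<subseteq> L \<Longrightarrow> L = M"
    using left_noetherian_maximal[OF N, of I A] A_def by blast
  have "M = K"
  proof (rule ccontr)
    assume "M \<noteq> K"
    then obtain L where L: "simple_step R Z F M L" "L \<subseteq> K"
      using simple_step_exists[of M K] M K unfolding A_def by blast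
    obtain n where "(simple_step R Z F ^^ n) I M" using M unfolding A_def by blast
    with L have "(simple_step R Z F ^^ Suc n) I L" by auto
    then have "L \<in> A" using L simple_step_ideals unfolding A_def by blast
    then show False using M(2)[of L] simple_step_ideals(3)[OF L(1)] by blast
  qed
  then show ?thesis using M that unfolding A_def by blast
qed

text \<open>The factor \<open>r(I)/r(K)\<close> is simple or zero: if \<open>K = I + Rt\<close> with \<open>t = ft\<close> and \<open>Zt \<subseteq> I\<close>, then
  \<open>x \<mapsto> tx\<close> embeds it into the \<open>f\<close>-component of \<open>r(Z)\<close>.\<close>

lemma rann_simple_step:
  assumes st: "simple_step R Z F I K" and y: "y \<in> rann R I" "y \<notin> rann R K" and x: "x \<in> rann R I"
  obtains s where "s \<in> carrier R" "x \<ominus> y \<otimes> s \<in> rann R K"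
proof -
  obtain f t where f: "f \<in> F" and t: "t \<in> carrier R" "f \<otimes> t = t" "t \<notin> I"
    "\<forall>z\<in>Z. z \<otimes> t \<in> I" "K = adjoin_left R I t" and I: "left_ideal I R"
    using st unfolding simple_step_def by metis
  note IC = left_idealD[OF I]
  have c: "x \<in> carrier R" "y \<in> carrier R" "f \<in> carrier R"
    using x y(1) f F_carrier by (auto simp: rann_def)
  have K: "w \<in> rann R K" if w: "w \<in> rann R I" "t \<otimes> w = \<zero>" for w
  proof -
    have wc: "w \<in> carrier R" using w by (simp add: rann_def)
    have "(i \<oplus> a \<otimes> t) \<otimes> w = \<zero>" if "i \<in> I" "a \<in> carrier R" for i a
      using that w IC(5) t(1) wc by (simp add: l_distr m_assoc rann_def)
    then show ?thesis using wc unfolding rann_def t(5) adjoin_left_def by blast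
  qed
  have ty: "t \<otimes> y \<noteq> \<zero>" using K[OF y(1)] y(2) by blast
  have kill: "z \<otimes> (t \<otimes> w) = \<zero>" if "z \<in> Z" "w \<in> rann R I" for z w
  proof -
    have w: "w \<in> carrier R" "\<forall>i\<in>I. i \<otimes> w = \<zero>" using that(2) by (simp_all add: rann_def)
    have "z \<otimes> (t \<otimes> w) = (z \<otimes> t) \<otimes> w"
      using that(1) Z_carrier t(1) w(1) by (simp add: m_assoc subset_iff)
    then show ?thesis using w(2) t(4) that(1) by simp
  qed
  have fw: "f \<otimes> (t \<otimes> w) = t \<otimes> w" if "w \<in> carrier R" for w
    using that c t(1,2) by (simp add: m_assoc[symmetric])
  obtain s where s: "s \<in> carrier R" "t \<otimes> x = (t \<otimes> y) \<otimes> s"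
    using right_simple[OF f m_closed[OF t(1) c(2)] m_closed[OF t(1) c(1)] fw[OF c(2)] fw[OF c(1)]
        kill[OF _ y(1)] kill[OF _ x] ty] by blast
  have xys: "x \<ominus> y \<otimes> s \<in> rann R I"
  proof -
    note A = right_idealD[OF right_ideal_rann[OF IC(1)]]
    show ?thesis by (rule A(7)[OF x A(4)[OF y(1) s(1)]])
  qed
  have "t \<otimes> (x \<ominus> y \<otimes> s) = t \<otimes> x \<ominus> t \<otimes> (y \<otimes> s)"
    using t(1) c s(1) by (simp add: minus_eq r_distr r_minus)
  also have "\<dots> = \<zero>" using s t(1) c by (simp add: m_assoc r_neg minus_eq)
  finally show ?thesis using that s K[OF xys] by blast
qed

text \<open>A length function for right ideals: count the factors of the annihilator series that a right
  ideal meets. If \<open>U \<subset> V\<close>, take \<open>x \<in> V - U\<close> in the smallest possible \<open>r(X i)\<close>. Then \<open>V\<close> meets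
  the factor at \<open>i\<close>, and \<open>U\<close> does not: otherwise \<open>x\<close> could be moved down by a multiple of an element of
  \<open>U\<close>.\<close>

lemma simple_chain_measures_right_ideals:
  assumes X: "X 0 = {\<zero>}" "X m = carrier R" "\<And>i. i < m \<Longrightarrow> simple_step R Z F (X i) (X (Suc i))"
    and U: "left_ideal U (opp_ring R)" and V: "left_ideal V (opp_ring R)" and sub: "U \<subset> V"
  shows "card {i. i < m \<and> \<not> U \<inter> rann R (X i) \<subseteq> rann R (X (Suc i))}
    < card {i. i < m \<and> \<not> V \<inter> rann R (X i) \<subseteq> rann R (X (Suc i))}" (is "card ?A < card ?B")
proof (rule psubset_card_mono)
  show "finite ?B" by simp
  note UC = right_idealD[OF U] and VC = right_idealD[OF V]
  let ?P = "\<lambda>i. (V - U) \<inter> rann R (X i) \<noteq> {}"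
  have "?P 0" using sub VC(5) by (auto simp: X rann_def)
  moreover have "\<not> ?P m"
  proof -
    have "w = \<zero>" if "w \<in> rann R (carrier R)" for w
    proof -
      have w: "w \<in> carrier R" "\<one> \<otimes> w = \<zero>" using that by (auto simp: rann_def)
      then show ?thesis by simp
    qed
    then show ?thesis using UC(2) by (auto simp: X)
  qed
  ultimately have "\<exists>k<m. (\<forall>i\<le>k. \<not> \<not> ?P i) \<and> \<not> ?P (Suc k)"
    by (intro ex_least_nat_less) simp_all
  then obtain i where i: "i < m" "?P i" "\<not> ?P (Suc i)"
    by blast
  then obtain x where x: "x \<in> V" "x \<notin> U" "x \<in> rann R (X i)" by blast
  have "i \<in> ?B" using i x by blast
  moreover have "i \<notin> ?A"
  proof
    assume "i \<in> ?A"
    then obtain y where y: "y \<in> U" "y \<in> rann R (X i)" "y \<notin> rann R (X (Suc i))" by blast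
    obtain s where s: "s \<in> carrier R" "x \<ominus> y \<otimes> s \<in> rann R (X (Suc i))"
      using rann_simple_step[OF X(3)[OF i(1)] y(2,3) x(3)] by blast
    have ys: "y \<otimes> s \<in> U" using UC(4) y s by blast
    have "x \<ominus> y \<otimes> s \<in> V" using VC(7) x(1) ys sub by blast
    moreover have "x \<ominus> y \<otimes> s \<notin> U"
    proof
      assume "x \<ominus> y \<otimes> s \<in> U"
      then have "(x \<ominus> y \<otimes> s) \<oplus> y \<otimes> s \<in> U" using ys UC(3) by blast
      then show False using x VC(5) UC(5) ys by (simp add: minus_eq a_assoc l_neg)
    qed
    ultimately show False using i(3) s by blast
  qed
  ultimately show "?A \<subset> ?B" using sub by blast
qed

lemma right_chain_length_le:
  assumes X: "X 0 = {\<zero>}" "X m = carrier R" "\<And>i. i < m \<Longrightarrow> simple_step R Z F (X i) (X (Suc i))"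
    and Y: "\<And>j. j \<le> n \<Longrightarrow> left_ideal (Y j) (opp_ring R)" "\<And>j. j < n \<Longrightarrow> Y j \<subset> Y (Suc j)"
  shows "n \<le> card {i. i < m \<and> rann R (X i) \<noteq> rann R (X (Suc i))}"
proof -
  define l where "l U = card {i. i < m \<and> \<not> U \<inter> rann R (X i) \<subseteq> rann R (X (Suc i))}" for U
  have "j \<le> n \<Longrightarrow> j \<le> l (Y j)" for j
  proof (induction j)
    case (Suc j)
    have "l (Y j) < l (Y (Suc j))" unfolding l_def
      by (rule simple_chain_measures_right_ideals[OF X]) (use Suc Y in auto)
    then show ?case using Suc by simp
  qed simp
  then have "n \<le> l (Y n)" by simp
  also have "\<dots> \<le> card {i. i < m \<and> rann R (X i) \<noteq> rann R (X (Suc i))}"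
    unfolding l_def by (rule card_mono) auto
  finally show ?thesis .
qed

text \<open>Along an ascending chain of right ideals the length function of a composition series of left
  ideals increases and is bounded.\<close>

lemma right_noetherian_of_left:
  assumes N: "left_noetherian R"
  shows "left_noetherian (opp_ring R)"
proof -
  obtain m where "(simple_step R Z F ^^ m) {\<zero>} (carrier R)"
    by (rule simple_chain_exists[OF N left_ideal_zero left_ideal_carrier]) simp
  then obtain X where X: "X 0 = {\<zero>}" "X m = carrier R"
    "\<And>i. i < m \<Longrightarrow> simple_step R Z F (X i) (X (Suc i))"
    unfolding relpowp_fun_conv by blast
  define l where "l U = card {i. i < m \<and> \<not> U \<inter> rann R (X i) \<subseteq> rann R (X (Suc i))}" for U
  show ?thesis unfolding left_noetherian_def
  proof (intro allI impI)
    fix C :: "nat \<Rightarrow> 'a set" assume C: "\<forall>n. left_ideal (C n) (opp_ring R) \<and> C n \<subseteq> C (Suc n)"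
    have bound: "l U \<le> m" for U
    proof -
      have "l U \<le> card {..<m}" unfolding l_def by (rule card_mono) auto
      then show ?thesis by simp
    qed
    then obtain n where n: "\<And>k. l (C k) \<le> l (C n)"
      using ex_has_greatest_nat[of "\<lambda>_. True" 0 "\<lambda>k. l (C k)" "Suc m"] by (auto simp: le_imp_less_Suc)
    have "C k = C n" if "k \<ge> n" for k
    proof (rule ccontr)
      assume "C k \<noteq> C n"
      moreover have "C n \<subseteq> C k" using lift_Suc_mono_le[of C n k] C that by auto
      ultimately have "l (C n) < l (C k)" unfolding l_def
        using simple_chain_measures_right_ideals[OF X] C by blast
      then show False using n[of k] by simp
    qed
    then show "\<exists>N. \<forall>n\<ge>N. C n = C N" by blast
  qed
qed

end

lemma (in dual_socle) opp_socle: "dual_socle (opp_ring R) Z F"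
  by (rule dual_socle_opp_ring) unfold_locales

lemma (in dual_socle) left_noetherian_of_right:
  "left_noetherian (opp_ring R) \<Longrightarrow> left_noetherian R"
  using dual_socle.right_noetherian_of_left[OF opp_socle] by simp

text \<open>Suppose that \<open>I\<close> is smaller than \<open>l(r(I))\<close>, and run a composition series \<open>X\<close> of left ideals of
  length \<open>m\<close> through \<open>I\<close> and a step \<open>K \<subseteq> l(r(I))\<close> above \<open>I\<close>. As \<open>r(I) = r(K)\<close>, the annihilator
  series has a zero factor, so right ideals have length less than \<open>m\<close>. A composition series of right
  ideals then bounds the length of left ideals by less than \<open>m\<close>, against \<open>X\<close> itself.\<close>

lemma (in dual_socle) left_double_annihilator:
  assumes LN: "left_noetherian R" and RN: "left_noetherian (opp_ring R)" and I: "left_ideal I R"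
  shows "lann R (rann R I) = I"
proof (rule ccontr)
  assume ne: "lann R (rann R I) \<noteq> I"
  interpret opp: dual_socle "opp_ring R" Z F by (rule opp_socle)
  note IC = left_idealD[OF I]
  have sub: "I \<subseteq> lann R (rann R I)" using IC(5) by (auto simp: lann_def rann_def)
  have id: "left_ideal (lann R (rann R I)) R"
    by (rule left_ideal_lann) (auto simp: rann_def)
  obtain K where K: "simple_step R Z F I K" "K \<subseteq> lann R (rann R I)"
    using simple_step_exists[OF I id] sub ne by blast
  have KI: "rann R K = rann R I"
    using simple_step_ideals(3)[OF K(1)] K(2) by (auto simp: rann_def lann_def)
  obtain a where "(simple_step R Z F ^^ a) {\<zero>} I"
    by (rule simple_chain_exists[OF LN left_ideal_zero I]) (use IC(2) in simp)
  then obtain X1 where X1: "X1 0 = {\<zero>}" "X1 a = I"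
    "\<And>i. i < a \<Longrightarrow> simple_step R Z F (X1 i) (X1 (Suc i))"
    unfolding relpowp_fun_conv by blast
  have Kid: "left_ideal K R" using simple_step_ideals K by blast
  obtain c where "(simple_step R Z F ^^ c) K (carrier R)"
    by (rule simple_chain_exists[OF LN Kid left_ideal_carrier left_idealD(1)[OF Kid]])
  then obtain X2 where X2: "X2 0 = K" "X2 c = carrier R"
    "\<And>i. i < c \<Longrightarrow> simple_step R Z F (X2 i) (X2 (Suc i))"
    unfolding relpowp_fun_conv by blast
  define X where "X i = (if i \<le> a then X1 i else X2 (i - Suc a))" for i
  define m where "m = Suc (a + c)"
  have X: "X 0 = {\<zero>}" "X m = carrier R" using X1 X2 by (auto simp: X_def m_def)
  have Xs: "simple_step R Z F (X i) (X (Suc i))" if "i < m" for i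
  proof -
    consider "i < a" | "i = a" | "i > a" by linarith
    then show ?thesis
    proof cases
      case 3
      then have "Suc i - Suc a = Suc (i - Suc a)" "i - Suc a < c" using that by (auto simp: m_def)
      then show ?thesis using X2(3)[of "i - Suc a"] 3 by (simp add: X_def)
    qed (use X1 X2 K in \<open>auto simp: X_def\<close>)
  qed
  obtain n where "(simple_step (opp_ring R) Z F ^^ n) {\<zero>} (carrier R)"
    by (rule opp.simple_chain_exists[OF RN opp.left_ideal_zero opp.left_ideal_carrier]) auto
  then obtain Y where Y: "Y 0 = {\<zero>}" "Y n = carrier R"
    "\<And>i. i < n \<Longrightarrow> simple_step (opp_ring R) Z F (Y i) (Y (Suc i))"
    unfolding relpowp_fun_conv by blast
  have Yid: "left_ideal (Y j) (opp_ring R)" if "j \<le> n" for j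
    using that opp.simple_step_ideals(1)[OF Y(3)[of j]] Y(2) opp.left_ideal_carrier
    by (cases "j = n") auto
  have Xid: "left_ideal (X j) R" if "j \<le> m" for j
    using that simple_step_ideals(1)[OF Xs[of j]] X(2) left_ideal_carrier
    by (cases "j = m") auto
  have "n \<le> card {i. i < m \<and> rann R (X i) \<noteq> rann R (X (Suc i))}"
    by (rule right_chain_length_le[OF X Xs Yid]) (use opp.simple_step_ideals(3)[OF Y(3)] in simp_all)
  also have "\<dots> \<le> card ({..<m} - {a})"
  proof (rule card_mono)
    have "X a = I" "X (Suc a) = K" using X1 X2 by (auto simp: X_def)
    then show "{i. i < m \<and> rann R (X i) \<noteq> rann R (X (Suc i))} \<subseteq> {..<m} - {a}"
      using KI by auto
  qed simp
  also have "\<dots> < m" by (simp add: m_def)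
  also have "m \<le> card {i. i < n \<and> rann (opp_ring R) (Y i) \<noteq> rann (opp_ring R) (Y (Suc i))}"
    by (rule opp.right_chain_length_le[of Y n m X])
      (use Y Xid simple_step_ideals(3)[OF Xs] in simp_all)
  also have "\<dots> \<le> card {..<n}" by (rule card_mono) auto
  finally show False by simp
qed

lemma (in dual_socle) right_double_annihilator:
  assumes "left_noetherian R" "left_noetherian (opp_ring R)" "left_ideal T (opp_ring R)"
  shows "rann R (lann R T) = T"
  using dual_socle.left_double_annihilator[OF opp_socle, of T] assms by simp

text \<open>The extension step from \<open>K\<close> to \<open>K + Ra\<close> is the argument of Ikeda and Nakayama: two right multiplications that
  agree on \<open>K \<inter> Ra\<close> differ by an element of \<open>r(K \<inter> Ra) = r(K) + r(a)\<close>.\<close>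

lemma (in dual_socle) baer_of_noetherian:
  assumes LN: "left_noetherian R"
  shows "baer_left R"
  unfolding baer_left_def
proof (intro allI impI)
  have RN: "left_noetherian (opp_ring R)" by (rule right_noetherian_of_left[OF LN])
  fix I f assume I: "left_ideal I R" and fc: "f \<in> I \<rightarrow> carrier R"
    and add: "\<forall>x\<in>I. \<forall>y\<in>I. f (x \<oplus> y) = f x \<oplus> f y"
    and smult: "\<forall>a\<in>carrier R. \<forall>x\<in>I. f (a \<otimes> x) = a \<otimes> f x"
  note IC = left_idealD[OF I]
  have fz: "f \<zero> = \<zero>"
  proof -
    have "f (\<zero> \<otimes> \<zero>) = \<zero> \<otimes> f \<zero>" using smult IC(2) zero_closed by blast
    then show ?thesis using fc IC(2) by (simp add: Pi_iff)
  qed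
  define A where "A = {K. left_ideal K R \<and> K \<subseteq> I \<and> (\<exists>c\<in>carrier R. \<forall>x\<in>K. f x = x \<otimes> c)}"
  have "{\<zero>} \<in> A" unfolding A_def using left_ideal_zero IC(2) fz by auto
  then obtain K where K: "K \<in> A" "\<And>L. L \<in> A \<Longrightarrow> K \<subseteq> L \<Longrightarrow> L = K"
    using left_noetherian_maximal[OF LN, of "{\<zero>}" A] A_def by blast
  then obtain c where c: "c \<in> carrier R" "\<forall>x\<in>K. f x = x \<otimes> c" and Kid: "left_ideal K R" "K \<subseteq> I"
    unfolding A_def by blast
  note KC = left_idealD[OF Kid(1)]
  have "K = I"
  proof (rule ccontr)
    assume "K \<noteq> I"
    then obtain a where a: "a \<in> I" "a \<notin> K" using Kid by blast
    have ac: "a \<in> carrier R" "f a \<in> carrier R" using a IC fc by auto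
    have pid: "left_ideal (principal_left (opp_ring R) a) (opp_ring R)"
      by (rule ring.left_ideal_principal[OF ring_opp_ring[OF ring_axioms]]) (simp add: ac)
    have aP: "a \<in> principal_left (opp_ring R) a"
      using ring.principal_left_self[OF ring_opp_ring[OF ring_axioms]] ac by simp
    have "f a \<in> rann R (lann R (principal_left (opp_ring R) a))"
    proof -
      have "y \<otimes> f a = \<zero>" if "y \<in> lann R (principal_left (opp_ring R) a)" for y
      proof -
        have y: "y \<in> carrier R" "y \<otimes> a = \<zero>" using that aP by (auto simp: lann_def)
        have "y \<otimes> f a = f (y \<otimes> a)" using smult y(1) a(1) by simp
        then show ?thesis using y fz by simp
      qed
      then show ?thesis using ac by (simp add: rann_def)
    qed
    then obtain d where d: "d \<in> carrier R" "f a = a \<otimes> d"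
      unfolding right_double_annihilator[OF LN RN pid] by (auto simp: principal_left_def)
    define T where "T = {u \<oplus> v | u v. u \<in> rann R K \<and> v \<in> rann R {a}}"
    note U = right_idealD[OF right_ideal_rann[OF KC(1)]]
    have "{a} \<subseteq> carrier R" using ac by simp
    note V = right_idealD[OF right_ideal_rann[OF this]]
    have T: "left_ideal T (opp_ring R)"
    proof (rule right_idealI)
      show "T \<subseteq> carrier R" using U(5) V(5) by (auto simp: T_def)
      have "\<zero> = \<zero> \<oplus> \<zero>" by simp
      then show "\<zero> \<in> T" unfolding T_def using U(2) V(2) by blast
      show "x \<oplus> y \<in> T" if xy: "x \<in> T" "y \<in> T" for x y
      proof -
        obtain u v u' v' where *: "u \<in> rann R K" "v \<in> rann R {a}" "u' \<in> rann R K" "v' \<in> rann R {a}"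
          "x = u \<oplus> v" "y = u' \<oplus> v'" using xy unfolding T_def by blast
        then have "x \<oplus> y = (u \<oplus> u') \<oplus> (v \<oplus> v')" using U(5) V(5) by (simp add: a_ac)
        then show ?thesis unfolding T_def using * U(3) V(3) by blast
      qed
      show "x \<otimes> y \<in> T" if xy: "x \<in> T" "y \<in> carrier R" for x y
      proof -
        obtain u v where *: "u \<in> rann R K" "v \<in> rann R {a}" "x = u \<oplus> v"
          using xy unfolding T_def by blast
        then have "x \<otimes> y = u \<otimes> y \<oplus> v \<otimes> y" using U(5) V(5) xy by (simp add: l_distr)
        then show ?thesis unfolding T_def using * U(4) V(4) xy by blast
      qed
    qed
    have "c \<ominus> d \<in> rann R (lann R T)"
    proof -
      have "y \<otimes> (c \<ominus> d) = \<zero>" if y: "y \<in> lann R T" for y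
      proof -
        have yc: "y \<in> carrier R" using y by (simp add: lann_def)
        have "u \<in> T" if "u \<in> rann R K" for u
        proof -
          have "u = u \<oplus> \<zero>" using that U(5) by simp
          then show ?thesis unfolding T_def using that V(2) by blast
        qed
        then have "y \<in> lann R (rann R K)" using y by (auto simp: lann_def)
        then have yK: "y \<in> K" using left_double_annihilator[OF LN RN Kid(1)] by simp
        have vT: "v \<in> T" if "v \<in> rann R {a}" for v
        proof -
          have "v = \<zero> \<oplus> v" using that V(5) by simp
          then show ?thesis unfolding T_def using that U(2) by blast
        qed
        have "rann R (principal_left R a) \<subseteq> rann R {a}"
          using principal_left_self[OF ac(1)] by (auto simp: rann_def)
        then have "y \<in> lann R (rann R (principal_left R a))" using y vT by (auto simp: lann_def)
        then have "y \<in> principal_left R a"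
          using left_double_annihilator[OF LN RN left_ideal_principal[OF ac(1)]] by simp
        then obtain r where r: "r \<in> carrier R" "y = r \<otimes> a" by (auto simp: principal_left_def)
        have "f y = y \<otimes> d" using smult r a d ac by (simp add: m_assoc)
        moreover have "f y = y \<otimes> c" using yK c by blast
        ultimately show ?thesis using yc c d by (simp add: minus_eq r_distr r_minus r_neg)
      qed
      then show ?thesis using c d by (simp add: rann_def)
    qed
    then have "c \<ominus> d \<in> T" unfolding right_double_annihilator[OF LN RN T] .
    then obtain u v where uv: "u \<in> rann R K" "v \<in> rann R {a}" "c \<ominus> d = u \<oplus> v"
      unfolding T_def by blast
    have uvc: "u \<in> carrier R" "v \<in> carrier R" using uv U(5) V(5) by auto
    have cd: "c \<ominus> u = d \<oplus> v"
    proof -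
      have "c = (c \<ominus> d) \<oplus> d" using c d by (simp add: minus_eq a_assoc l_neg)
      then have "c = u \<oplus> v \<oplus> d" using uv by simp
      then have "c \<ominus> u = (u \<oplus> v \<oplus> d) \<oplus> \<ominus> u" by (simp add: minus_eq)
      also have "\<dots> = (u \<oplus> \<ominus> u) \<oplus> (d \<oplus> v)"
        using uvc d(1) by (simp add: a_ac)
      finally show ?thesis using uvc d by (simp add: r_neg)
    qed
    define e where "e = c \<ominus> u"
    have e: "e \<in> carrier R" using c uvc by (simp add: e_def)
    have eK: "f x = x \<otimes> e" if "x \<in> K" for x
    proof -
      have "x \<otimes> u = \<zero>" using that uv by (simp add: rann_def)
      then show ?thesis using that c uvc KC(5) by (simp add: e_def minus_eq r_distr r_minus)
    qed
    have ea: "f a = a \<otimes> e"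
    proof -
      have "a \<otimes> v = \<zero>" using uv by (simp add: rann_def)
      then show ?thesis using d uvc ac by (simp add: e_def cd r_distr)
    qed
    have "f x = x \<otimes> e" if x: "x \<in> adjoin_left R K a" for x
    proof -
      obtain i r where ir: "i \<in> K" "r \<in> carrier R" "x = i \<oplus> r \<otimes> a"
        using x unfolding adjoin_left_def by blast
      have "r \<otimes> a \<in> I" "i \<in> I" using IC(4) a ir Kid by auto
      then have "f x = f i \<oplus> r \<otimes> f a" using ir add smult a by simp
      then show ?thesis using eK[OF ir(1)] ea ir KC(5) e ac by (simp add: l_distr m_assoc)
    qed
    then have "adjoin_left R K a \<in> A"
      unfolding A_def using left_ideal_adjoin[OF Kid(1) ac(1)] adjoin_left_subset[OF I Kid(2) a(1)] e
      by blast
    then show False using K(2) left_ideal_adjoin[OF Kid(1) ac(1)] a by blast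
  qed
  then show "\<exists>c\<in>carrier R. \<forall>x\<in>I. f x = x \<otimes> c" using c by blast
qed


section \<open>Baer's criterion and 2-injectivity\<close>

lemma baer_leftE:
  assumes "baer_left R" "left_ideal I R" "f \<in> I \<rightarrow> carrier R"
    "\<And>x y. x \<in> I \<Longrightarrow> y \<in> I \<Longrightarrow> f (x \<oplus>\<^bsub>R\<^esub> y) = f x \<oplus>\<^bsub>R\<^esub> f y"
    "\<And>a x. a \<in> carrier R \<Longrightarrow> x \<in> I \<Longrightarrow> f (a \<otimes>\<^bsub>R\<^esub> x) = a \<otimes>\<^bsub>R\<^esub> f x"
  obtains c where "c \<in> carrier R" "\<forall>x\<in>I. f x = x \<otimes>\<^bsub>R\<^esub> c"
  using assms(1)[unfolded baer_left_def, rule_format, OF assms(2,3)] assms(4,5) that by metis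

lemma left_module_homI:
  assumes "f \<in> carrier M \<rightarrow> carrier N"
    "\<And>x y. x \<in> carrier M \<Longrightarrow> y \<in> carrier M \<Longrightarrow> f (x \<oplus>\<^bsub>M\<^esub> y) = f x \<oplus>\<^bsub>N\<^esub> f y"
    "\<And>a x. a \<in> carrier R \<Longrightarrow> x \<in> carrier M \<Longrightarrow> f (a \<odot>\<^bsub>M\<^esub> x) = a \<odot>\<^bsub>N\<^esub> f x"
  shows "f \<in> left_module_hom R M N"
  using assms by (simp add: left_module_hom_def)

lemma left_module_homD:
  assumes "f \<in> left_module_hom R M N"
  shows "\<And>x. x \<in> carrier M \<Longrightarrow> f x \<in> carrier N"
    "\<And>x y. x \<in> carrier M \<Longrightarrow> y \<in> carrier M \<Longrightarrow> f (x \<oplus>\<^bsub>M\<^esub> y) = f x \<oplus>\<^bsub>N\<^esub> f y"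
    "\<And>a x. a \<in> carrier R \<Longrightarrow> x \<in> carrier M \<Longrightarrow> f (a \<odot>\<^bsub>M\<^esub> x) = a \<odot>\<^bsub>N\<^esub> f x"
  using assms by (auto simp: left_module_hom_def Pi_iff)

lemma left_ideal_module_simps [simp]:
  "carrier (left_ideal_module R I) = I"
  "\<zero>\<^bsub>left_ideal_module R I\<^esub> = \<zero>\<^bsub>R\<^esub>"
  "x \<oplus>\<^bsub>left_ideal_module R I\<^esub> y = x \<oplus>\<^bsub>R\<^esub> y"
  "a \<odot>\<^bsub>left_ideal_module R I\<^esub> x = a \<otimes>\<^bsub>R\<^esub> x"
  by (simp_all add: left_ideal_module_def)

text \<open>A copy of a left ideal on the carrier type of the test modules.\<close>

definition tagged_left_ideal :: "('a, 'r) ring_scheme \<Rightarrow> 'a set \<Rightarrow> ('a, 'a + 'm) module" where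
  "tagged_left_ideal R I =
     \<lparr>carrier = Inl ` I, mult = \<lambda>u v. u, one = Inl \<zero>\<^bsub>R\<^esub>, zero = Inl \<zero>\<^bsub>R\<^esub>,
      add = \<lambda>u v. Inl (projl u \<oplus>\<^bsub>R\<^esub> projl v), smult = \<lambda>a u. Inl (a \<otimes>\<^bsub>R\<^esub> projl u)\<rparr>"

lemma tagged_left_ideal_simps [simp]:
  "carrier (tagged_left_ideal R I) = Inl ` I"
  "\<zero>\<^bsub>tagged_left_ideal R I\<^esub> = Inl \<zero>\<^bsub>R\<^esub>"
  "u \<oplus>\<^bsub>tagged_left_ideal R I\<^esub> v = Inl (projl u \<oplus>\<^bsub>R\<^esub> projl v)"
  "a \<odot>\<^bsub>tagged_left_ideal R I\<^esub> u = Inl (a \<otimes>\<^bsub>R\<^esub> projl u)"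
  by (simp_all add: tagged_left_ideal_def)

context ring
begin

lemma left_module_left_ideal:
  assumes "left_ideal I R" shows "left_module R (left_ideal_module R I)"
proof -
  note I = left_idealD[OF assms]
  have "abelian_group (left_ideal_module R I)"
  proof (rule abelian_groupI)
    fix x assume "x \<in> carrier (left_ideal_module R I)"
    then show "\<exists>y\<in>carrier (left_ideal_module R I).
        y \<oplus>\<^bsub>left_ideal_module R I\<^esub> x = \<zero>\<^bsub>left_ideal_module R I\<^esub>"
      using I(5,6) by (auto intro!: bexI[of _ "\<ominus> x"] l_neg)
  qed (use I(2,3,5) a_assoc in \<open>auto intro: a_comm\<close>)
  then show ?thesis
    unfolding left_module_def left_module_axioms_def
    using I(4,5) by (simp add: ring_axioms l_distr r_distr m_assoc)
qed

lemma left_module_tagged_left_ideal: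
  assumes "left_ideal I R" shows "left_module R (tagged_left_ideal R I)"
proof -
  note I = left_idealD[OF assms]
  have "abelian_group (tagged_left_ideal R I)" (is "abelian_group ?M")
  proof (rule abelian_groupI)
    fix x assume "x \<in> carrier ?M"
    then show "\<exists>y\<in>carrier ?M. y \<oplus>\<^bsub>?M\<^esub> x = \<zero>\<^bsub>?M\<^esub>"
      using I(5,6) by (auto intro!: bexI[of _ "\<ominus> projl x"] l_neg)
  qed (use I(2,3,5) a_assoc in \<open>auto intro: a_comm\<close>)
  then show ?thesis
    unfolding left_module_def left_module_axioms_def
    using I(4,5) by (auto simp: ring_axioms l_distr r_distr m_assoc)
qed

end

lemma (in left_module) smult_zero: "x \<in> carrier M \<Longrightarrow> \<zero> \<odot>\<^bsub>M\<^esub> x = \<zero>\<^bsub>M\<^esub>"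
proof -
  assume x: "x \<in> carrier M"
  have "\<zero> \<odot>\<^bsub>M\<^esub> x \<oplus>\<^bsub>M\<^esub> \<zero> \<odot>\<^bsub>M\<^esub> x = (\<zero> \<oplus> \<zero>) \<odot>\<^bsub>M\<^esub> x"
    using x by (simp only: smult_l_distr R.zero_closed)
  then show ?thesis using x smult_closed[of \<zero> x] by simp
qed

lemma (in left_module) smult_minus_one:
  assumes x: "x \<in> carrier M" shows "(\<ominus> \<one>) \<odot>\<^bsub>M\<^esub> x = \<ominus>\<^bsub>M\<^esub> x"
proof -
  have "(\<ominus> \<one>) \<odot>\<^bsub>M\<^esub> x \<oplus>\<^bsub>M\<^esub> x = (\<ominus> \<one> \<oplus> \<one>) \<odot>\<^bsub>M\<^esub> x"
    using x smult_l_distr[of "\<ominus> \<one>" \<one> x] by (simp add: smult_one)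
  also have "\<dots> = \<zero>\<^bsub>M\<^esub>" using x smult_zero by (simp add: R.l_neg)
  finally show ?thesis
    using x smult_closed[of "\<ominus> \<one>" x] by (metis M.minus_equality R.a_inv_closed R.one_closed)
qed

text \<open>Baer's criterion. Partial extensions are kept as graphs: submodules \<open>G\<close> of \<open>N \<times> R\<close> that meet
  \<open>0 \<times> R\<close> trivially. If \<open>G\<close> is maximal and \<open>n\<close> is any element of \<open>N\<close>, then on the left ideal of all
  \<open>a\<close> with \<open>an\<close> in the domain of \<open>G\<close> the map \<open>a \<mapsto> G(an)\<close> is right multiplication by some \<open>c\<close>, and
  \<open>n \<mapsto> c\<close> is compatible with \<open>G\<close>.\<close>

lemma (in ring) baer_left_imp_injective:
  assumes baer: "baer_left R"
  shows "injective_left_module TYPE('c) R (regular_left_module R)"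
  unfolding injective_left_module_def
proof (intro conjI allI impI ballI)
  show "left_module R (regular_left_module R)"
    by (rule left_module_left_ideal[OF left_ideal_carrier])
  fix M N :: "('a, 'c) module" and i f
  assume "left_module R M \<and> left_module R N"
  then interpret M: left_module R M + N: left_module R N by auto
  assume i: "i \<in> left_module_hom R M N" and inj: "inj_on i (carrier M)"
    and f: "f \<in> left_module_hom R M (regular_left_module R)"
  note iD = left_module_homD[OF i] and fD = left_module_homD[OF f, simplified]
  define A where "A = {G. G \<subseteq> carrier N \<times> carrier R
      \<and> (\<forall>m v n w. (m, v) \<in> G \<longrightarrow> (n, w) \<in> G \<longrightarrow> (m \<oplus>\<^bsub>N\<^esub> n, v \<oplus> w) \<in> G)
      \<and> (\<forall>a\<in>carrier R. \<forall>m v. (m, v) \<in> G \<longrightarrow> (a \<odot>\<^bsub>N\<^esub> m, a \<otimes> v) \<in> G)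
      \<and> (\<forall>v. (\<zero>\<^bsub>N\<^esub>, v) \<in> G \<longrightarrow> v = \<zero>) \<and> (\<forall>x\<in>carrier M. (i x, f x) \<in> G)}"
  have AI: "G \<in> A" if "G \<subseteq> carrier N \<times> carrier R"
      "\<And>m v n w. (m, v) \<in> G \<Longrightarrow> (n, w) \<in> G \<Longrightarrow> (m \<oplus>\<^bsub>N\<^esub> n, v \<oplus> w) \<in> G"
      "\<And>a m v. a \<in> carrier R \<Longrightarrow> (m, v) \<in> G \<Longrightarrow> (a \<odot>\<^bsub>N\<^esub> m, a \<otimes> v) \<in> G"
      "\<And>v. (\<zero>\<^bsub>N\<^esub>, v) \<in> G \<Longrightarrow> v = \<zero>" "\<And>x. x \<in> carrier M \<Longrightarrow> (i x, f x) \<in> G" for G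
    using that unfolding A_def by blast
  have i0: "i \<zero>\<^bsub>M\<^esub> = \<zero>\<^bsub>N\<^esub>"
    using iD(3)[of \<zero> "\<zero>\<^bsub>M\<^esub>"] M.smult_zero N.smult_zero iD(1) by simp
  have f0: "f \<zero>\<^bsub>M\<^esub> = \<zero>"
    using fD(3)[of \<zero> "\<zero>\<^bsub>M\<^esub>"] M.smult_zero fD(1) by simp
  have base: "(\<lambda>x. (i x, f x)) ` carrier M \<in> A"
  proof (rule AI)
    show "(\<lambda>x. (i x, f x)) ` carrier M \<subseteq> carrier N \<times> carrier R" using iD(1) fD(1) by auto
    show "(m \<oplus>\<^bsub>N\<^esub> n, v \<oplus> w) \<in> (\<lambda>x. (i x, f x)) ` carrier M"
      if mn: "(m, v) \<in> (\<lambda>x. (i x, f x)) ` carrier M" "(n, w) \<in> (\<lambda>x. (i x, f x)) ` carrier M" for m v n w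
    proof -
      obtain x y where xy: "x \<in> carrier M" "y \<in> carrier M" "m = i x" "v = f x" "n = i y" "w = f y"
        using mn by auto
      then have "(m \<oplus>\<^bsub>N\<^esub> n, v \<oplus> w) = (i (x \<oplus>\<^bsub>M\<^esub> y), f (x \<oplus>\<^bsub>M\<^esub> y))" using iD(2) fD(2) by simp
      then show ?thesis using xy by auto
    qed
    show "(a \<odot>\<^bsub>N\<^esub> m, a \<otimes> v) \<in> (\<lambda>x. (i x, f x)) ` carrier M"
      if mn: "a \<in> carrier R" "(m, v) \<in> (\<lambda>x. (i x, f x)) ` carrier M" for a m v
    proof -
      obtain x where x: "x \<in> carrier M" "m = i x" "v = f x" using mn by auto
      then have "(a \<odot>\<^bsub>N\<^esub> m, a \<otimes> v) = (i (a \<odot>\<^bsub>M\<^esub> x), f (a \<odot>\<^bsub>M\<^esub> x))" using iD(3) fD(3) mn by simp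
      then show ?thesis using x mn M.smult_closed by auto
    qed
    show "v = \<zero>" if z: "(\<zero>\<^bsub>N\<^esub>, v) \<in> (\<lambda>x. (i x, f x)) ` carrier M" for v
    proof -
      obtain x where x: "x \<in> carrier M" "i x = \<zero>\<^bsub>N\<^esub>" "v = f x" using z by auto
      then have "x = \<zero>\<^bsub>M\<^esub>" using inj i0 by (metis inj_onD M.zero_closed)
      then show ?thesis using x f0 by simp
    qed
  qed auto
  have "\<exists>G\<in>A. \<forall>H\<in>A. G \<subseteq> H \<longrightarrow> H = G"
  proof (rule subset_Zorn_nonempty)
    show "A \<noteq> {}" using base by blast
    fix C assume C: "C \<noteq> {}" "subset.chain A C"
    have CA: "G \<in> A" if "G \<in> C" for G using C that by (auto simp: subset.chain_def)
    show "\<Union>C \<in> A"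
    proof (rule AI)
      show "\<Union>C \<subseteq> carrier N \<times> carrier R" using CA unfolding A_def by blast
      show "(m \<oplus>\<^bsub>N\<^esub> n, v \<oplus> w) \<in> \<Union>C" if mn: "(m, v) \<in> \<Union>C" "(n, w) \<in> \<Union>C" for m v n w
      proof -
        obtain G H where GH: "G \<in> C" "H \<in> C" "(m, v) \<in> G" "(n, w) \<in> H" using mn by blast
        then have "G \<subseteq> H \<or> H \<subseteq> G" using C(2) by (auto simp: subset.chain_def)
        then obtain L where "L \<in> C" "(m, v) \<in> L" "(n, w) \<in> L" using GH by blast
        then show ?thesis using CA[of L] unfolding A_def by blast
      qed
      show "(a \<odot>\<^bsub>N\<^esub> m, a \<otimes> v) \<in> \<Union>C" if "a \<in> carrier R" "(m, v) \<in> \<Union>C" for a m v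
        using that CA unfolding A_def by blast
      show "v = \<zero>" if "(\<zero>\<^bsub>N\<^esub>, v) \<in> \<Union>C" for v using that CA unfolding A_def by blast
      show "(i x, f x) \<in> \<Union>C" if "x \<in> carrier M" for x
        using that CA C(1) unfolding A_def by blast
    qed
  qed
  then obtain G where GA: "G \<in> A" and max: "\<And>H. H \<in> A \<Longrightarrow> G \<subseteq> H \<Longrightarrow> H = G" by blast
  have Gc: "m \<in> carrier N" "v \<in> carrier R" if "(m, v) \<in> G" for m v
    using that GA unfolding A_def by blast+
  have Gadd: "(m \<oplus>\<^bsub>N\<^esub> n, v \<oplus> w) \<in> G" if "(m, v) \<in> G" "(n, w) \<in> G" for m v n w
    using that GA unfolding A_def by blast
  have Gsm: "(a \<odot>\<^bsub>N\<^esub> m, a \<otimes> v) \<in> G" if "a \<in> carrier R" "(m, v) \<in> G" for a m v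
    using that GA unfolding A_def by blast
  have G0: "v = \<zero>" if "(\<zero>\<^bsub>N\<^esub>, v) \<in> G" for v
    using that GA unfolding A_def by blast
  have Gif: "(i x, f x) \<in> G" if "x \<in> carrier M" for x
    using that GA unfolding A_def by blast
  have Gneg: "(\<ominus>\<^bsub>N\<^esub> m, \<ominus> v) \<in> G" if "(m, v) \<in> G" for m v
    using Gsm[OF _ that, of "\<ominus> \<one>"] N.smult_minus_one[OF Gc(1)[OF that]] Gc(2)[OF that]
    by (simp add: l_minus)
  have Gfun: "v = w" if "(m, v) \<in> G" "(m, w) \<in> G" for m v w
  proof -
    have "(m \<oplus>\<^bsub>N\<^esub> \<ominus>\<^bsub>N\<^esub> m, v \<oplus> \<ominus> w) \<in> G" using Gadd[OF that(1) Gneg[OF that(2)]] .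
    then have "v \<oplus> \<ominus> w = \<zero>" using G0 Gc(1)[OF that(1)] by (simp add: N.M.r_neg)
    then show ?thesis using eq_of_minus_zero Gc that by (simp add: minus_eq)
  qed
  have G00: "(\<zero>\<^bsub>N\<^esub>, \<zero>) \<in> G" using Gif[of "\<zero>\<^bsub>M\<^esub>"] i0 f0 by simp
  have tot: "\<exists>v. (n, v) \<in> G" if n: "n \<in> carrier N" for n
  proof -
    define I where "I = {a \<in> carrier R. \<exists>v. (a \<odot>\<^bsub>N\<^esub> n, v) \<in> G}"
    define h where "h a = (THE v. (a \<odot>\<^bsub>N\<^esub> n, v) \<in> G)" for a
    have hG: "(a \<odot>\<^bsub>N\<^esub> n, h a) \<in> G" if "a \<in> I" for a
      unfolding h_def by (rule theI') (use that Gfun I_def in blast)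
    have hI: "h a = v" if "(a \<odot>\<^bsub>N\<^esub> n, v) \<in> G" for a v
      unfolding h_def using that Gfun by blast
    have sum: "((a \<oplus> b) \<odot>\<^bsub>N\<^esub> n, h a \<oplus> h b) \<in> G" if "a \<in> I" "b \<in> I" for a b
      using Gadd[OF hG[OF that(1)] hG[OF that(2)]] that n
      by (simp add: I_def N.smult_l_distr)
    have sm: "((r \<otimes> a) \<odot>\<^bsub>N\<^esub> n, r \<otimes> h a) \<in> G" if "r \<in> carrier R" "a \<in> I" for r a
      using Gsm[OF that(1) hG[OF that(2)]] that n by (simp add: I_def N.smult_assoc)
    have I: "left_ideal I R"
    proof (rule left_idealI)
      show "I \<subseteq> carrier R" by (auto simp: I_def)
      show "\<zero> \<in> I" using G00 n by (auto simp: I_def N.smult_zero)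
      show "a \<oplus> b \<in> I" if "a \<in> I" "b \<in> I" for a b using sum[OF that] that by (auto simp: I_def)
      show "r \<otimes> a \<in> I" if "a \<in> I" "r \<in> carrier R" for a r
        using sm[OF that(2,1)] that by (auto simp: I_def)
    qed
    have "h \<in> I \<rightarrow> carrier R" using hG Gc(2) by blast
    moreover have "\<forall>a\<in>I. \<forall>b\<in>I. h (a \<oplus> b) = h a \<oplus> h b" using hI[OF sum] by blast
    moreover have "\<forall>r\<in>carrier R. \<forall>a\<in>I. h (r \<otimes> a) = r \<otimes> h a" using hI[OF sm] by blast
    ultimately obtain c where c: "c \<in> carrier R" "\<forall>a\<in>I. h a = a \<otimes> c"
      using baer I unfolding baer_left_def by blast
    define H where "H = {(m \<oplus>\<^bsub>N\<^esub> a \<odot>\<^bsub>N\<^esub> n, v \<oplus> a \<otimes> c) | m v a. (m, v) \<in> G \<and> a \<in> carrier R}"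
    have GH: "G \<subseteq> H"
    proof clarify
      fix m v assume mv: "(m, v) \<in> G"
      have "m = m \<oplus>\<^bsub>N\<^esub> \<zero> \<odot>\<^bsub>N\<^esub> n" "v = v \<oplus> \<zero> \<otimes> c"
        using Gc[OF mv] n c by (simp_all add: N.smult_zero)
      then show "(m, v) \<in> H" unfolding H_def using mv zero_closed by blast
    qed
    have "H \<in> A"
    proof (rule AI)
      show "H \<subseteq> carrier N \<times> carrier R"
        using Gc n c N.smult_closed unfolding H_def by auto
      show "(m \<oplus>\<^bsub>N\<^esub> m', v \<oplus> v') \<in> H" if mv: "(m, v) \<in> H" "(m', v') \<in> H" for m v m' v'
      proof -
        obtain p a x q b y where *: "(p, x) \<in> G" "a \<in> carrier R" "(q, y) \<in> G" "b \<in> carrier R"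
          "m = p \<oplus>\<^bsub>N\<^esub> a \<odot>\<^bsub>N\<^esub> n" "v = x \<oplus> a \<otimes> c" "m' = q \<oplus>\<^bsub>N\<^esub> b \<odot>\<^bsub>N\<^esub> n" "v' = y \<oplus> b \<otimes> c"
          using mv unfolding H_def by blast
        have "m \<oplus>\<^bsub>N\<^esub> m' = (p \<oplus>\<^bsub>N\<^esub> q) \<oplus>\<^bsub>N\<^esub> (a \<oplus> b) \<odot>\<^bsub>N\<^esub> n"
          using * Gc n N.smult_closed by (simp add: N.smult_l_distr N.M.a_ac)
        moreover have "v \<oplus> v' = (x \<oplus> y) \<oplus> (a \<oplus> b) \<otimes> c"
          using * Gc c by (simp add: l_distr a_ac)
        ultimately show ?thesis unfolding H_def using Gadd * by blast
      qed
      show "(r \<odot>\<^bsub>N\<^esub> m, r \<otimes> v) \<in> H" if mv: "r \<in> carrier R" "(m, v) \<in> H" for r m v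
      proof -
        obtain p a x where *: "(p, x) \<in> G" "a \<in> carrier R"
          "m = p \<oplus>\<^bsub>N\<^esub> a \<odot>\<^bsub>N\<^esub> n" "v = x \<oplus> a \<otimes> c"
          using mv unfolding H_def by blast
        have "r \<odot>\<^bsub>N\<^esub> m = r \<odot>\<^bsub>N\<^esub> p \<oplus>\<^bsub>N\<^esub> (r \<otimes> a) \<odot>\<^bsub>N\<^esub> n"
          using * Gc n mv N.smult_closed by (simp add: N.smult_r_distr N.smult_assoc)
        moreover have "r \<otimes> v = r \<otimes> x \<oplus> (r \<otimes> a) \<otimes> c"
          using * Gc c mv by (simp add: r_distr m_assoc)
        ultimately show ?thesis unfolding H_def using Gsm * mv by blast
      qed
      show "w = \<zero>" if w: "(\<zero>\<^bsub>N\<^esub>, w) \<in> H" for w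
      proof -
        obtain p a x where *: "(p, x) \<in> G" "a \<in> carrier R"
          "\<zero>\<^bsub>N\<^esub> = p \<oplus>\<^bsub>N\<^esub> a \<odot>\<^bsub>N\<^esub> n" "w = x \<oplus> a \<otimes> c"
          using w unfolding H_def by blast
        have "a \<odot>\<^bsub>N\<^esub> n = \<ominus>\<^bsub>N\<^esub> p"
          using *(3) Gc[OF *(1)] N.smult_closed[OF *(2) n]
          by (metis N.M.a_comm N.M.minus_equality)
        then have an: "(a \<odot>\<^bsub>N\<^esub> n, \<ominus> x) \<in> G" using Gneg[OF *(1)] by simp
        then have "a \<in> I" using * by (auto simp: I_def)
        then have "a \<otimes> c = \<ominus> x" using c hI[OF an] by metis
        then show ?thesis using * Gc[OF *(1)] by (simp add: r_neg)
      qed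
      show "(i x, f x) \<in> H" if "x \<in> carrier M" for x using Gif[OF that] GH by blast
    qed
    then have "H = G" using max GH by blast
    moreover have "n = \<zero>\<^bsub>N\<^esub> \<oplus>\<^bsub>N\<^esub> \<one> \<odot>\<^bsub>N\<^esub> n" "c = \<zero> \<oplus> \<one> \<otimes> c"
      using n c by (simp_all add: N.smult_one)
    ultimately have "(n, c) \<in> G" using G00 one_closed unfolding H_def by blast
    then show ?thesis by blast
  qed
  define g where "g n = (THE v. (n, v) \<in> G)" for n
  have gI: "g n = v" if "(n, v) \<in> G" for n v
    unfolding g_def using that Gfun by blast
  have gG: "(n, g n) \<in> G" if "n \<in> carrier N" for n
    using tot[OF that] gI by blast
  have "g \<in> left_module_hom R N (regular_left_module R)"
  proof (rule left_module_homI)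
    show "g \<in> carrier N \<rightarrow> carrier (regular_left_module R)" using gG Gc(2) by auto
  qed (use gI[OF Gadd] gI[OF Gsm] gG in simp_all)
  moreover have "\<forall>x\<in>carrier M. g (i x) = f x" using gI Gif by blast
  ultimately show "\<exists>g\<in>left_module_hom R N (regular_left_module R). \<forall>x\<in>carrier M. g (i x) = f x"
    by blast
qed

text \<open>A homomorphism on all of \<open>R\<close> is right multiplication by its value at \<open>1\<close>.\<close>

lemma (in ring) left_self_injective_imp_baer:
  assumes "left_self_injective TYPE('m) R"
  shows "baer_left R"
  unfolding baer_left_def
proof (intro allI impI)
  fix I f assume I: "left_ideal I R" and fc: "f \<in> I \<rightarrow> carrier R"
    and add: "\<forall>x\<in>I. \<forall>y\<in>I. f (x \<oplus> y) = f x \<oplus> f y"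
    and smult: "\<forall>a\<in>carrier R. \<forall>x\<in>I. f (a \<otimes> x) = a \<otimes> f x"
  let ?M = "tagged_left_ideal R I :: ('a, 'a + 'm) module"
  let ?N = "tagged_left_ideal R (carrier R) :: ('a, 'a + 'm) module"
  have M: "left_module R ?M" "left_module R ?N"
    by (rule left_module_tagged_left_ideal[OF I],
        rule left_module_tagged_left_ideal[OF left_ideal_carrier])
  have id: "(\<lambda>u. u) \<in> left_module_hom R ?M ?N"
    by (rule left_module_homI) (use left_idealD(5)[OF I] in auto)
  have f: "(\<lambda>u. f (projl u)) \<in> left_module_hom R ?M (regular_left_module R)"
    by (rule left_module_homI) (use fc add smult in auto)
  obtain g where g: "g \<in> left_module_hom R ?N (regular_left_module R)"
    "\<forall>u\<in>carrier ?M. g u = f (projl u)"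
    using assms[unfolded left_self_injective_def injective_left_module_def, THEN conjunct2,
        rule_format, OF conjI[OF M] id inj_on_id2 f] by blast
  have "f x = x \<otimes> g (Inl \<one>)" if x: "x \<in> I" for x
    using left_module_homD(3)[OF g(1), of x "Inl \<one>"] g(2) x left_idealD(5)[OF I x] by simp
  moreover have "g (Inl \<one>) \<in> carrier R"
    using left_module_homD(1)[OF g(1), of "Inl \<one>"] by simp
  ultimately show "\<exists>c\<in>carrier R. \<forall>x\<in>I. f x = x \<otimes> c" by blast
qed

lemma left_self_injective_iff_baer:
  "ring R \<Longrightarrow> left_self_injective TYPE('m) R \<longleftrightarrow> baer_left R"
  using ring.left_self_injective_imp_baer ring.baer_left_imp_injective
  unfolding left_self_injective_def by blast

lemma (in ring) baer_imp_n_injective: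
  assumes baer: "baer_left R" shows "left_n_injective R n"
  unfolding left_n_injective_def
proof (intro allI impI ballI)
  fix I f assume I: "left_ideal I R \<and> n_generated_left_ideal R n I"
    and f: "f \<in> left_module_hom R (left_ideal_module R I) (regular_left_module R)"
  note fD = left_module_homD[OF f, simplified]
  have "f \<in> I \<rightarrow> carrier R" using fD(1) by blast
  then obtain c where c: "c \<in> carrier R" "\<forall>x\<in>I. f x = x \<otimes> c"
    using baer_leftE[OF baer conjunct1[OF I], of f] fD(2,3) by metis
  have "(\<lambda>x. x \<otimes> c) \<in> left_module_hom R (regular_left_module R) (regular_left_module R)"
    by (rule left_module_homI) (use c in \<open>auto simp: l_distr m_assoc\<close>)
  then show "\<exists>g\<in>left_module_hom R (regular_left_module R) (regular_left_module R). \<forall>x\<in>I. g x = f x"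
    using c by force
qed

text \<open>Left 2-injectivity in terms of elements, from the homomorphism \<open>xa + yb \<mapsto> xa' + yb'\<close> on
  \<open>Ra + Rb\<close>.\<close>

lemma (in ring) two_injective_pair:
  assumes inj: "left_n_injective R 2"
    and c: "a \<in> carrier R" "b \<in> carrier R" "a' \<in> carrier R" "b' \<in> carrier R"
    and rel: "\<And>x y. x \<in> carrier R \<Longrightarrow> y \<in> carrier R \<Longrightarrow> x \<otimes> a \<oplus> y \<otimes> b = \<zero> \<Longrightarrow>
      x \<otimes> a' \<oplus> y \<otimes> b' = \<zero>"
  obtains d where "d \<in> carrier R" "a \<otimes> d = a'" "b \<otimes> d = b'"
proof -
  define I where "I = adjoin_left R (principal_left R a) b"
  note P = left_ideal_principal[OF c(1)]
  note Iid = left_ideal_adjoin[OF P c(2), folded I_def]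
  have mem: "u \<in> I \<longleftrightarrow> (\<exists>x\<in>carrier R. \<exists>y\<in>carrier R. u = x \<otimes> a \<oplus> y \<otimes> b)" for u
    unfolding I_def adjoin_left_def principal_left_def by blast
  have aI: "a \<in> I" "b \<in> I" using Iid principal_left_self[OF c(1)] by blast+
  have gen: "I = gen_left_ideal R {a, b}"
  proof
    show "I \<subseteq> gen_left_ideal R {a, b}"
      unfolding gen_left_ideal_def
    proof (rule Inter_greatest)
      fix K assume "K \<in> {I. left_ideal I R \<and> {a, b} \<subseteq> I}"
      then show "I \<subseteq> K" unfolding I_def
        by (intro adjoin_left_subset principal_left_subset) auto
    qed
    show "gen_left_ideal R {a, b} \<subseteq> I"
      unfolding gen_left_ideal_def using Iid(1) aI by blast
  qed
  have "n_generated_left_ideal R 2 I"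
    unfolding n_generated_left_ideal_def
  proof (rule bexI)
    show "(\<lambda>i::nat. if i = 0 then a else b) \<in> {..<2} \<rightarrow> carrier R" using c by auto
    have "(\<lambda>i::nat. if i = 0 then a else b) ` {..<2} = {a, b}"
      by (auto simp: image_iff lessThan_nat_numeral lessThan_Suc numeral_2_eq_2)
    then show "I = gen_left_ideal R ((\<lambda>i::nat. if i = 0 then a else b) ` {..<2})" using gen by simp
  qed
  moreover define f where "f u = (SOME v. \<exists>x\<in>carrier R. \<exists>y\<in>carrier R.
      u = x \<otimes> a \<oplus> y \<otimes> b \<and> v = x \<otimes> a' \<oplus> y \<otimes> b')" for u
  have fI: "f (x \<otimes> a \<oplus> y \<otimes> b) = x \<otimes> a' \<oplus> y \<otimes> b'" if xy: "x \<in> carrier R" "y \<in> carrier R" for x y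
  proof -
    let ?u = "x \<otimes> a \<oplus> y \<otimes> b"
    have "\<exists>x'\<in>carrier R. \<exists>y'\<in>carrier R. ?u = x' \<otimes> a \<oplus> y' \<otimes> b \<and> f ?u = x' \<otimes> a' \<oplus> y' \<otimes> b'"
      unfolding f_def by (rule someI_ex) (use xy in blast)
    then obtain x' y' where *: "x' \<in> carrier R" "y' \<in> carrier R"
      "?u = x' \<otimes> a \<oplus> y' \<otimes> b" "f ?u = x' \<otimes> a' \<oplus> y' \<otimes> b'" by blast
    have diff: "(x \<ominus> x') \<otimes> p \<oplus> (y \<ominus> y') \<otimes> q = (x \<otimes> p \<oplus> y \<otimes> q) \<ominus> (x' \<otimes> p \<oplus> y' \<otimes> q)"
      if "p \<in> carrier R" "q \<in> carrier R" for p q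
      using that xy *(1,2) by (simp add: minus_eq l_distr l_minus minus_add a_ac)
    have "(x \<ominus> x') \<otimes> a \<oplus> (y \<ominus> y') \<otimes> b = \<zero>"
      unfolding diff[OF c(1,2)] *(3) using * c by (simp add: minus_eq r_neg)
    then have "(x \<ominus> x') \<otimes> a' \<oplus> (y \<ominus> y') \<otimes> b' = \<zero>" using rel xy * by simp
    then show ?thesis unfolding diff[OF c(3,4)] *(4)
      using eq_of_minus_zero[of "x \<otimes> a' \<oplus> y \<otimes> b'" "x' \<otimes> a' \<oplus> y' \<otimes> b'"] xy *(1,2) c by simp
  qed
  have "f \<in> left_module_hom R (left_ideal_module R I) (regular_left_module R)"
  proof (rule left_module_homI, unfold left_ideal_module_simps)
    show "f \<in> I \<rightarrow> carrier R" using fI c mem by auto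
    show "f (u \<oplus> v) = f u \<oplus> f v" if uv: "u \<in> I" "v \<in> I" for u v
    proof -
      obtain x y where *: "x \<in> carrier R" "y \<in> carrier R" "u = x \<otimes> a \<oplus> y \<otimes> b"
        using mem uv(1) by metis
      obtain x' y' where **: "x' \<in> carrier R" "y' \<in> carrier R" "v = x' \<otimes> a \<oplus> y' \<otimes> b"
        using mem uv(2) by metis
      have eq: "(x \<otimes> p \<oplus> y \<otimes> q) \<oplus> (x' \<otimes> p \<oplus> y' \<otimes> q) = (x \<oplus> x') \<otimes> p \<oplus> (y \<oplus> y') \<otimes> q"
        if "p \<in> carrier R" "q \<in> carrier R" for p q
        using that * ** by (simp add: l_distr a_ac)
      show ?thesis unfolding *(3) **(3) eq[OF c(1,2)]
        using *(1,2) **(1,2) eq[OF c(3,4)] by (simp add: fI)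
    qed
    show "f (r \<otimes> u) = r \<otimes> f u" if ru: "r \<in> carrier R" "u \<in> I" for r u
    proof -
      obtain x y where *: "x \<in> carrier R" "y \<in> carrier R" "u = x \<otimes> a \<oplus> y \<otimes> b"
        using mem ru(2) by metis
      have eq: "r \<otimes> (x \<otimes> p \<oplus> y \<otimes> q) = (r \<otimes> x) \<otimes> p \<oplus> (r \<otimes> y) \<otimes> q"
        if "p \<in> carrier R" "q \<in> carrier R" for p q
        using that * ru by (simp add: r_distr m_assoc)
      show ?thesis unfolding *(3) eq[OF c(1,2)] using *(1,2) ru(1) eq[OF c(3,4)] by (simp add: fI)
    qed
  qed
  ultimately obtain g where g: "g \<in> left_module_hom R (regular_left_module R) (regular_left_module R)"
    "\<forall>x\<in>I. g x = f x" using inj Iid(1) unfolding left_n_injective_def by blast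
  have gx: "x \<otimes> g \<one> = f x" if "x \<in> I" for x
    using left_module_homD(3)[OF g(1), of x \<one>] g(2) that left_idealD(5)[OF Iid(1) that] by simp
  show ?thesis
  proof (rule that)
    show "g \<one> \<in> carrier R" using left_module_homD(1)[OF g(1), of \<one>] by simp
    show "a \<otimes> g \<one> = a'" using gx[OF aI(1)] fI[of \<one> \<zero>] c by simp
    show "b \<otimes> g \<one> = b'" using gx[OF aI(2)] fI[of \<zero> \<one>] c by simp
  qed
qed


section \<open>Uniform left ideals and complements\<close>

text \<open>The left singular ideal: the elements whose left annihilator is essential.\<close>

definition left_singular :: "('a, 'r) ring_scheme \<Rightarrow> 'a set" where
  "left_singular R = {a \<in> carrier R. \<forall>x\<in>carrier R. x \<noteq> \<zero>\<^bsub>R\<^esub> \<longrightarrow>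
     (\<exists>r\<in>carrier R. r \<otimes>\<^bsub>R\<^esub> x \<noteq> \<zero>\<^bsub>R\<^esub> \<and> r \<otimes>\<^bsub>R\<^esub> x \<otimes>\<^bsub>R\<^esub> a = \<zero>\<^bsub>R\<^esub>)}"

definition uniform_left :: "('a, 'r) ring_scheme \<Rightarrow> 'a set \<Rightarrow> bool" where
  "uniform_left R U \<longleftrightarrow> left_ideal U R \<and> U \<noteq> {\<zero>\<^bsub>R\<^esub>} \<and>
     (\<forall>x\<in>U. \<forall>y\<in>U. x \<noteq> \<zero>\<^bsub>R\<^esub> \<longrightarrow> y \<noteq> \<zero>\<^bsub>R\<^esub> \<longrightarrow>
       (\<exists>r\<in>carrier R. \<exists>s\<in>carrier R. r \<otimes>\<^bsub>R\<^esub> x = s \<otimes>\<^bsub>R\<^esub> y \<and> r \<otimes>\<^bsub>R\<^esub> x \<noteq> \<zero>\<^bsub>R\<^esub>))"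

definition uniform_idempotent :: "('a, 'r) ring_scheme \<Rightarrow> 'a \<Rightarrow> bool" where
  "uniform_idempotent R f \<longleftrightarrow>
     f \<in> carrier R \<and> f \<otimes>\<^bsub>R\<^esub> f = f \<and> uniform_left R (principal_left R f)"

lemma uniform_leftD:
  assumes "uniform_left R U"
  shows "left_ideal U R" "U \<noteq> {\<zero>\<^bsub>R\<^esub>}"
    "\<And>x y. x \<in> U \<Longrightarrow> y \<in> U \<Longrightarrow> x \<noteq> \<zero>\<^bsub>R\<^esub> \<Longrightarrow> y \<noteq> \<zero>\<^bsub>R\<^esub> \<Longrightarrow>
       \<exists>r\<in>carrier R. \<exists>s\<in>carrier R. r \<otimes>\<^bsub>R\<^esub> x = s \<otimes>\<^bsub>R\<^esub> y \<and> r \<otimes>\<^bsub>R\<^esub> x \<noteq> \<zero>\<^bsub>R\<^esub>"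
  using assms unfolding uniform_left_def by auto

context ring
begin

lemma left_singularD:
  assumes "a \<in> left_singular R"
  shows "a \<in> carrier R"
    "\<And>x. x \<in> carrier R \<Longrightarrow> x \<noteq> \<zero> \<Longrightarrow> \<exists>r\<in>carrier R. r \<otimes> x \<noteq> \<zero> \<and> r \<otimes> x \<otimes> a = \<zero>"
  using assms by (auto simp: left_singular_def)

lemma left_singularI:
  assumes "a \<in> carrier R"
    "\<And>x. x \<in> carrier R \<Longrightarrow> x \<noteq> \<zero> \<Longrightarrow> \<exists>r\<in>carrier R. r \<otimes> x \<noteq> \<zero> \<and> r \<otimes> x \<otimes> a = \<zero>"
  shows "a \<in> left_singular R"
  using assms by (auto simp: left_singular_def)

lemma left_singular_mult_right:
  assumes a: "a \<in> left_singular R" and r: "r \<in> carrier R"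
  shows "a \<otimes> r \<in> left_singular R"
proof (rule left_singularI)
  note aD = left_singularD[OF a]
  show "a \<otimes> r \<in> carrier R" using aD(1) r by simp
  fix x assume x: "x \<in> carrier R" "x \<noteq> \<zero>"
  obtain s where s: "s \<in> carrier R" "s \<otimes> x \<noteq> \<zero>" "s \<otimes> x \<otimes> a = \<zero>" using aD(2)[OF x] by blast
  have "s \<otimes> x \<otimes> (a \<otimes> r) = s \<otimes> x \<otimes> a \<otimes> r" using s(1) x(1) aD(1) r by (simp add: m_assoc)
  then show "\<exists>s\<in>carrier R. s \<otimes> x \<noteq> \<zero> \<and> s \<otimes> x \<otimes> (a \<otimes> r) = \<zero>" using s r by auto
qed

lemma left_singular_mult_left:
  assumes a: "a \<in> left_singular R" and r: "r \<in> carrier R"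
  shows "r \<otimes> a \<in> left_singular R"
proof (rule left_singularI)
  note aD = left_singularD[OF a]
  show "r \<otimes> a \<in> carrier R" using aD(1) r by simp
  fix x assume x: "x \<in> carrier R" "x \<noteq> \<zero>"
  show "\<exists>s\<in>carrier R. s \<otimes> x \<noteq> \<zero> \<and> s \<otimes> x \<otimes> (r \<otimes> a) = \<zero>"
  proof (cases "x \<otimes> r = \<zero>")
    case True
    then have "\<one> \<otimes> x \<otimes> (r \<otimes> a) = \<zero>"
      using x(1) r aD(1) by (simp add: m_assoc[symmetric])
    then show ?thesis using x by (intro bexI[of _ \<one>]) auto
  next
    case False
    obtain s where s: "s \<in> carrier R" "s \<otimes> (x \<otimes> r) \<noteq> \<zero>" "s \<otimes> (x \<otimes> r) \<otimes> a = \<zero>"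
      using aD(2)[OF _ False] x r by auto
    have "s \<otimes> x \<noteq> \<zero>" using s(1,2) x(1) r by (auto simp: m_assoc[symmetric])
    moreover have "s \<otimes> x \<otimes> (r \<otimes> a) = \<zero>" using s(1,3) x(1) r aD(1) by (simp add: m_assoc)
    ultimately show ?thesis using s(1) by blast
  qed
qed

text \<open>The substitute for the invertibility of \<open>1 - z\<close>: if \<open>bz = b\<close>, then \<open>rbz = rb\<close> for all \<open>r\<close>, so
  \<open>Rb\<close> does not meet \<open>l(z)\<close>.\<close>

lemma left_singular_fixes_nothing:
  assumes z: "z \<in> left_singular R" and b: "b \<in> carrier R" and eq: "b \<otimes> z = b"
  shows "b = \<zero>"
proof (rule ccontr)
  assume "b \<noteq> \<zero>"
  then obtain r where r: "r \<in> carrier R" "r \<otimes> b \<noteq> \<zero>" "r \<otimes> b \<otimes> z = \<zero>"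
    using left_singularD(2)[OF z b] by blast
  have "r \<otimes> b \<otimes> z = r \<otimes> b" using r(1) b left_singularD(1)[OF z] eq by (simp add: m_assoc)
  then show False using r by simp
qed

lemma uniform_idempotentD:
  assumes "uniform_idempotent R f"
  shows "f \<in> carrier R" "f \<otimes> f = f" "f \<noteq> \<zero>" "f \<notin> left_singular R"
    "\<And>x y. x \<in> carrier R \<Longrightarrow> y \<in> carrier R \<Longrightarrow> x \<otimes> f = x \<Longrightarrow> y \<otimes> f = y \<Longrightarrow>
      x \<noteq> \<zero> \<Longrightarrow> y \<noteq> \<zero> \<Longrightarrow>
      \<exists>r\<in>carrier R. \<exists>s\<in>carrier R. r \<otimes> x = s \<otimes> y \<and> r \<otimes> x \<noteq> \<zero>"
proof -
  show f: "f \<in> carrier R" "f \<otimes> f = f" using assms by (auto simp: uniform_idempotent_def)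
  have U: "uniform_left R (principal_left R f)" using assms by (auto simp: uniform_idempotent_def)
  have "principal_left R \<zero> = {\<zero>}" unfolding principal_left_def by force
  then show "f \<noteq> \<zero>" using uniform_leftD(2)[OF U] by metis
  then show "f \<notin> left_singular R" using left_singular_fixes_nothing f by blast
  fix x y assume xy: "x \<in> carrier R" "y \<in> carrier R" "x \<otimes> f = x" "y \<otimes> f = y" "x \<noteq> \<zero>" "y \<noteq> \<zero>"
  have "x \<in> principal_left R f" "y \<in> principal_left R f"
    unfolding principal_left_def using xy(1-4) by force+
  then show "\<exists>r\<in>carrier R. \<exists>s\<in>carrier R. r \<otimes> x = s \<otimes> y \<and> r \<otimes> x \<noteq> \<zero>"
    using uniform_leftD(3)[OF U] xy(5,6) by blast
qed

lemma left_complement_exists: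
  assumes A: "left_ideal A R" and B: "left_ideal B R" and AB: "A \<inter> B = {\<zero>}"
  obtains C where "left_ideal C R" "A \<subseteq> C" "C \<inter> B = {\<zero>}"
    "\<And>C'. left_ideal C' R \<Longrightarrow> C' \<inter> B = {\<zero>} \<Longrightarrow> C \<subseteq> C' \<Longrightarrow> C' = C"
proof -
  define P where "P = {C. left_ideal C R \<and> A \<subseteq> C \<and> C \<inter> B = {\<zero>}}"
  have "\<exists>C\<in>P. \<forall>D\<in>P. C \<subseteq> D \<longrightarrow> D = C"
  proof (rule subset_Zorn_nonempty)
    show "P \<noteq> {}" using A AB unfolding P_def by blast
    fix \<C> assume ne: "\<C> \<noteq> {}" and ch: "subset.chain P \<C>"
    have CP: "C \<in> P" if "C \<in> \<C>" for C using ch that by (auto simp: subset.chain_def)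
    then have Cid: "left_ideal C R" if "C \<in> \<C>" for C using that unfolding P_def by blast
    have "left_ideal (\<Union>\<C>) R"
    proof (rule left_idealI)
      show "\<Union>\<C> \<subseteq> carrier R" using left_idealD(1)[OF Cid] by blast
      show "\<zero> \<in> \<Union>\<C>" using left_idealD(2)[OF Cid] ne by blast
      show "a \<oplus> b \<in> \<Union>\<C>" if "a \<in> \<Union>\<C>" "b \<in> \<Union>\<C>" for a b
      proof -
        obtain C D where CD: "C \<in> \<C>" "D \<in> \<C>" "a \<in> C" "b \<in> D" using \<open>a \<in> \<Union>\<C>\<close> \<open>b \<in> \<Union>\<C>\<close> by blast
        then have "C \<subseteq> D \<or> D \<subseteq> C" using ch by (auto simp: subset.chain_def)
        then obtain E where E: "E \<in> \<C>" "a \<in> E" "b \<in> E" using CD by blast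
        show ?thesis by (rule UnionI[OF E(1) left_idealD(3)[OF Cid[OF E(1)] E(2,3)]])
      qed
      show "x \<otimes> a \<in> \<Union>\<C>" if "a \<in> \<Union>\<C>" "x \<in> carrier R" for a x
        using \<open>a \<in> \<Union>\<C>\<close> left_idealD(4)[OF Cid _ \<open>x \<in> carrier R\<close>] by blast
    qed
    moreover have "A \<subseteq> \<Union>\<C>" "\<Union>\<C> \<inter> B = {\<zero>}" using CP ne unfolding P_def by blast+
    ultimately show "\<Union>\<C> \<in> P" unfolding P_def by blast
  qed
  then obtain C where C: "C \<in> P" "\<And>D. D \<in> P \<Longrightarrow> C \<subseteq> D \<Longrightarrow> D = C" by blast
  show ?thesis
  proof (rule that)
    show "left_ideal C R" "A \<subseteq> C" "C \<inter> B = {\<zero>}" using C(1) by (auto simp: P_def)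
    show "C' = C" if "left_ideal C' R" "C' \<inter> B = {\<zero>}" "C \<subseteq> C'" for C'
    proof (rule C(2)[OF _ that(3)])
      have "A \<subseteq> C" using C(1) by (simp add: P_def)
      then show "C' \<in> P" using that by (simp add: P_def)
    qed
  qed
qed

text \<open>Take \<open>S \<supseteq> E\<close> maximal with \<open>S \<inter> U = 0\<close>, then \<open>C \<supseteq> U\<close> maximal with \<open>C \<inter> S = 0\<close>. The maximality
  of \<open>S\<close> makes \<open>U\<close> essential in \<open>C\<close>, and so \<open>C\<close> inherits uniformity.\<close>

lemma uniform_complement_exists:
  assumes U: "uniform_left R U" and E: "left_ideal E R" and UE: "U \<inter> E = {\<zero>}"
  obtains C where "uniform_left R C" "complement_left_ideal R C" "U \<subseteq> C" "C \<inter> E = {\<zero>}"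
proof -
  note Uid = uniform_leftD(1)[OF U]
  have EU: "E \<inter> U = {\<zero>}" using UE by blast
  obtain S where S: "left_ideal S R" "E \<subseteq> S" "S \<inter> U = {\<zero>}"
    "\<And>S'. left_ideal S' R \<Longrightarrow> S' \<inter> U = {\<zero>} \<Longrightarrow> S \<subseteq> S' \<Longrightarrow> S' = S"
    using left_complement_exists[OF E Uid EU] by metis
  have US: "U \<inter> S = {\<zero>}" using S(3) by blast
  obtain C where C: "left_ideal C R" "U \<subseteq> C" "C \<inter> S = {\<zero>}"
    "\<And>C'. left_ideal C' R \<Longrightarrow> C' \<inter> S = {\<zero>} \<Longrightarrow> C \<subseteq> C' \<Longrightarrow> C' = C"
    using left_complement_exists[OF Uid S(1) US] by metis
  note CD = left_idealD[OF C(1)] and SD = left_idealD[OF S(1)]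
  have ess: "\<exists>r\<in>carrier R. r \<otimes> x \<in> U \<and> r \<otimes> x \<noteq> \<zero>" if x: "x \<in> C" "x \<noteq> \<zero>" for x
  proof (rule ccontr)
    assume *: "\<not> ?thesis"
    have xc: "x \<in> carrier R" using CD(5) x by blast
    note T = left_ideal_adjoin[OF S(1) xc]
    have "w = \<zero>" if w: "w \<in> adjoin_left R S x" "w \<in> U" for w
    proof -
      obtain s r where sr: "s \<in> S" "r \<in> carrier R" "w = s \<oplus> r \<otimes> x"
        using w(1) unfolding adjoin_left_def by blast
      have rx: "r \<otimes> x \<in> C" by (rule CD(4)[OF x(1) sr(2)])
      have "w \<ominus> r \<otimes> x \<in> C" by (rule CD(7)[OF _ rx]) (use w(2) C(2) in blast)
      moreover have eq: "w \<ominus> r \<otimes> x = s"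
        using sr xc SD(5)[OF sr(1)] by (simp add: minus_eq a_assoc r_neg)
      ultimately have "s = \<zero>" using C(3) sr(1) by auto
      then have "w = r \<otimes> x" using sr xc by simp
      then show ?thesis using * w(2) sr(2) by blast
    qed
    then have "adjoin_left R S x \<inter> U = {\<zero>}"
      using left_idealD(2)[OF T(1)] left_idealD(2)[OF Uid] by blast
    then have "adjoin_left R S x = S" using S(4) T by blast
    then have "x \<in> C \<inter> S" using T(3) x by blast
    then show False using C(3) x by blast
  qed
  have "uniform_left R C"
    unfolding uniform_left_def
  proof (intro conjI ballI impI)
    show "left_ideal C R" by fact
    show "C \<noteq> {\<zero>}" using C(2) uniform_leftD(2)[OF U] left_idealD(2)[OF Uid] by blast
    fix x y assume xy: "x \<in> C" "y \<in> C" "x \<noteq> \<zero>" "y \<noteq> \<zero>"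
    obtain r where r: "r \<in> carrier R" "r \<otimes> x \<in> U" "r \<otimes> x \<noteq> \<zero>" using ess[OF xy(1,3)] by blast
    obtain s where s: "s \<in> carrier R" "s \<otimes> y \<in> U" "s \<otimes> y \<noteq> \<zero>" using ess[OF xy(2,4)] by blast
    obtain p q where pq: "p \<in> carrier R" "q \<in> carrier R" "p \<otimes> (r \<otimes> x) = q \<otimes> (s \<otimes> y)"
      "p \<otimes> (r \<otimes> x) \<noteq> \<zero>" using uniform_leftD(3)[OF U r(2) s(2) r(3) s(3)] by blast
    have "(p \<otimes> r) \<otimes> x = (q \<otimes> s) \<otimes> y" "(p \<otimes> r) \<otimes> x \<noteq> \<zero>"
      using pq r(1) s(1) CD(5)[OF xy(1)] CD(5)[OF xy(2)] by (simp_all add: m_assoc)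
    then show "\<exists>r\<in>carrier R. \<exists>s\<in>carrier R. r \<otimes> x = s \<otimes> y \<and> r \<otimes> x \<noteq> \<zero>"
      using pq(1,2) r(1) s(1) by (meson m_closed)
  qed
  moreover have "complement_left_ideal R C"
    unfolding complement_left_ideal_def using S(1) C by blast
  moreover have "C \<inter> E = {\<zero>}" using C(3) S(2) left_idealD(2)[OF E] CD(2) by blast
  ultimately show ?thesis using that C(2) by blast
qed

end

section \<open>Nilpotency of the left singular ideal\<close>

text \<open>The products of \<open>n\<close> elements of \<open>Z\<close>; sums are not needed to express nilpotency.\<close>

primrec words :: "('a, 'r) ring_scheme \<Rightarrow> 'a set \<Rightarrow> nat \<Rightarrow> 'a set" where
  "words R Z 0 = {\<one>\<^bsub>R\<^esub>}"
| "words R Z (Suc n) = {z \<otimes>\<^bsub>R\<^esub> w | z w. z \<in> Z \<and> w \<in> words R Z n}"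

context ring
begin

lemma words_carrier: "Z \<subseteq> carrier R \<Longrightarrow> words R Z n \<subseteq> carrier R"
  by (induction n) auto

lemma words_Suc_right:
  assumes Z: "Z \<subseteq> carrier R"
  shows "words R Z (Suc n) = {w \<otimes> z | w z. w \<in> words R Z n \<and> z \<in> Z}"
proof (induction n)
  case 0
  have "z \<otimes> \<one> = \<one> \<otimes> z" if "z \<in> Z" for z using that Z by (simp add: subset_iff)
  then show ?case by force
next
  case (Suc n)
  have W: "w \<in> carrier R" if "w \<in> words R Z n" for w using words_carrier[OF Z] that by blast
  have c: "z \<in> carrier R" if "z \<in> Z" for z using Z that by blast
  show ?case
  proof (intro Set.set_eqI iffI)
    fix v assume "v \<in> words R Z (Suc (Suc n))"
    then obtain y u where u: "y \<in> Z" "u \<in> words R Z (Suc n)" "v = y \<otimes> u"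
      unfolding words.simps(2)[of R Z "Suc n"] by blast
    then obtain w z where wz: "w \<in> words R Z n" "z \<in> Z" "u = w \<otimes> z" unfolding Suc by blast
    have "v = y \<otimes> w \<otimes> z" using u wz W c by (simp add: m_assoc)
    moreover have "y \<otimes> w \<in> words R Z (Suc n)" using u(1) wz(1) by auto
    ultimately show "v \<in> {w \<otimes> z | w z. w \<in> words R Z (Suc n) \<and> z \<in> Z}" using wz(2) by blast
  next
    fix v assume "v \<in> {w \<otimes> z | w z. w \<in> words R Z (Suc n) \<and> z \<in> Z}"
    then obtain u z where u: "u \<in> words R Z (Suc n)" "z \<in> Z" "v = u \<otimes> z" by blast
    then obtain y w where yw: "y \<in> Z" "w \<in> words R Z n" "u = y \<otimes> w" by auto
    have "v = y \<otimes> (w \<otimes> z)" using u yw W c by (simp add: m_assoc)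
    moreover have "w \<otimes> z \<in> words R Z (Suc n)" unfolding Suc using yw(2) u(2) by blast
    ultimately show "v \<in> words R Z (Suc (Suc n))"
      unfolding words.simps(2)[of R Z "Suc n"] using yw(1) by blast
  qed
qed

lemma lann_words_mono:
  assumes Z: "Z \<subseteq> carrier R"
  shows "lann R (words R Z n) \<subseteq> lann R (words R Z (Suc n))"
proof
  fix x assume x: "x \<in> lann R (words R Z n)"
  have "x \<otimes> (w \<otimes> z) = \<zero>" if "w \<in> words R Z n" "z \<in> Z" for w z
  proof -
    have c: "w \<in> carrier R" "z \<in> carrier R" "x \<in> carrier R" "x \<otimes> w = \<zero>"
      using that words_carrier[OF Z] Z x by (auto simp: lann_def)
    have "x \<otimes> (w \<otimes> z) = x \<otimes> w \<otimes> z" using c(1-3) by (simp add: m_assoc)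
    then show ?thesis using c by simp
  qed
  then show "x \<in> lann R (words R Z (Suc n))"
    unfolding words_Suc_right[OF Z] using x by (auto simp: lann_def)
qed

lemma left_singular_carrier: "left_singular R \<subseteq> carrier R"
  by (auto simp: left_singular_def)

text \<open>Among the nonzero multiples of \<open>v\<close> choose \<open>rv\<close> with \<open>r(rv)\<close> maximal. If \<open>rvz \<noteq> 0\<close>, then a
  multiple \<open>srv \<noteq> 0\<close> with \<open>srvz = 0\<close> has a larger annihilator.\<close>

lemma lann_left_singular_essential:
  assumes RN: "left_noetherian (opp_ring R)" and v: "v \<in> carrier R" "v \<noteq> \<zero>"
  shows "\<exists>r\<in>carrier R. r \<otimes> v \<noteq> \<zero> \<and> r \<otimes> v \<in> lann R (left_singular R)"
proof -
  define A where "A = {rann R {r \<otimes> v} | r. r \<in> carrier R \<and> r \<otimes> v \<noteq> \<zero>}"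
  have "rann R {\<one> \<otimes> v} \<in> A"
    unfolding A_def by (rule CollectI, rule exI[of _ \<one>]) (use v in simp)
  moreover have "left_ideal I (opp_ring R)" if "I \<in> A" for I
    using that v unfolding A_def by (auto intro: right_ideal_rann)
  ultimately obtain M where M: "M \<in> A" "\<And>I. I \<in> A \<Longrightarrow> M \<subseteq> I \<Longrightarrow> I = M"
    using left_noetherian_maximal[OF RN] by metis
  then obtain r where r: "r \<in> carrier R" "r \<otimes> v \<noteq> \<zero>" "M = rann R {r \<otimes> v}" unfolding A_def by blast
  have "r \<otimes> v \<otimes> z = \<zero>" if z: "z \<in> left_singular R" for z
  proof -
    have zc: "z \<in> carrier R" by (rule left_singularD(1)[OF z])
    obtain s where s: "s \<in> carrier R" "s \<otimes> (r \<otimes> v) \<noteq> \<zero>" "s \<otimes> (r \<otimes> v) \<otimes> z = \<zero>"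
      using left_singularD(2)[OF z _ r(2)] r(1) v by auto
    have "rann R {(s \<otimes> r) \<otimes> v} \<in> A"
      unfolding A_def by (rule CollectI, rule exI[of _ "s \<otimes> r"]) (use s r(1) v in \<open>simp add: m_assoc\<close>)
    moreover have "M \<subseteq> rann R {(s \<otimes> r) \<otimes> v}"
      unfolding r(3) using s(1) r(1) v by (auto simp: rann_def m_assoc)
    ultimately have "rann R {(s \<otimes> r) \<otimes> v} = M" by (rule M(2))
    moreover have "z \<in> rann R {(s \<otimes> r) \<otimes> v}"
      using s r(1) v zc by (simp add: rann_def m_assoc)
    ultimately show ?thesis unfolding r(3) by (simp add: rann_def)
  qed
  then show ?thesis using r(1,2) v by (intro bexI[of _ r]) (auto simp: lann_def)
qed

text \<open>The ideals \<open>l(Z\<^sup>n)\<close> ascend, say up to \<open>l(Z\<^sup>N) = l(Z\<^sup>N\<^sup>+\<^sup>1)\<close>. If this is not \<open>R\<close>, choose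
  \<open>y \<notin> l(Z\<^sup>N)\<close> for which the right ideal \<open>Q y\<close> of all \<open>w\<close> with \<open>yw \<in> l(Z)\<close> is maximal. As \<open>l(Z)\<close> is
  essential, a product \<open>w\<close> of length \<open>N\<close> outside \<open>Q y\<close> could be absorbed by passing to some \<open>ry\<close>.
  Hence \<open>yZ\<^sup>N \<subseteq> l(Z)\<close> and \<open>y \<in> l(Z\<^sup>N\<^sup>+\<^sup>1)\<close>, a contradiction.\<close>

lemma left_singular_nilpotent_of_right_noetherian:
  assumes RN: "left_noetherian (opp_ring R)"
  obtains n where "words R (left_singular R) n \<subseteq> {\<zero>}"
proof -
  note Zc = left_singular_carrier
  note W = words_carrier[OF Zc]
  define L where "L n = lann R (words R (left_singular R) n)" for n
  note Lid = left_ideal_lann[OF W, folded L_def]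
  have LR: "left_ideal (L n) (opp_ring R)" for n
  proof (rule right_idealI)
    note D = left_idealD[OF Lid]
    show "L n \<subseteq> carrier R" "\<zero> \<in> L n" by (rule D(1), rule D(2))
    show "\<And>a b. a \<in> L n \<Longrightarrow> b \<in> L n \<Longrightarrow> a \<oplus> b \<in> L n" by (rule D(3))
    fix a x assume a: "a \<in> L n" and x: "x \<in> carrier R"
    have ac: "a \<in> carrier R" by (rule D(5)[OF a])
    show "a \<otimes> x \<in> L n"
    proof (cases n)
      case 0
      then have "a = \<zero>" using a ac by (simp add: L_def lann_def)
      then show ?thesis using D(2) x by simp
    next
      case (Suc m)
      have "a \<otimes> x \<otimes> (z \<otimes> w) = \<zero>" if zw: "z \<in> left_singular R" "w \<in> words R (left_singular R) m" for z w
      proof -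
        have "a \<otimes> x \<otimes> (z \<otimes> w) = a \<otimes> ((x \<otimes> z) \<otimes> w)"
          using ac x zw Zc W by (simp add: m_assoc subset_iff)
        moreover have "(x \<otimes> z) \<otimes> w \<in> words R (left_singular R) n"
          using left_singular_mult_left[OF zw(1) x] zw(2) Suc by auto
        ultimately show ?thesis using a by (simp add: L_def lann_def)
      qed
      then show ?thesis using ac x by (auto simp: L_def lann_def Suc)
    qed
  qed
  then obtain N where N: "\<forall>n\<ge>N. L n = L N"
    using RN[unfolded left_noetherian_def, rule_format, of L] lann_words_mono[OF Zc]
    by (auto simp: L_def)
  have stab: "L (Suc N) = L N" by (rule N[rule_format]) simp
  have "\<one> \<in> L N"
  proof (rule ccontr)
    assume one: "\<one> \<notin> L N"
    define Q where "Q y = {w \<in> carrier R. y \<otimes> w \<in> lann R (left_singular R)}" for y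
    note lZ = left_idealD[OF left_ideal_lann[OF Zc]]
    have lZr: "a \<otimes> x \<in> lann R (left_singular R)" if "a \<in> lann R (left_singular R)" "x \<in> carrier R" for a x
    proof -
      have "a \<otimes> x \<otimes> z = \<zero>" if z: "z \<in> left_singular R" for z
      proof -
        have "a \<otimes> (x \<otimes> z) = \<zero>"
          using \<open>a \<in> lann R (left_singular R)\<close> left_singular_mult_left[OF z \<open>x \<in> carrier R\<close>] by (simp add: lann_def)
        then show ?thesis
          using lZ(5)[OF \<open>a \<in> lann R (left_singular R)\<close>] \<open>x \<in> carrier R\<close> left_singularD(1)[OF z] by (simp add: m_assoc)
      qed
      then show ?thesis using lZ(5)[OF that(1)] that(2) by (simp add: lann_def)
    qed
    define A where "A = {Q y | y. y \<in> carrier R \<and> y \<notin> L N}"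
    have "Q \<one> \<in> A" unfolding A_def using one by blast
    moreover have "left_ideal I (opp_ring R)" if I: "I \<in> A" for I
    proof -
      obtain y where y: "y \<in> carrier R" "I = Q y" using I unfolding A_def by blast
      show ?thesis unfolding y(2)
      proof (rule right_idealI)
        show "Q y \<subseteq> carrier R" "\<zero> \<in> Q y" using y(1) lZ(2) by (auto simp: Q_def)
        show "a \<oplus> b \<in> Q y" if "a \<in> Q y" "b \<in> Q y" for a b
          using that lZ(3) y(1) by (simp add: Q_def r_distr)
        show "a \<otimes> x \<in> Q y" if "a \<in> Q y" "x \<in> carrier R" for a x
          using that lZr[of "y \<otimes> a" x] y(1) by (simp add: Q_def m_assoc)
      qed
    qed
    ultimately obtain M where M: "M \<in> A" "\<And>I. I \<in> A \<Longrightarrow> M \<subseteq> I \<Longrightarrow> I = M"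
      using left_noetherian_maximal[OF RN] by metis
    then obtain y where y: "y \<in> carrier R" "y \<notin> L N" "M = Q y" unfolding A_def by blast
    have yw: "y \<otimes> w \<in> lann R (left_singular R)" if w: "w \<in> words R (left_singular R) N" for w
    proof (rule ccontr)
      assume n: "y \<otimes> w \<notin> lann R (left_singular R)"
      have wc: "w \<in> carrier R" using w W by blast
      have "y \<otimes> w \<noteq> \<zero>" using n lZ(2) by metis
      then obtain r where r: "r \<in> carrier R" "r \<otimes> (y \<otimes> w) \<noteq> \<zero>" "r \<otimes> (y \<otimes> w) \<in> lann R (left_singular R)"
        using lann_left_singular_essential[OF RN, of "y \<otimes> w"] y(1) wc by auto
      have "r \<otimes> y \<notin> L N"
        using r(1,2) w wc y(1) by (auto simp: L_def lann_def m_assoc intro!: bexI[OF _ w])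
      then have "Q (r \<otimes> y) \<in> A" unfolding A_def using r(1) y(1) by blast
      moreover have "M \<subseteq> Q (r \<otimes> y)"
        unfolding y(3) Q_def using lZ(4) r(1) y(1) by (auto simp: m_assoc)
      ultimately have "Q (r \<otimes> y) = M" by (rule M(2))
      moreover have "w \<in> Q (r \<otimes> y)" using r wc y(1) by (simp add: Q_def m_assoc)
      ultimately show False using n unfolding y(3) by (simp add: Q_def)
    qed
    have "y \<otimes> (w \<otimes> z) = \<zero>" if "w \<in> words R (left_singular R) N" "z \<in> left_singular R" for w z
    proof -
      have "y \<otimes> w \<otimes> z = \<zero>" using yw[OF that(1)] that(2) by (simp add: lann_def)
      then show ?thesis using y(1) that W Zc by (simp add: m_assoc subset_iff)
    qed
    then have "y \<in> L (Suc N)"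
      unfolding L_def words_Suc_right[OF Zc] using y(1) by (auto simp: lann_def)
    then show False using stab y(2) by simp
  qed
  then have "words R (left_singular R) N \<subseteq> {\<zero>}" using W by (auto simp: L_def lann_def subset_iff)
  then show ?thesis by (rule that)
qed

text \<open>Again \<open>l(Z\<^sup>N) = l(Z\<^sup>N\<^sup>+\<^sup>1)\<close> for some \<open>N\<close>. If this is not \<open>R\<close>, choose \<open>a \<notin> l(Z\<^sup>N)\<close> with \<open>l(a)\<close>
  maximal. For \<open>z \<in> Z\<close> the annihilator \<open>l(az)\<close> is strictly larger than \<open>l(a)\<close>, so \<open>az \<in> l(Z\<^sup>N)\<close>, and
  \<open>a \<in> l(Z\<^sup>N\<^sup>+\<^sup>1)\<close>.\<close>

lemma left_singular_nilpotent_of_left_noetherian: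
  assumes LN: "left_noetherian R"
  obtains n where "words R (left_singular R) n \<subseteq> {\<zero>}"
proof -
  note Zc = left_singular_carrier
  note W = words_carrier[OF Zc]
  define L where "L n = lann R (words R (left_singular R) n)" for n
  note Lid = left_ideal_lann[OF W, folded L_def]
  obtain N where N: "\<forall>n\<ge>N. L n = L N"
    using LN[unfolded left_noetherian_def, rule_format, of L] lann_words_mono[OF Zc] Lid
    by (auto simp: L_def)
  have stab: "L (Suc N) = L N" by (rule N[rule_format]) simp
  have "\<one> \<in> L N"
  proof (rule ccontr)
    assume one: "\<one> \<notin> L N"
    define A where "A = {lann R {a} | a. a \<in> carrier R \<and> a \<notin> L N}"
    have "lann R {\<one>} \<in> A" unfolding A_def using one by blast
    moreover have "left_ideal I R" if "I \<in> A" for I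
      using that unfolding A_def by (auto intro: left_ideal_lann)
    ultimately obtain M where M: "M \<in> A" "\<And>I. I \<in> A \<Longrightarrow> M \<subseteq> I \<Longrightarrow> I = M"
      using left_noetherian_maximal[OF LN] by metis
    then obtain a where a: "a \<in> carrier R" "a \<notin> L N" "M = lann R {a}" unfolding A_def by blast
    have a0: "a \<noteq> \<zero>" using a(2) left_idealD(2)[OF Lid] by metis
    have az: "a \<otimes> z \<in> L N" if z: "z \<in> left_singular R" for z
    proof (rule ccontr)
      assume n: "a \<otimes> z \<notin> L N"
      have zc: "z \<in> carrier R" by (rule left_singularD(1)[OF z])
      obtain r where r: "r \<in> carrier R" "r \<otimes> a \<noteq> \<zero>" "r \<otimes> a \<otimes> z = \<zero>"
        using left_singularD(2)[OF z a(1) a0] by blast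
      have "lann R {a \<otimes> z} \<in> A" unfolding A_def using n a(1) zc by blast
      moreover have "M \<subseteq> lann R {a \<otimes> z}"
        unfolding a(3) using a(1) zc by (auto simp: lann_def m_assoc[symmetric])
      ultimately have "lann R {a \<otimes> z} = M" by (rule M(2))
      moreover have "r \<in> lann R {a \<otimes> z}" using r a(1) zc by (simp add: lann_def m_assoc)
      ultimately show False using r unfolding a(3) by (simp add: lann_def)
    qed
    have "a \<otimes> (z \<otimes> w) = \<zero>" if "w \<in> words R (left_singular R) N" "z \<in> left_singular R" for w z
    proof -
      have "a \<otimes> z \<otimes> w = \<zero>" using az[OF that(2)] that(1) by (simp add: lann_def L_def)
      then show ?thesis using a(1) that W Zc by (simp add: m_assoc subset_iff)
    qed
    then have "a \<in> L (Suc N)"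
      unfolding L_def using a(1) by (auto simp: lann_def)
    then show False using stab a(2) by simp
  qed
  then have "words R (left_singular R) N \<subseteq> {\<zero>}" using W by (auto simp: L_def lann_def subset_iff)
  then show ?thesis by (rule that)
qed

text \<open>Otherwise \<open>x\<close> could be multiplied by arbitrarily long products of elements of \<open>Z\<close> without
  entering \<open>K\<close>. The mirror image is \<open>right_loewy_of_nilpotent\<close>.\<close>

lemma left_loewy_of_nilpotent:
  assumes nil: "words R (left_singular R) n \<subseteq> {\<zero>}" and K: "left_ideal K R"
    and x: "x \<in> carrier R" "x \<notin> K"
  shows "\<exists>r\<in>carrier R. r \<otimes> x \<notin> K \<and> (\<forall>z\<in>left_singular R. z \<otimes> (r \<otimes> x) \<in> K)"
proof (rule ccontr)
  assume *: "\<not> ?thesis"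
  note W = words_carrier[OF left_singular_carrier]
  have "\<exists>w\<in>words R (left_singular R) m. w \<otimes> x \<notin> K" for m
  proof (induction m)
    case 0
    then show ?case using x by simp
  next
    case (Suc m)
    then obtain w where w: "w \<in> words R (left_singular R) m" "w \<otimes> x \<notin> K" by blast
    have wc: "w \<in> carrier R" using w W by blast
    obtain z where z: "z \<in> left_singular R" "z \<otimes> (w \<otimes> x) \<notin> K" using * wc w(2) by blast
    then have "(z \<otimes> w) \<otimes> x \<notin> K" using wc x left_singularD(1)[OF z(1)] by (simp add: m_assoc)
    then show ?case using z(1) w(1) by auto
  qed
  then obtain w where "w \<in> words R (left_singular R) n" "w \<otimes> x \<notin> K" by blast
  then show False using nil left_idealD(2)[OF K] x by auto
qed

lemma right_loewy_of_nilpotent: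
  assumes nil: "words R (left_singular R) n \<subseteq> {\<zero>}" and K: "left_ideal K (opp_ring R)"
    and x: "x \<in> carrier R" "x \<notin> K"
  shows "\<exists>r\<in>carrier R. x \<otimes> r \<notin> K \<and> (\<forall>z\<in>left_singular R. x \<otimes> r \<otimes> z \<in> K)"
proof (rule ccontr)
  assume *: "\<not> ?thesis"
  note W = words_carrier[OF left_singular_carrier]
  have "\<exists>w\<in>words R (left_singular R) m. x \<otimes> w \<notin> K" for m
  proof (induction m)
    case 0
    then show ?case using x by simp
  next
    case (Suc m)
    then obtain w where w: "w \<in> words R (left_singular R) m" "x \<otimes> w \<notin> K" by blast
    have wc: "w \<in> carrier R" using w W by blast
    obtain z where z: "z \<in> left_singular R" "x \<otimes> w \<otimes> z \<notin> K" using * wc w(2) by blast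
    then have "x \<otimes> (w \<otimes> z) \<notin> K" using wc x left_singularD(1)[OF z(1)] by (simp add: m_assoc)
    then show ?case
      unfolding words_Suc_right[OF left_singular_carrier] using z(1) w(1) by blast
  qed
  then obtain w where "w \<in> words R (left_singular R) n" "x \<otimes> w \<notin> K" by blast
  then show False using nil right_idealD(2)[OF K] x by auto
qed

end


section \<open>Left principally injective rings\<close>

text \<open>The condition is left 1-injectivity: \<open>xa \<mapsto> xb\<close> extends from \<open>Ra\<close> to \<open>R\<close>. In terms of annihilators
  it reads \<open>r(l(a)) = aR\<close>.\<close>

locale left_p_injective = ring +
  assumes p_inj: "\<And>a b. a \<in> carrier R \<Longrightarrow> b \<in> carrier R \<Longrightarrow>
    (\<And>x. x \<in> carrier R \<Longrightarrow> x \<otimes> a = \<zero> \<Longrightarrow> x \<otimes> b = \<zero>) \<Longrightarrow> \<exists>c\<in>carrier R. b = a \<otimes> c"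

lemma (in ring) left_p_injective_of_2_injective:
  assumes inj: "left_n_injective R 2" shows "left_p_injective R"
proof unfold_locales
  fix a b assume ab: "a \<in> carrier R" "b \<in> carrier R"
    and ann: "\<And>x. x \<in> carrier R \<Longrightarrow> x \<otimes> a = \<zero> \<Longrightarrow> x \<otimes> b = \<zero>"
  have "x \<otimes> b \<oplus> y \<otimes> b = \<zero>"
    if xy: "x \<in> carrier R" "y \<in> carrier R" "x \<otimes> a \<oplus> y \<otimes> a = \<zero>" for x y
    using ann[of "x \<oplus> y"] xy ab by (simp add: l_distr)
  then obtain d where "d \<in> carrier R" "a \<otimes> d = b" "a \<otimes> d = b"
    using two_injective_pair[OF inj ab(1,1) ab(2,2)] by blast
  then show "\<exists>c\<in>carrier R. b = a \<otimes> c" by auto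
qed

context left_p_injective
begin

text \<open>If \<open>l(x)\<close> is not essential, then \<open>Rb \<inter> l(x) = 0\<close> for some \<open>b \<noteq> 0\<close>. So \<open>l(bx) = l(b)\<close>, which
  gives \<open>b = bxc\<close> and, by iteration, \<open>b = b(xcxc)\<close> with \<open>xcxc \<in> Z\<close>.\<close>

lemma left_singular_semiprime:
  assumes x: "x \<in> carrier R" and xrx: "\<And>r. r \<in> carrier R \<Longrightarrow> x \<otimes> r \<otimes> x \<in> left_singular R"
  shows "x \<in> left_singular R"
proof (rule left_singularI[OF x])
  fix b assume b: "b \<in> carrier R" "b \<noteq> \<zero>"
  show "\<exists>r\<in>carrier R. r \<otimes> b \<noteq> \<zero> \<and> r \<otimes> b \<otimes> x = \<zero>"
  proof (rule ccontr)
    assume *: "\<not> ?thesis"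
    have "r \<otimes> b = \<zero>" if "r \<in> carrier R" "r \<otimes> (b \<otimes> x) = \<zero>" for r
      using * that b(1) x by (auto simp: m_assoc)
    then obtain c where c: "c \<in> carrier R" "b = b \<otimes> x \<otimes> c"
      using p_inj[of "b \<otimes> x" b] b(1) x by auto
    have "b \<otimes> (x \<otimes> c \<otimes> x \<otimes> c) = (b \<otimes> x \<otimes> c) \<otimes> x \<otimes> c" using b(1) x c(1) by (simp add: m_assoc)
    also have "\<dots> = b" using c(2) by simp
    finally have "b \<otimes> (x \<otimes> c \<otimes> x \<otimes> c) = b" .
    moreover have "x \<otimes> c \<otimes> x \<otimes> c \<in> left_singular R"
      using left_singular_mult_right[OF xrx[OF c(1)] c(1)] .
    ultimately show False using left_singular_fixes_nothing b by blast
  qed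
qed

text \<open>The ring \<open>fRf\<close> is local, with \<open>fRf \<inter> Z\<close> as its set of non-units. If \<open>xy = 0\<close> for
  a nonzero \<open>x\<close> in the uniform left ideal \<open>Rf\<close>, then \<open>l(y)\<close> is essential. So \<open>y \<notin> Z\<close> implies
  \<open>l(y) = l(f)\<close>, and \<open>y\<close> has a right inverse \<open>c\<close> in \<open>fRf\<close>; the same applies to \<open>c\<close>.\<close>

lemma uniform_corner_inverse:
  assumes f: "uniform_idempotent R f" and y: "y \<in> carrier R" "f \<otimes> y = y" "y \<otimes> f = y"
    "y \<notin> left_singular R"
  shows "\<exists>c\<in>carrier R. c \<otimes> y = f \<and> y \<otimes> c = f"
proof -
  note fD = uniform_idempotentD[OF f]
  have right: "\<exists>c\<in>carrier R. y \<otimes> c = f \<and> f \<otimes> c = c \<and> c \<otimes> f = c"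
    if y: "y \<in> carrier R" "f \<otimes> y = y" "y \<otimes> f = y" "y \<notin> left_singular R" for y
  proof -
    have inj: "x \<otimes> f = \<zero>" if x: "x \<in> carrier R" "x \<otimes> y = \<zero>" for x
    proof (rule ccontr)
      assume xf: "x \<otimes> f \<noteq> \<zero>"
      have "y \<in> left_singular R"
      proof (rule left_singularI[OF y(1)])
        fix b assume b: "b \<in> carrier R" "b \<noteq> \<zero>"
        have key: "u \<otimes> f \<otimes> y = u \<otimes> y" if "u \<in> carrier R" for u
          using that y(1,2) fD(1) by (simp add: m_assoc)
        show "\<exists>r\<in>carrier R. r \<otimes> b \<noteq> \<zero> \<and> r \<otimes> b \<otimes> y = \<zero>"
        proof (cases "b \<otimes> f = \<zero>")
          case True
          then have "\<one> \<otimes> b \<otimes> y = \<zero>" using key[OF b(1)] y(1) b(1) by simp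
          then show ?thesis using b by (intro bexI[of _ \<one>]) auto
        next
          case False
          have ff: "u \<otimes> f \<otimes> f = u \<otimes> f" if "u \<in> carrier R" for u
            using that fD(1,2) by (simp add: m_assoc)
          obtain r s where rs: "r \<in> carrier R" "s \<in> carrier R"
            "r \<otimes> (b \<otimes> f) = s \<otimes> (x \<otimes> f)" "r \<otimes> (b \<otimes> f) \<noteq> \<zero>"
            using fD(5)[OF m_closed[OF b(1) fD(1)] m_closed[OF x(1) fD(1)]
                ff[OF b(1)] ff[OF x(1)] False xf] by blast
          have "r \<otimes> b \<noteq> \<zero>" using rs(1,4) b(1) fD(1) by (auto simp: m_assoc[symmetric])
          moreover have "r \<otimes> b \<otimes> y = \<zero>"
          proof -
            have "r \<otimes> b \<otimes> y = r \<otimes> (b \<otimes> f) \<otimes> y"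
              using key[of "r \<otimes> b"] rs(1) b(1) fD(1) by (simp add: m_assoc)
            also have "\<dots> = s \<otimes> (x \<otimes> f \<otimes> y)"
              unfolding rs(3) using rs(2) x(1) fD(1) y(1) by (simp add: m_assoc)
            also have "\<dots> = \<zero>" using key[OF x(1)] x(2) rs(2) by simp
            finally show ?thesis .
          qed
          ultimately show ?thesis using rs(1) by blast
        qed
      qed
      then show False using y(4) by blast
    qed
    obtain c where c: "c \<in> carrier R" "f = y \<otimes> c" using p_inj[OF y(1) fD(1) inj] by blast
    have "y \<otimes> (f \<otimes> c \<otimes> f) = y \<otimes> f \<otimes> c \<otimes> f" using y(1) c(1) fD(1) by (simp add: m_assoc)
    also have "\<dots> = f" using y(3) c(2) fD(2) by simp
    finally have "y \<otimes> (f \<otimes> c \<otimes> f) = f" .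
    moreover have "f \<otimes> (f \<otimes> c \<otimes> f) = f \<otimes> c \<otimes> f"
      using c(1) fD(1,2) by (simp add: m_assoc[symmetric])
    moreover have "f \<otimes> c \<otimes> f \<otimes> f = f \<otimes> c \<otimes> f" using c(1) fD(1,2) by (simp add: m_assoc)
    ultimately show ?thesis using c(1) fD(1) by (intro bexI[of _ "f \<otimes> c \<otimes> f"]) auto
  qed
  obtain c where c: "c \<in> carrier R" "y \<otimes> c = f" "f \<otimes> c = c" "c \<otimes> f = c"
    using right[OF y] by blast
  have "c \<notin> left_singular R"
    using left_singular_mult_left[of c y] y(1) c(2) fD(4) by auto
  then obtain d where d: "d \<in> carrier R" "c \<otimes> d = f" "f \<otimes> d = d"
    using right[OF c(1,3,4)] by blast
  have "y = y \<otimes> (c \<otimes> d)" using y(3) d(2) by simp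
  also have "\<dots> = f \<otimes> d" using y(1) c(1,2) d(1) by (simp add: m_assoc[symmetric])
  finally have "y = d" using d(3) by simp
  then show ?thesis using c d(2) by blast
qed

text \<open>\<open>Zf\<close> is the only maximal submodule of \<open>Rf\<close>: as \<open>Z\<close> is semiprime, some \<open>af r af\<close> is not in \<open>Z\<close>,
  and \<open>f r af\<close> is a unit of \<open>fRf\<close>.\<close>

lemma uniform_idempotent_left_local:
  assumes f: "uniform_idempotent R f" and a: "a \<in> carrier R" "a \<otimes> f \<notin> left_singular R"
  shows "\<exists>b\<in>carrier R. b \<otimes> (a \<otimes> f) = f"
proof -
  note fD = uniform_idempotentD[OF f]
  obtain r where r: "r \<in> carrier R" "a \<otimes> f \<otimes> r \<otimes> (a \<otimes> f) \<notin> left_singular R"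
    using left_singular_semiprime[of "a \<otimes> f"] a fD(1) by auto
  define y where "y = f \<otimes> r \<otimes> a \<otimes> f"
  have yc: "y \<in> carrier R" using a(1) r(1) fD(1) by (simp add: y_def)
  have "a \<otimes> y = a \<otimes> f \<otimes> r \<otimes> (a \<otimes> f)" using a(1) r(1) fD(1) by (simp add: y_def m_assoc)
  then have "y \<notin> left_singular R" using left_singular_mult_left[OF _ a(1), of y] r(2) by auto
  moreover have "f \<otimes> y = y" "y \<otimes> f = y"
    using a(1) r(1) fD(1,2) by (simp_all add: y_def m_assoc) (simp add: m_assoc[symmetric])
  ultimately obtain c where c: "c \<in> carrier R" "c \<otimes> y = f"
    using uniform_corner_inverse[OF f yc] by blast
  have "(c \<otimes> f \<otimes> r) \<otimes> (a \<otimes> f) = f"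
    using c a(1) r(1) fD(1) by (simp add: y_def m_assoc)
  then show ?thesis using c(1) fD(1) r(1) by (meson m_closed)
qed

lemma uniform_idempotent_right_local:
  assumes f: "uniform_idempotent R f" and a: "a \<in> carrier R" "f \<otimes> a \<notin> left_singular R"
  shows "\<exists>b\<in>carrier R. f \<otimes> a \<otimes> b = f"
proof -
  note fD = uniform_idempotentD[OF f]
  obtain r where r: "r \<in> carrier R" "f \<otimes> a \<otimes> r \<otimes> (f \<otimes> a) \<notin> left_singular R"
    using left_singular_semiprime[of "f \<otimes> a"] a fD(1) by auto
  define y where "y = f \<otimes> a \<otimes> r \<otimes> f"
  have yc: "y \<in> carrier R" using a(1) r(1) fD(1) by (simp add: y_def)
  have "y \<otimes> a = f \<otimes> a \<otimes> r \<otimes> (f \<otimes> a)" using a(1) r(1) fD(1) by (simp add: y_def m_assoc)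
  then have "y \<notin> left_singular R" using left_singular_mult_right[OF _ a(1), of y] r(2) by auto
  moreover have "f \<otimes> y = y" "y \<otimes> f = y"
    using a(1) r(1) fD(1,2) by (simp_all add: y_def m_assoc) (simp add: m_assoc[symmetric])
  ultimately obtain c where c: "c \<in> carrier R" "y \<otimes> c = f"
    using uniform_corner_inverse[OF f yc] by blast
  have "f \<otimes> a \<otimes> (r \<otimes> f \<otimes> c) = f"
    using c a(1) r(1) fD(1) by (simp add: y_def m_assoc)
  then show ?thesis using c(1) fD(1) r(1) by (meson m_closed)
qed

end

section \<open>Decomposing the identity into uniform idempotents\<close>

text \<open>\<open>e\<close> is a finite sum of elements of \<open>F\<close>. The closure form serves directly for arguments of the
  kind "true for all \<open>f\<close>, hence for \<open>1\<close>".\<close>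

definition additively_generates :: "('a, 'r) ring_scheme \<Rightarrow> 'a set \<Rightarrow> 'a \<Rightarrow> bool" where
  "additively_generates R F e \<longleftrightarrow> (\<forall>K \<subseteq> carrier R. \<zero>\<^bsub>R\<^esub> \<in> K \<longrightarrow>
     (\<forall>a\<in>K. \<forall>b\<in>K. a \<oplus>\<^bsub>R\<^esub> b \<in> K) \<longrightarrow> F \<subseteq> K \<longrightarrow> e \<in> K)"

text \<open>If \<open>Ra\<close> and \<open>Rb\<close> do not meet, 2-injectivity extends the map fixing \<open>a\<close> and killing \<open>b\<close>, so
  \<open>r(b)\<close> is not contained in \<open>r(a)\<close>. Therefore \<open>Ra\<close> and \<open>Rb\<close> meet as soon as \<open>r(b) \<subseteq> r(a)\<close>. Choose
  \<open>r(y) \<supseteq> r(k)\<close> maximal. Then \<open>Ry\<close> meets \<open>Rk\<close>, and all nonzero elements of \<open>Ry\<close> have the same right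
  annihilator.\<close>

lemma (in ring) uniform_ideal_exists_of_right_noetherian:
  assumes RN: "left_noetherian (opp_ring R)" and inj: "left_n_injective R 2"
    and K: "left_ideal K R" "K \<noteq> {\<zero>}"
  obtains U where "uniform_left R U" "U \<subseteq> K"
proof -
  note KD = left_idealD[OF K(1)]
  have sep: "\<exists>r\<in>carrier R. \<exists>s\<in>carrier R. r \<otimes> a = s \<otimes> b \<and> r \<otimes> a \<noteq> \<zero>"
    if ab: "a \<in> carrier R" "b \<in> carrier R" and a0: "a \<noteq> \<zero>" and sub: "rann R {b} \<subseteq> rann R {a}" for a b
  proof (rule ccontr)
    assume *: "\<not> ?thesis"
    have "x \<otimes> a \<oplus> y \<otimes> \<zero> = \<zero>"
      if xy: "x \<in> carrier R" "y \<in> carrier R" "x \<otimes> a \<oplus> y \<otimes> b = \<zero>" for x y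
    proof -
      have "x \<otimes> a = (\<ominus> y) \<otimes> b"
        using xy ab by (simp add: l_minus minus_equality[symmetric])
      then have "x \<otimes> a = \<zero>" using * xy(1,2) by (meson a_inv_closed)
      then show ?thesis using xy(2) by simp
    qed
    then obtain d where d: "d \<in> carrier R" "a \<otimes> d = a" "b \<otimes> d = \<zero>"
      using two_injective_pair[OF inj ab(1,2) ab(1) zero_closed] by metis
    then have "d \<in> rann R {b}" by (simp add: rann_def)
    then have "d \<in> rann R {a}" using sub by blast
    then show False using d(2) a0 by (simp add: rann_def)
  qed
  obtain k where k: "k \<in> K" "k \<noteq> \<zero>" using K(2) KD(2) by blast
  have kc: "k \<in> carrier R" by (rule KD(5)[OF k(1)])
  define A where "A = {rann R {y} | y. y \<in> carrier R \<and> y \<noteq> \<zero> \<and> rann R {k} \<subseteq> rann R {y}}"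
  have "rann R {k} \<in> A" unfolding A_def using k kc by blast
  moreover have "left_ideal I (opp_ring R)" if "I \<in> A" for I
    using that unfolding A_def by (auto intro: right_ideal_rann)
  ultimately obtain M where M: "M \<in> A" "\<And>I. I \<in> A \<Longrightarrow> M \<subseteq> I \<Longrightarrow> I = M"
    using left_noetherian_maximal[OF RN] by metis
  then obtain y where y: "y \<in> carrier R" "y \<noteq> \<zero>" "rann R {k} \<subseteq> rann R {y}" "M = rann R {y}"
    unfolding A_def by blast
  obtain r s where rs: "r \<in> carrier R" "s \<in> carrier R" "r \<otimes> y = s \<otimes> k" "r \<otimes> y \<noteq> \<zero>"
    using sep[OF y(1) kc y(2,3)] by blast
  define w where "w = r \<otimes> y"
  have w: "w \<in> carrier R" "w \<noteq> \<zero>" "w \<in> K"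
    using rs y(1) KD(4)[OF k(1) rs(2)] KD(5)[OF KD(4)[OF k(1) rs(2)]] by (auto simp: w_def)
  have same: "rann R {v} = M" if v: "v \<in> principal_left R w" "v \<noteq> \<zero>" for v
  proof -
    obtain t where t: "t \<in> carrier R" "v = t \<otimes> w" using v(1) unfolding principal_left_def by blast
    have le: "rann R {y} \<subseteq> rann R {v}"
      using t rs(1) y(1) by (auto simp: rann_def w_def m_assoc)
    have vc: "v \<in> carrier R" using t w(1) by simp
    have "rann R {v} \<in> A" unfolding A_def using vc v(2) le y(3) by blast
    then show ?thesis using M(2) le unfolding y(4) by blast
  qed
  note P = left_ideal_principal[OF w(1)]
  have "uniform_left R (principal_left R w)"
    unfolding uniform_left_def
  proof (intro conjI ballI impI P)
    show "principal_left R w \<noteq> {\<zero>}" using principal_left_self[OF w(1)] w(2) by blast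
    fix a b assume ab: "a \<in> principal_left R w" "b \<in> principal_left R w" "a \<noteq> \<zero>" "b \<noteq> \<zero>"
    have "rann R {b} \<subseteq> rann R {a}" using same ab by simp
    then show "\<exists>r\<in>carrier R. \<exists>s\<in>carrier R. r \<otimes> a = s \<otimes> b \<and> r \<otimes> a \<noteq> \<zero>"
      using sep left_idealD(5)[OF P] ab by blast
  qed
  then show ?thesis using that principal_left_subset[OF K(1) w(3)] by blast
qed

text \<open>Choose \<open>B\<close> maximal among the left ideals with \<open>B \<inter> Rk = 0\<close> for some nonzero \<open>k \<in> K\<close>. If two
  nonzero left ideals \<open>Ra\<close> and \<open>Rb\<close> inside \<open>Rk\<close> did not meet, then \<open>B + Ra\<close> would still miss \<open>Rb\<close>.\<close>

lemma (in ring) uniform_ideal_exists_of_left_noetherian: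
  assumes LN: "left_noetherian R" and K: "left_ideal K R" "K \<noteq> {\<zero>}"
  obtains U where "uniform_left R U" "U \<subseteq> K"
proof -
  note KD = left_idealD[OF K(1)]
  define A where
    "A = {B. left_ideal B R \<and> (\<exists>k\<in>K. k \<noteq> \<zero> \<and> B \<inter> principal_left R k = {\<zero>})}"
  obtain k where k: "k \<in> K" "k \<noteq> \<zero>" using K(2) KD(2) by blast
  have "{\<zero>} \<inter> principal_left R k = {\<zero>}"
    using left_idealD(2)[OF left_ideal_principal[OF KD(5)[OF k(1)]]] by blast
  then have "{\<zero>} \<in> A" unfolding A_def using k left_ideal_zero by blast
  then obtain B where B: "B \<in> A" "\<And>I. I \<in> A \<Longrightarrow> B \<subseteq> I \<Longrightarrow> I = B"
    using left_noetherian_maximal[OF LN, of "{\<zero>}" A] A_def by blast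
  then obtain k where k: "k \<in> K" "k \<noteq> \<zero>" "B \<inter> principal_left R k = {\<zero>}" and Bid: "left_ideal B R"
    unfolding A_def by blast
  have kc: "k \<in> carrier R" by (rule KD(5)[OF k(1)])
  note P = left_ideal_principal[OF kc] and BD = left_idealD[OF Bid]
  note PD = left_idealD[OF P]
  have PK: "principal_left R k \<subseteq> K" by (rule principal_left_subset[OF K(1) k(1)])
  have "uniform_left R (principal_left R k)"
    unfolding uniform_left_def
  proof (intro conjI ballI impI P)
    show "principal_left R k \<noteq> {\<zero>}" using principal_left_self[OF kc] k(2) by blast
    fix a b assume ab: "a \<in> principal_left R k" "b \<in> principal_left R k" "a \<noteq> \<zero>" "b \<noteq> \<zero>"
    have abc: "a \<in> carrier R" "b \<in> carrier R" using PD(5) ab by auto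
    note T = left_ideal_adjoin[OF Bid abc(1)]
    show "\<exists>r\<in>carrier R. \<exists>s\<in>carrier R. r \<otimes> a = s \<otimes> b \<and> r \<otimes> a \<noteq> \<zero>"
    proof (rule ccontr)
      assume *: "\<not> ?thesis"
      have "w = \<zero>" if w: "w \<in> adjoin_left R B a" "w \<in> principal_left R b" for w
      proof -
        obtain i r where ir: "i \<in> B" "r \<in> carrier R" "w = i \<oplus> r \<otimes> a"
          using w(1) unfolding adjoin_left_def by blast
        obtain s where s: "s \<in> carrier R" "w = s \<otimes> b" using w(2) unfolding principal_left_def by blast
        have "w \<ominus> r \<otimes> a \<in> principal_left R k"
          unfolding s(2) by (rule PD(7)[OF PD(4)[OF ab(2) s(1)] PD(4)[OF ab(1) ir(2)]])
        moreover have "w \<ominus> r \<otimes> a = i"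
          using ir abc BD(5)[OF ir(1)] by (simp add: minus_eq a_assoc r_neg)
        ultimately have "i = \<zero>" using k(3) ir(1) by auto
        then have "w = r \<otimes> a" using ir abc by simp
        then show ?thesis using * s ir(2) by metis
      qed
      then have "adjoin_left R B a \<inter> principal_left R b = {\<zero>}"
        using left_idealD(2)[OF T(1)] left_idealD(2)[OF left_ideal_principal[OF abc(2)]] by blast
      then have "adjoin_left R B a \<in> A" unfolding A_def using T(1) PK ab(2,4) by blast
      then have "a \<in> B" using B(2) T by blast
      then show False using k(3) ab(1,3) by blast
    qed
  qed
  then show ?thesis using that PK by blast
qed

text \<open>Suppose that each \<open>c \<in> C\<close> kills a nonzero element of \<open>C\<close>. An element \<open>x\<close> with \<open>x(1 - c) = 0\<close> lies in
  \<open>C\<close>, and the uniformity of \<open>C\<close> forces \<open>x = 0\<close>. So \<open>1 - c\<close> has a right inverse, hence an inverse, and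
  \<open>C\<close> is small. Consequently some \<open>c \<in> C\<close> acts injectively on \<open>C\<close>. Then \<open>l(c\<^sup>2) = l(c)\<close>, that is
  \<open>c = c\<^sup>2d\<close>, and the right noetherian condition turns this into \<open>c = cdc\<close>.\<close>

lemma (in left_p_injective) uniform_complement_summand_of_right_noetherian:
  assumes RN: "left_noetherian (opp_ring R)" and C: "uniform_left R C"
    and ns: "\<not> small_left_ideal R C"
  obtains g where "g \<in> carrier R" "g \<otimes> g = g" "C = principal_left R g"
proof -
  note Cid = uniform_leftD(1)[OF C]
  note CD = left_idealD[OF Cid]
  \<comment> \<open>A surjective endomorphism of a noetherian module is injective, here left multiplication by
    \<open>c\<close> on \<open>cR = c\<^sup>2R\<close>.\<close>
  have stable: "c \<otimes> x = \<zero>"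
    if c: "c \<in> carrier R" "d \<in> carrier R" "c = c \<otimes> c \<otimes> d"
      and x: "x \<in> carrier R" "c \<otimes> (c \<otimes> x) = \<zero>" for c d x
  proof -
    define L where "L n = rann R {c [^] (n::nat)}" for n
    have "left_ideal (L n) (opp_ring R)" for n
      unfolding L_def by (rule right_ideal_rann) (simp add: c(1))
    moreover have "L n \<subseteq> L (Suc n)" for n
    proof
      fix y assume "y \<in> L n"
      then have y: "y \<in> carrier R" "c [^] n \<otimes> y = \<zero>" by (auto simp: L_def rann_def)
      have "c [^] Suc n \<otimes> y = c \<otimes> (c [^] n \<otimes> y)"
        unfolding nat_pow_Suc2[OF c(1)] using c(1) y(1) by (simp add: m_assoc)
      then show "y \<in> L (Suc n)" using y c(1) by (simp add: L_def rann_def del: nat_pow_Suc)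
    qed
    ultimately obtain N where N: "\<forall>n\<ge>N. L n = L N"
      using RN[unfolded left_noetherian_def, rule_format, of L] by auto
    have pw: "c = c [^] Suc n \<otimes> d [^] n" for n
    proof (induction n)
      case 0 then show ?case using c by simp
    next
      case (Suc n)
      have "c [^] Suc (Suc n) \<otimes> d [^] Suc n = c \<otimes> (c [^] Suc n \<otimes> d [^] n) \<otimes> d"
        using c(1,2) nat_pow_Suc2[OF c(1), of "Suc n"] by (simp add: m_assoc del: nat_pow_Suc)
      then show ?case using Suc c(3) by simp
    qed
    define y where "y = d [^] N \<otimes> x"
    have yc: "y \<in> carrier R" using c x by (simp add: y_def)
    have cx: "c \<otimes> x = c [^] Suc N \<otimes> y"
      using pw[of N] c(1,2) x(1) by (metis m_assoc y_def nat_pow_closed)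
    have "c [^] Suc (Suc N) \<otimes> y = \<zero>"
      using x(2) cx yc c(1) nat_pow_Suc2[OF c(1), of "Suc N"] by (simp add: m_assoc del: nat_pow_Suc)
    then have "y \<in> L (Suc (Suc N))" using yc by (simp add: L_def rann_def del: nat_pow_Suc)
    moreover have "L (Suc (Suc N)) = L (Suc N)" using N by (metis le_SucI order_refl)
    ultimately have "y \<in> L (Suc N)" by blast
    then have "c [^] Suc N \<otimes> y = \<zero>" by (simp add: L_def rann_def del: nat_pow_Suc)
    then show ?thesis using cx by simp
  qed
  have "\<exists>c\<in>C. \<forall>x\<in>C. x \<otimes> c = \<zero> \<longrightarrow> x = \<zero>"
  proof (rule ccontr)
    assume "\<not> ?thesis"
    then have kill: "\<exists>x\<in>C. x \<otimes> c = \<zero> \<and> x \<noteq> \<zero>" if "c \<in> C" for c using that by blast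
    have unit: "\<exists>d\<in>carrier R. d \<otimes> (\<one> \<ominus> c) = \<one>" if cC: "c \<in> C" for c
    proof -
      have cc: "c \<in> carrier R" by (rule CD(5)[OF cC])
      obtain x where x: "x \<in> C" "x \<otimes> c = \<zero>" "x \<noteq> \<zero>" using kill[OF cC] by blast
      have xc: "x \<in> carrier R" by (rule CD(5)[OF x(1)])
      have mul: "y \<otimes> (\<one> \<ominus> c) = y \<ominus> y \<otimes> c" if "y \<in> carrier R" for y
        using that cc by (simp add: minus_eq r_distr r_minus)
      have "y = \<zero>" if y: "y \<in> carrier R" "y \<otimes> (\<one> \<ominus> c) = \<zero>" for y
      proof (rule ccontr)
        assume y0: "y \<noteq> \<zero>"
        have yy: "y = y \<otimes> c" using eq_of_minus_zero mul[OF y(1)] y cc by simp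
        then have "y \<in> C" using CD(4)[OF cC y(1)] by simp
        then obtain r s where rs: "r \<in> carrier R" "s \<in> carrier R" "r \<otimes> x = s \<otimes> y" "r \<otimes> x \<noteq> \<zero>"
          using uniform_leftD(3)[OF C x(1) _ x(3) y0] by blast
        have "r \<otimes> x \<otimes> c = \<zero>" using rs(1) xc cc x(2) by (simp add: m_assoc)
        moreover have "s \<otimes> y \<otimes> c = s \<otimes> y" using rs(2) y(1) cc yy[symmetric] by (simp add: m_assoc)
        ultimately show False using rs by simp
      qed
      then obtain d where d: "d \<in> carrier R" "\<one> = (\<one> \<ominus> c) \<otimes> d"
        using p_inj[OF minus_closed[OF one_closed cc] one_closed] by auto
      define a where "a = \<one> \<ominus> c"
      have a: "a \<in> carrier R" using cc by (simp add: a_def)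
      have ad: "a \<otimes> d = \<one>" using d(2) by (simp add: a_def)
      \<comment> \<open>The right inverse is two-sided: \<open>u = 1 - da\<close> satisfies \<open>au = 0\<close> and \<open>u = a(du)\<close>.\<close>
      have "a = a \<otimes> a \<otimes> d" using a d(1) ad by (simp add: m_assoc)
      note st = stable[OF a d(1) this]
      define u where "u = \<one> \<ominus> d \<otimes> a"
      have u: "u \<in> carrier R" using a d(1) by (simp add: u_def)
      have "a \<otimes> u = a \<ominus> (a \<otimes> d) \<otimes> a" using a d(1) by (simp add: u_def minus_eq r_distr r_minus m_assoc)
      then have au: "a \<otimes> u = \<zero>" using a ad by (simp add: minus_eq r_neg)
      have adu: "a \<otimes> (d \<otimes> u) = u" using a d(1) u ad by (simp add: m_assoc[symmetric])
      have "a \<otimes> (d \<otimes> u) = \<zero>" by (rule st) (use adu au d(1) u in simp_all)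
      then have "u = \<zero>" using adu by simp
      then have "\<one> = d \<otimes> a" using eq_of_minus_zero a d(1) by (simp add: u_def)
      then show ?thesis using d(1) by (intro bexI[of _ d]) (simp_all add: a_def)
    qed
    have "small_left_ideal R C"
      unfolding small_left_ideal_def
    proof (intro conjI allI impI)
      show "left_ideal C R" by (rule Cid)
      fix K assume K: "left_ideal K R \<and> K <+>\<^bsub>R\<^esub> C = carrier R"
      note KD = left_idealD[OF conjunct1[OF K]]
      have "\<one> \<in> K <+>\<^bsub>R\<^esub> C" using K by simp
      then obtain k c where kc: "k \<in> K" "c \<in> C" "\<one> = k \<oplus> c"
        unfolding set_add_def' by blast
      have "k = \<one> \<ominus> c" using kc KD(5)[OF kc(1)] CD(5)[OF kc(2)] by (simp add: minus_eq a_assoc r_neg)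
      then obtain d where "d \<in> carrier R" "d \<otimes> k = \<one>" using unit[OF kc(2)] by blast
      then have "\<one> \<in> K" using KD(4)[OF kc(1)] by metis
      then have "x \<in> K" if "x \<in> carrier R" for x using KD(4)[of \<one> x] that by simp
      then show "K = carrier R" using KD(1) by blast
    qed
    then show False using ns by blast
  qed
  then obtain c where c: "c \<in> C" "\<And>x. x \<in> C \<Longrightarrow> x \<otimes> c = \<zero> \<Longrightarrow> x = \<zero>" by blast
  have cc: "c \<in> carrier R" by (rule CD(5)[OF c(1)])
  have "\<exists>d\<in>carrier R. c = c \<otimes> c \<otimes> d"
  proof (rule p_inj)
    fix x assume x: "x \<in> carrier R" "x \<otimes> (c \<otimes> c) = \<zero>"
    then show "x \<otimes> c = \<zero>" using c(2)[OF CD(4)[OF c(1) x(1)]] cc by (simp add: m_assoc)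
  qed (use cc in auto)
  then obtain d where d: "d \<in> carrier R" "c = c \<otimes> c \<otimes> d" by blast
  have cdc: "c \<otimes> (d \<otimes> c) = c"
  proof -
    define x where "x = d \<otimes> c \<ominus> \<one>"
    have xc: "x \<in> carrier R" using cc d(1) by (simp add: x_def)
    have "c \<otimes> (c \<otimes> x) = c \<otimes> c \<otimes> d \<otimes> c \<ominus> c \<otimes> c"
      using cc d(1) by (simp add: x_def minus_eq r_distr r_minus m_assoc)
    also have "\<dots> = \<zero>" using d(2)[symmetric] cc by (simp add: minus_eq r_neg)
    finally have "c \<otimes> x = \<zero>" using stable[OF cc d xc] by blast
    then have "c \<otimes> (d \<otimes> c) \<ominus> c = \<zero>" using cc d(1) by (simp add: x_def minus_eq r_distr r_minus)
    then show ?thesis using eq_of_minus_zero cc d(1) by simp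
  qed
  define g where "g = d \<otimes> c"
  have g: "g \<in> carrier R" "g \<in> C" "g \<otimes> g = g" "c \<otimes> g = c"
    using cc d(1) CD(4)[OF c(1) d(1)] cdc by (simp_all add: g_def m_assoc)
  have "C = principal_left R g"
  proof
    show "principal_left R g \<subseteq> C" by (rule principal_left_subset[OF Cid g(2)])
    show "C \<subseteq> principal_left R g"
    proof
      fix x assume x: "x \<in> C"
      have xc: "x \<in> carrier R" by (rule CD(5)[OF x])
      have "x \<ominus> x \<otimes> g \<in> C" by (rule CD(7)[OF x CD(4)[OF g(2) xc]])
      moreover have "(x \<ominus> x \<otimes> g) \<otimes> g = \<zero>"
        using xc g(1,3) by (simp add: minus_eq l_distr l_minus m_assoc r_neg)
      moreover have "y = \<zero>" if y: "y \<in> C" "y \<otimes> g = \<zero>" for y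
      proof (rule ccontr)
        assume y0: "y \<noteq> \<zero>"
        have yc: "y \<in> carrier R" by (rule CD(5)[OF y(1)])
        have "g \<noteq> \<zero>" using g(4) cc c(2)[OF y(1)] y0 yc by auto
        then obtain r s where rs: "r \<in> carrier R" "s \<in> carrier R" "r \<otimes> y = s \<otimes> g" "r \<otimes> y \<noteq> \<zero>"
          using uniform_leftD(3)[OF C y(1) g(2) y0] by blast
        have "r \<otimes> y \<otimes> g = \<zero>" using rs(1) yc g(1) y(2) by (simp add: m_assoc)
        moreover have "s \<otimes> g \<otimes> g = s \<otimes> g" using rs(2) g(1,3) by (simp add: m_assoc)
        ultimately show False using rs by simp
      qed
      ultimately have "x \<ominus> x \<otimes> g = \<zero>" by blast
      then have "x = x \<otimes> g" using eq_of_minus_zero xc g(1) by simp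
      then show "x \<in> principal_left R g" unfolding principal_left_def using xc by blast
    qed
  qed
  then show ?thesis using that g by blast
qed

text \<open>Enlarge the relative complement of \<open>C\<close> to a maximal \<open>S\<close>, and extend the projection
  \<open>C + S \<rightarrow> C\<close> to right multiplication by \<open>e\<close>. By the maximality of \<open>S\<close>, every nonzero element of \<open>Re\<close>
  has a nonzero multiple in \<open>C\<close>. So \<open>Re\<close> misses \<open>S\<close>, and the maximality of \<open>C\<close> gives \<open>C = Re\<close>.\<close>

lemma (in ring) complement_summand_of_baer:
  assumes baer: "baer_left R" and C: "complement_left_ideal R C"
  obtains g where "g \<in> carrier R" "g \<otimes> g = g" "C = principal_left R g"
proof -
  obtain S0 where S0: "left_ideal S0 R" "left_ideal C R" "C \<inter> S0 = {\<zero>}"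
    "\<And>C'. left_ideal C' R \<Longrightarrow> C' \<inter> S0 = {\<zero>} \<Longrightarrow> C \<subseteq> C' \<Longrightarrow> C' = C"
    using C unfolding complement_left_ideal_def by metis
  have S0C: "S0 \<inter> C = {\<zero>}" using S0(3) by blast
  obtain S where S: "left_ideal S R" "S0 \<subseteq> S" "S \<inter> C = {\<zero>}"
    "\<And>S'. left_ideal S' R \<Longrightarrow> S' \<inter> C = {\<zero>} \<Longrightarrow> S \<subseteq> S' \<Longrightarrow> S' = S"
    using left_complement_exists[OF S0(1,2) S0C] by metis
  note CD = left_idealD[OF S0(2)] and SD = left_idealD[OF S(1)]
  define I where "I = {c \<oplus> s | c s. c \<in> C \<and> s \<in> S}"
  have uniq: "c = c'" if m: "c \<in> C" "s \<in> S" "c' \<in> C" "s' \<in> S" "c \<oplus> s = c' \<oplus> s'" for c s c' s'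
  proof -
    have cc: "c \<in> carrier R" "s \<in> carrier R" "c' \<in> carrier R" "s' \<in> carrier R"
      using m CD(5) SD(5) by auto
    have "c \<ominus> c' = s' \<ominus> s"
    proof -
      have "(c \<oplus> s) \<ominus> c' \<ominus> s = (c \<ominus> c') \<oplus> (s \<ominus> s)" using cc by (simp add: minus_eq a_ac)
      then have "c \<ominus> c' = (c \<oplus> s) \<ominus> c' \<ominus> s" using cc by (simp add: minus_eq r_neg)
      also have "\<dots> = (c' \<oplus> s') \<ominus> c' \<ominus> s" using m(5) by simp
      also have "\<dots> = s' \<ominus> s"
      proof -
        have "(c' \<oplus> s') \<ominus> c' = s'" using cc by (simp add: minus_eq a_comm[of c' s'] a_assoc r_neg)
        then show ?thesis by simp
      qed
      finally show ?thesis .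
    qed
    then have "c \<ominus> c' \<in> S \<inter> C" using CD(7)[OF m(1,3)] SD(7)[OF m(4,2)] by simp
    then have "c \<ominus> c' = \<zero>" using S(3) by blast
    then show ?thesis using eq_of_minus_zero cc by blast
  qed
  define p where "p u = (THE c. c \<in> C \<and> (\<exists>s\<in>S. u = c \<oplus> s))" for u
  have p: "p (c \<oplus> s) = c" if "c \<in> C" "s \<in> S" for c s
    unfolding p_def
  proof (rule the_equality)
    show "c \<in> C \<and> (\<exists>s'\<in>S. c \<oplus> s = c \<oplus> s')" using that by blast
    show "c' = c" if "c' \<in> C \<and> (\<exists>s'\<in>S. c \<oplus> s = c' \<oplus> s')" for c'
      using that uniq \<open>c \<in> C\<close> \<open>s \<in> S\<close> by metis
  qed
  have add: "(c \<oplus> s) \<oplus> (c' \<oplus> s') = (c \<oplus> c') \<oplus> (s \<oplus> s')"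
    if "c \<in> C" "s \<in> S" "c' \<in> C" "s' \<in> S" for c s c' s'
    using CD(5)[OF that(1)] SD(5)[OF that(2)] CD(5)[OF that(3)] SD(5)[OF that(4)] by (simp add: a_ac)
  have mul: "r \<otimes> (c \<oplus> s) = r \<otimes> c \<oplus> r \<otimes> s" if "r \<in> carrier R" "c \<in> C" "s \<in> S" for r c s
    using that(1) CD(5)[OF that(2)] SD(5)[OF that(3)] by (simp add: r_distr)
  have Iid: "left_ideal I R"
  proof (rule left_idealI)
    show "I \<subseteq> carrier R" using CD(5) SD(5) by (auto simp: I_def)
    have "\<zero> = \<zero> \<oplus> \<zero>" by simp
    then show "\<zero> \<in> I" unfolding I_def using CD(2) SD(2) by blast
    show "u \<oplus> v \<in> I" if uv: "u \<in> I" "v \<in> I" for u v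
    proof -
      obtain c s c' s' where *: "c \<in> C" "s \<in> S" "c' \<in> C" "s' \<in> S" "u = c \<oplus> s" "v = c' \<oplus> s'"
        using uv unfolding I_def by blast
      show ?thesis unfolding *(5,6) add[OF *(1-4)] I_def
        using CD(3)[OF *(1,3)] SD(3)[OF *(2,4)] by blast
    qed
    show "r \<otimes> u \<in> I" if ru: "u \<in> I" "r \<in> carrier R" for u r
    proof -
      obtain c s where *: "c \<in> C" "s \<in> S" "u = c \<oplus> s" using ru unfolding I_def by blast
      show ?thesis unfolding *(3) mul[OF ru(2) *(1,2)] I_def
        using CD(4)[OF *(1) ru(2)] SD(4)[OF *(2) ru(2)] by blast
    qed
  qed
  have "p \<in> I \<rightarrow> carrier R" using p CD(5) by (auto simp: I_def)
  moreover have "p (u \<oplus> v) = p u \<oplus> p v" if uv: "u \<in> I" "v \<in> I" for u v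
  proof -
    obtain c s c' s' where *: "c \<in> C" "s \<in> S" "c' \<in> C" "s' \<in> S" "u = c \<oplus> s" "v = c' \<oplus> s'"
      using uv unfolding I_def by blast
    show ?thesis unfolding *(5,6) add[OF *(1-4)]
      using p[OF CD(3)[OF *(1,3)] SD(3)[OF *(2,4)]] p[OF *(1,2)] p[OF *(3,4)] by simp
  qed
  moreover have "p (r \<otimes> u) = r \<otimes> p u" if ru: "r \<in> carrier R" "u \<in> I" for u r
  proof -
    obtain c s where *: "c \<in> C" "s \<in> S" "u = c \<oplus> s" using ru unfolding I_def by blast
    show ?thesis unfolding *(3) mul[OF ru(1) *(1,2)]
      using p[OF CD(4)[OF *(1) ru(1)] SD(4)[OF *(2) ru(1)]] p[OF *(1,2)] by simp
  qed
  ultimately obtain e where e: "e \<in> carrier R" "\<forall>x\<in>I. p x = x \<otimes> e"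
    using baer_leftE[OF baer Iid, of p] by metis
  have eC: "c \<otimes> e = c" if c: "c \<in> C" for c
  proof -
    have cc: "c = c \<oplus> \<zero>" using CD(5)[OF c] by simp
    then have "c \<in> I" unfolding I_def using c SD(2) by blast
    then show ?thesis using e(2) p[OF c SD(2)] cc by metis
  qed
  have eS: "s \<otimes> e = \<zero>" if s: "s \<in> S" for s
  proof -
    have cc: "s = \<zero> \<oplus> s" using SD(5)[OF s] by simp
    then have "s \<in> I" unfolding I_def using s CD(2) by blast
    then show ?thesis using e(2) p[OF CD(2) s] cc by metis
  qed
  note P = left_ideal_principal[OF e(1)]
  have "w = \<zero>" if w: "w \<in> principal_left R e" "w \<in> S" for w
  proof (rule ccontr)
    assume w0: "w \<noteq> \<zero>"
    obtain x where x: "x \<in> carrier R" "w = x \<otimes> e" using w(1) unfolding principal_left_def by blast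
    have "x \<notin> S" using eS x(2) w0 by metis
    note T = left_ideal_adjoin[OF S(1) x(1)]
    have "adjoin_left R S x \<inter> C \<noteq> {\<zero>}" using S(4)[OF T(1) _ T(2)] T(3) \<open>x \<notin> S\<close> by blast
    then obtain c where c: "c \<in> adjoin_left R S x" "c \<in> C" "c \<noteq> \<zero>"
      using left_idealD(2)[OF T(1)] CD(2) by blast
    then obtain s r where sr: "s \<in> S" "r \<in> carrier R" "c = s \<oplus> r \<otimes> x"
      unfolding adjoin_left_def by blast
    have "c \<otimes> e = s \<otimes> e \<oplus> r \<otimes> w"
      unfolding sr(3) x(2) using SD(5)[OF sr(1)] sr(2) x(1) e(1) by (simp add: l_distr m_assoc)
    then have "c = r \<otimes> w" using eC[OF c(2)] eS[OF sr(1)] sr(2) x e(1) by simp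
    then have "c \<in> S \<inter> C" using SD(4)[OF w(2) sr(2)] c(2) by blast
    then show False using S(3) c(3) by blast
  qed
  then have "principal_left R e \<inter> S0 = {\<zero>}"
    using S(2) left_idealD(2)[OF P] left_idealD(2)[OF S0(1)] by blast
  moreover have sub: "C \<subseteq> principal_left R e"
  proof
    fix c assume c: "c \<in> C"
    have "c = c \<otimes> e" using eC[OF c] by simp
    then show "c \<in> principal_left R e" unfolding principal_left_def using CD(5)[OF c] by blast
  qed
  ultimately have eq: "principal_left R e = C" using S0(4) P by blast
  then have "e \<otimes> e = e" using eC principal_left_self[OF e(1)] by blast
  then show ?thesis using that e(1) eq by blast
qed

lemma (in ring) complement_not_small_of_baer:
  assumes baer: "baer_left R" and C: "complement_left_ideal R C" "C \<noteq> {\<zero>}"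
  shows "\<not> small_left_ideal R C"
proof
  assume small: "small_left_ideal R C"
  obtain g where g: "g \<in> carrier R" "g \<otimes> g = g" "C = principal_left R g"
    using complement_summand_of_baer[OF baer C(1)] by blast
  define n where "n = \<one> \<ominus> g"
  have n: "n \<in> carrier R" using g by (simp add: n_def)
  note P = left_ideal_principal[OF n]
  have "principal_left R n <+>\<^bsub>R\<^esub> C = carrier R"
  proof
    show "principal_left R n <+>\<^bsub>R\<^esub> C \<subseteq> carrier R"
      using left_idealD(5)[OF P] left_idealD(5)[OF left_ideal_principal[OF g(1)]] g(3)
      unfolding set_add_def' by auto
    show "carrier R \<subseteq> principal_left R n <+>\<^bsub>R\<^esub> C"
    proof
      fix x assume x: "x \<in> carrier R"
      have "x = x \<otimes> n \<oplus> x \<otimes> g"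
        using x g(1) by (simp add: n_def minus_eq r_distr r_minus a_assoc l_neg)
      then show "x \<in> principal_left R n <+>\<^bsub>R\<^esub> C"
        unfolding set_add_def' g(3) principal_left_def using x by blast
    qed
  qed
  then have "principal_left R n = carrier R" using small P unfolding small_left_ideal_def by blast
  then obtain x where x: "x \<in> carrier R" "g = x \<otimes> n" using g(1) unfolding principal_left_def by blast
  have "g \<otimes> g = x \<otimes> (n \<otimes> g)" using x n g(1) by (simp add: m_assoc)
  also have "n \<otimes> g = \<zero>" using g(1,2) by (simp add: n_def minus_eq l_distr l_minus r_neg)
  finally have "g = \<zero>" using g(2) x by simp
  then have "C = {\<zero>}" unfolding g(3) principal_left_def by force
  then show False using C(2) by blast
qed


context left_p_injective
begin

text \<open>The summands \<open>Rg\<close> and \<open>Re\<close> are independent, but \<open>g\<close> and \<open>e\<close> need not be orthogonal. With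
  \<open>n = 1 - e\<close> and \<open>u = gn\<close> independence says \<open>l(u) = l(g)\<close>. So \<open>g = uc\<close> for some \<open>c\<close>, and \<open>h = ncu\<close> is an
  idempotent with \<open>Rh = Ru \<cong> Rg\<close>.\<close>

lemma orthogonal_uniform_idempotent:
  assumes e: "e \<in> carrier R" "e \<otimes> e = e"
    and g: "g \<in> carrier R" "g \<otimes> g = g" and U: "uniform_left R (principal_left R g)"
    and disj: "principal_left R g \<inter> principal_left R e = {\<zero>}"
  obtains h where "uniform_idempotent R h" "e \<otimes> h = \<zero>" "h \<otimes> e = \<zero>"
proof -
  define n where "n = \<one> \<ominus> e"
  have n: "n \<in> carrier R" "n \<otimes> n = n" "n \<otimes> e = \<zero>" "e \<otimes> n = \<zero>"
    using e by (simp_all add: n_def minus_eq l_distr r_distr l_minus r_minus r_neg)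
  define u where "u = g \<otimes> n"
  have u: "u \<in> carrier R" "u \<otimes> n = u" "g \<otimes> u = u"
    using g n by (simp_all add: u_def m_assoc) (simp add: m_assoc[symmetric])
  have "x \<otimes> g = \<zero>" if x: "x \<in> carrier R" "x \<otimes> u = \<zero>" for x
  proof -
    have "x \<otimes> u = x \<otimes> g \<ominus> x \<otimes> g \<otimes> e"
      using x(1) g(1) e(1) by (simp add: u_def n_def minus_eq r_distr r_minus m_assoc)
    then have "x \<otimes> g = x \<otimes> g \<otimes> e" using eq_of_minus_zero x g(1) e(1) by simp
    moreover have "x \<otimes> g \<in> carrier R" using x(1) g(1) by simp
    ultimately have "x \<otimes> g \<in> principal_left R e" unfolding principal_left_def by blast
    moreover have "x \<otimes> g \<in> principal_left R g" unfolding principal_left_def using x(1) by blast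
    ultimately show ?thesis using disj by blast
  qed
  then obtain c where c: "c \<in> carrier R" "g = u \<otimes> c" using p_inj[OF u(1) g(1)] by blast
  have ucu: "u \<otimes> (c \<otimes> u) = u" using c u(1,3) by (simp add: m_assoc[symmetric])
  define h where "h = n \<otimes> (c \<otimes> u)"
  have h: "h \<in> carrier R" using n(1) c(1) u(1) by (simp add: h_def)
  have uh: "u \<otimes> h = u"
  proof -
    have "u \<otimes> h = (u \<otimes> n) \<otimes> (c \<otimes> u)" using n(1) c(1) u(1) by (simp add: h_def m_assoc)
    then show ?thesis using u(2) ucu by simp
  qed
  have "h \<otimes> h = n \<otimes> (c \<otimes> (u \<otimes> h))" using n(1) c(1) u(1) h by (simp add: h_def m_assoc)
  then have hh: "h \<otimes> h = h" using uh by (simp add: h_def)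
  have eh: "e \<otimes> h = \<zero>"
  proof -
    have "e \<otimes> h = (e \<otimes> n) \<otimes> (c \<otimes> u)" using e(1) n(1) c(1) u(1) by (simp add: h_def m_assoc)
    then show ?thesis using n(4) c(1) u(1) by simp
  qed
  have he: "h \<otimes> e = \<zero>"
  proof -
    have "h \<otimes> e = n \<otimes> (c \<otimes> (g \<otimes> (n \<otimes> e)))"
      using e(1) n(1) c(1) g(1) by (simp add: h_def u_def m_assoc)
    then show ?thesis using n(1,3) c(1) g(1) by simp
  qed
  note P = left_ideal_principal[OF h]
  have "principal_left R g \<noteq> {\<zero>}" by (rule uniform_leftD(2)[OF U])
  moreover have "principal_left R \<zero> = {\<zero>}" unfolding principal_left_def by force
  ultimately have "g \<noteq> \<zero>" by metis
  then have "h \<noteq> \<zero>" using uh u(1) c by auto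
  have "uniform_left R (principal_left R h)"
    unfolding uniform_left_def
  proof (intro conjI ballI impI P)
    show "principal_left R h \<noteq> {\<zero>}" using principal_left_self[OF h] \<open>h \<noteq> \<zero>\<close> by blast
    fix a b assume ab: "a \<in> principal_left R h" "b \<in> principal_left R h" "a \<noteq> \<zero>" "b \<noteq> \<zero>"
    have rep: "\<exists>p\<in>carrier R. a = p \<otimes> u" if "a \<in> principal_left R h" for a
    proof -
      obtain x where x: "x \<in> carrier R" "a = x \<otimes> h"
        using \<open>a \<in> principal_left R h\<close> unfolding principal_left_def by blast
      then have "a = (x \<otimes> n \<otimes> c) \<otimes> u" using n(1) c(1) u(1) by (simp add: h_def m_assoc)
      then show ?thesis using x(1) n(1) c(1) by (intro bexI[of _ "x \<otimes> n \<otimes> c"]) simp_all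
    qed
    obtain p where p: "p \<in> carrier R" "a = p \<otimes> u" using rep[OF ab(1)] by (elim bexE)
    obtain q where q: "q \<in> carrier R" "b = q \<otimes> u" using rep[OF ab(2)] by (elim bexE)
    note pq = p(1) q(1) p(2) q(2)
    have un: "y \<otimes> u = y \<otimes> g \<otimes> n" if "y \<in> carrier R" for y
      using that g(1) n(1) by (simp add: u_def m_assoc)
    have gu: "y \<otimes> g = y \<otimes> u \<otimes> c" if "y \<in> carrier R" for y
      using that u(1) c by (simp add: m_assoc)
    have "p \<otimes> g \<noteq> \<zero>" "q \<otimes> g \<noteq> \<zero>"
      using un[OF pq(1)] un[OF pq(2)] ab(3,4) l_null[OF n(1)] unfolding pq(3,4) by metis+
    moreover have "p \<otimes> g \<in> principal_left R g" "q \<otimes> g \<in> principal_left R g"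
      unfolding principal_left_def using pq(1,2) by blast+
    ultimately obtain r s where rs: "r \<in> carrier R" "s \<in> carrier R"
      "r \<otimes> (p \<otimes> g) = s \<otimes> (q \<otimes> g)" "r \<otimes> (p \<otimes> g) \<noteq> \<zero>"
      using uniform_leftD(3)[OF U] by blast
    have "r \<otimes> a = r \<otimes> (p \<otimes> g) \<otimes> n" "s \<otimes> b = s \<otimes> (q \<otimes> g) \<otimes> n"
      using rs(1,2) pq g(1) n(1) by (simp_all add: u_def m_assoc)
    then have "r \<otimes> a = s \<otimes> b" using rs(3) by simp
    moreover have "r \<otimes> a \<noteq> \<zero>"
    proof
      assume "r \<otimes> a = \<zero>"
      then have "r \<otimes> a \<otimes> c = \<zero>" using c(1) by simp
      then have "r \<otimes> (p \<otimes> g) = \<zero>" using rs(1) pq u(1) c(1) gu[OF pq(1)] by (simp add: m_assoc)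
      then show False using rs(4) by blast
    qed
    ultimately show "\<exists>r\<in>carrier R. \<exists>s\<in>carrier R. r \<otimes> a = s \<otimes> b \<and> r \<otimes> a \<noteq> \<zero>"
      using rs(1,2) by blast
  qed
  then have "uniform_idempotent R h" using h hh by (simp add: uniform_idempotent_def)
  then show ?thesis using that eh he by blast
qed

text \<open>Take an idempotent \<open>e\<close>, a sum of uniform idempotents, with \<open>Re\<close> or \<open>eR\<close> maximal. If \<open>e \<noteq> 1\<close>, then
  \<open>R(1 - e)\<close> contains a uniform left ideal, and a further orthogonal uniform idempotent enlarges both
  \<open>Re\<close> and \<open>eR\<close>.\<close>

lemma uniform_decomposition:
  assumes noeth: "left_noetherian R \<or> left_noetherian (opp_ring R)"
    and uniform: "\<And>K. left_ideal K R \<Longrightarrow> K \<noteq> {\<zero>} \<Longrightarrow> \<exists>U. uniform_left R U \<and> U \<subseteq> K"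
    and summand: "\<And>C. uniform_left R C \<Longrightarrow> complement_left_ideal R C \<Longrightarrow>
      \<exists>g\<in>carrier R. g \<otimes> g = g \<and> C = principal_left R g"
  obtains F where "finite F" "\<And>f. f \<in> F \<Longrightarrow> uniform_idempotent R f"
    "additively_generates R F \<one>"
proof -
  define G where "G e \<longleftrightarrow> e \<in> carrier R \<and> e \<otimes> e = e \<and>
    (\<exists>F. finite F \<and> (\<forall>f\<in>F. uniform_idempotent R f) \<and> additively_generates R F e)" for e
  have G0: "G \<zero>" unfolding G_def additively_generates_def by (auto intro!: exI[of _ "{}"])
  have step: "\<exists>h. G (e \<oplus> h) \<and> h \<in> carrier R \<and> h \<noteq> \<zero> \<and> e \<otimes> h = \<zero> \<and> h \<otimes> e = \<zero>"
    if Ge: "G e" and ne: "e \<noteq> \<one>" for e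
  proof -
    obtain F where e: "e \<in> carrier R" "e \<otimes> e = e" and F: "finite F"
      "\<forall>f\<in>F. uniform_idempotent R f" "additively_generates R F e" using Ge unfolding G_def by blast
    define n where "n = \<one> \<ominus> e"
    have n: "n \<in> carrier R" "n \<otimes> e = \<zero>"
      using e by (simp_all add: n_def minus_eq l_distr l_minus r_neg)
    note Pn = left_ideal_principal[OF n(1)] and Pe = left_ideal_principal[OF e(1)]
    have "n \<noteq> \<zero>" using eq_of_minus_zero[of \<one> e] e(1) ne by (auto simp: n_def)
    then have "principal_left R n \<noteq> {\<zero>}" using principal_left_self[OF n(1)] by blast
    then obtain U where U: "uniform_left R U" "U \<subseteq> principal_left R n" using uniform[OF Pn] by blast
    have "w = \<zero>" if w: "w \<in> principal_left R n" "w \<in> principal_left R e" for w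
    proof -
      obtain x y where xy: "x \<in> carrier R" "w = x \<otimes> n" "y \<in> carrier R" "w = y \<otimes> e"
        using w unfolding principal_left_def by blast
      have "w \<otimes> e = w" unfolding xy(4) using xy(3) e by (simp add: m_assoc)
      moreover have "w \<otimes> e = \<zero>" unfolding xy(2) using xy(1) n e(1) by (simp add: m_assoc)
      ultimately show ?thesis by simp
    qed
    then have "U \<inter> principal_left R e = {\<zero>}"
      using U(2) left_idealD(2)[OF uniform_leftD(1)[OF U(1)]] left_idealD(2)[OF Pe] by blast
    then obtain C where C: "uniform_left R C" "complement_left_ideal R C" "C \<inter> principal_left R e = {\<zero>}"
      using uniform_complement_exists[OF U(1) Pe] by metis
    obtain g where g: "g \<in> carrier R" "g \<otimes> g = g" "C = principal_left R g"
      using summand[OF C(1,2)] by blast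
    obtain h where h: "uniform_idempotent R h" "e \<otimes> h = \<zero>" "h \<otimes> e = \<zero>"
      using orthogonal_uniform_idempotent[OF e g(1,2)] C(1,3) unfolding g(3) by blast
    note hD = uniform_idempotentD[OF h(1)]
    have "(e \<oplus> h) \<otimes> (e \<oplus> h) = e \<oplus> h"
      using e hD(1,2) h(2,3) by (simp add: l_distr r_distr)
    moreover have "additively_generates R (insert h F) (e \<oplus> h)"
      using F(3) unfolding additively_generates_def by auto
    ultimately have "G (e \<oplus> h)"
      unfolding G_def using e(1) hD(1) F(1,2) h(1)
      by (intro conjI exI[of _ "insert h F"]) auto
    then show ?thesis using h hD(1,3) by blast
  qed
  have "G \<one>"
  proof (rule ccontr)
    assume n1: "\<not> G \<one>"
    show False using noeth
    proof
      assume N: "left_noetherian R"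
      define A where "A = {principal_left R e | e. G e}"
      have "principal_left R \<zero> \<in> A" unfolding A_def using G0 by blast
      moreover have "left_ideal I R" if "I \<in> A" for I
        using that left_ideal_principal unfolding A_def G_def by auto
      ultimately obtain M where M: "M \<in> A" "\<And>I. I \<in> A \<Longrightarrow> M \<subseteq> I \<Longrightarrow> I = M"
        using left_noetherian_maximal[OF N] by metis
      then obtain e where e: "G e" "M = principal_left R e" unfolding A_def by blast
      have ec: "e \<in> carrier R" "e \<otimes> e = e" using e(1) by (auto simp: G_def)
      obtain h where h: "G (e \<oplus> h)" "h \<in> carrier R" "h \<noteq> \<zero>" "e \<otimes> h = \<zero>" "h \<otimes> e = \<zero>"
        using step[OF e(1)] n1 e(1) by metis
      have ee: "e \<otimes> (e \<oplus> h) = e" "(e \<oplus> h) \<otimes> e = e" using ec h(2,4,5) by (simp_all add: l_distr r_distr)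
      have "principal_left R e \<subseteq> principal_left R (e \<oplus> h)"
        by (rule principal_left_subset[OF left_ideal_principal])
          (use ec(1) h(2) ee(1)[symmetric] in \<open>auto simp: principal_left_def\<close>)
      then have "principal_left R (e \<oplus> h) = principal_left R e"
        using M(2)[of "principal_left R (e \<oplus> h)"] h(1) unfolding e(2) A_def by blast
      then have "e \<oplus> h \<in> principal_left R e" using principal_left_self[of "e \<oplus> h"] ec(1) h(2) by auto
      then obtain x where "x \<in> carrier R" "e \<oplus> h = x \<otimes> e" unfolding principal_left_def by blast
      then have "(e \<oplus> h) \<otimes> e = e \<oplus> h" using ec by (simp add: m_assoc)
      then show False using ee(2) ec(1) h(2,3) by simp
    next
      assume N: "left_noetherian (opp_ring R)"
      interpret opp: ring "opp_ring R" by (rule ring_opp_ring[OF ring_axioms])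
      define A where "A = {principal_left (opp_ring R) e | e. G e}"
      have "principal_left (opp_ring R) \<zero> \<in> A" unfolding A_def using G0 by blast
      moreover have "left_ideal I (opp_ring R)" if "I \<in> A" for I
        using that opp.left_ideal_principal unfolding A_def G_def by auto
      ultimately obtain M where M: "M \<in> A" "\<And>I. I \<in> A \<Longrightarrow> M \<subseteq> I \<Longrightarrow> I = M"
        using left_noetherian_maximal[OF N] by metis
      then obtain e where e: "G e" "M = principal_left (opp_ring R) e" unfolding A_def by blast
      have ec: "e \<in> carrier R" "e \<otimes> e = e" using e(1) by (auto simp: G_def)
      obtain h where h: "G (e \<oplus> h)" "h \<in> carrier R" "h \<noteq> \<zero>" "e \<otimes> h = \<zero>" "h \<otimes> e = \<zero>"
        using step[OF e(1)] n1 e(1) by metis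
      have ee: "e \<otimes> (e \<oplus> h) = e" "(e \<oplus> h) \<otimes> e = e" using ec h(2,4,5) by (simp_all add: l_distr r_distr)
      have "principal_left (opp_ring R) e \<subseteq> principal_left (opp_ring R) (e \<oplus> h)"
        by (rule opp.principal_left_subset[OF opp.left_ideal_principal])
          (use ec(1) h(2) ee(2)[symmetric] in \<open>auto simp: principal_left_def\<close>)
      then have "principal_left (opp_ring R) (e \<oplus> h) = principal_left (opp_ring R) e"
        using M(2)[of "principal_left (opp_ring R) (e \<oplus> h)"] h(1) unfolding e(2) A_def by blast
      then have "e \<oplus> h \<in> principal_left (opp_ring R) e"
        using opp.principal_left_self[of "e \<oplus> h"] ec(1) h(2) by auto
      then obtain x where "x \<in> carrier R" "e \<oplus> h = e \<otimes> x" unfolding principal_left_def by auto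
      then have "e \<otimes> (e \<oplus> h) = e \<oplus> h" using ec by (simp add: m_assoc[symmetric])
      then show False using ee(1) ec(1) h(2,3) by simp
    qed
  qed
  then show ?thesis using that unfolding G_def by blast
qed

end

section \<open>Coincidence of the two socles\<close>

locale peirce = left_p_injective +
  fixes F
  assumes F_finite: "finite F"
    and F_uniform: "f \<in> F \<Longrightarrow> uniform_idempotent R f"
    and F_generates: "additively_generates R F \<one>"
    and left_loewy: "left_ideal K R \<Longrightarrow> x \<in> carrier R \<Longrightarrow> x \<notin> K \<Longrightarrow>
      \<exists>r\<in>carrier R. r \<otimes> x \<notin> K \<and> (\<forall>z\<in>left_singular R. z \<otimes> (r \<otimes> x) \<in> K)"
begin

abbreviation (input) "Z \<equiv> left_singular R"

definition lsoc :: "'a set" where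
  "lsoc = rann R Z"

lemma lsoc_iff: "k \<in> lsoc \<longleftrightarrow> k \<in> carrier R \<and> (\<forall>z\<in>Z. z \<otimes> k = \<zero>)"
  by (simp add: lsoc_def rann_def)

lemma F_carrier: "f \<in> F \<Longrightarrow> f \<in> carrier R"
  and F_idem: "f \<in> F \<Longrightarrow> f \<otimes> f = f"
  using F_uniform uniform_idempotentD by blast+

lemma F_absorb: "f \<in> F \<Longrightarrow> x \<in> carrier R \<Longrightarrow> f \<otimes> (f \<otimes> x) = f \<otimes> x"
  using F_carrier[of f] F_idem[of f] by (simp add: m_assoc[symmetric])

lemma generated_by_F:
  assumes "\<And>f. f \<in> F \<Longrightarrow> P f" "P \<zero>"
    "\<And>a b. a \<in> carrier R \<Longrightarrow> b \<in> carrier R \<Longrightarrow> P a \<Longrightarrow> P b \<Longrightarrow> P (a \<oplus> b)"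
  shows "P \<one>"
proof -
  have "{a \<in> carrier R. P a} \<subseteq> carrier R" "\<zero> \<in> {a \<in> carrier R. P a}"
    "\<forall>a\<in>{a \<in> carrier R. P a}. \<forall>b\<in>{a \<in> carrier R. P a}. a \<oplus> b \<in> {a \<in> carrier R. P a}"
    "F \<subseteq> {a \<in> carrier R. P a}"
    using assms F_carrier by auto
  then have "\<one> \<in> {a \<in> carrier R. P a}"
    using F_generates unfolding additively_generates_def by blast
  then show ?thesis by simp
qed

lemma lsoc_zero: "\<zero> \<in> lsoc"
  by (simp add: lsoc_iff left_singularD(1))

lemma lsoc_add: "a \<in> lsoc \<Longrightarrow> b \<in> lsoc \<Longrightarrow> a \<oplus> b \<in> lsoc"
  by (simp add: lsoc_iff left_singularD(1) r_distr)

lemma lsoc_mult_left: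
  assumes "k \<in> lsoc" "r \<in> carrier R" shows "r \<otimes> k \<in> lsoc"
proof -
  have "z \<otimes> (r \<otimes> k) = \<zero>" if z: "z \<in> Z" for z
  proof -
    have "(z \<otimes> r) \<otimes> k = \<zero>" using left_singular_mult_right[OF z assms(2)] assms(1) by (simp add: lsoc_iff)
    then show ?thesis using assms left_singularD(1)[OF z] by (simp add: lsoc_iff m_assoc)
  qed
  then show ?thesis using assms by (simp add: lsoc_iff)
qed

lemma lsoc_mult_right:
  assumes "k \<in> lsoc" "r \<in> carrier R" shows "k \<otimes> r \<in> lsoc"
  using assms by (simp add: lsoc_iff left_singularD(1) m_assoc[symmetric])

lemma exists_component:
  assumes "x \<in> carrier R" "x \<noteq> \<zero>" shows "\<exists>f\<in>F. f \<otimes> x \<noteq> \<zero>"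
proof (rule ccontr)
  assume "\<not> ?thesis"
  then have "\<one> \<otimes> x = \<zero>"
    by (intro generated_by_F[of "\<lambda>a. a \<otimes> x = \<zero>"]) (use assms in \<open>auto simp: l_distr\<close>)
  then show False using assms by simp
qed

text \<open>For \<open>k = gk\<close> in the left socle, \<open>Rk\<close> is an image of \<open>Rg/Zg\<close> and therefore simple.\<close>

lemma nonzero_on_lsoc_local:
  assumes g: "g \<in> F" and k: "k \<in> lsoc" "g \<otimes> k = k" and r: "r \<in> carrier R" "r \<otimes> k \<noteq> \<zero>"
  shows "\<exists>b\<in>carrier R. b \<otimes> (r \<otimes> k) = k"
proof -
  have kc: "k \<in> carrier R" using k(1) by (simp add: lsoc_iff)
  have rk: "r \<otimes> k = (r \<otimes> g) \<otimes> k" using k(2) kc r(1) F_carrier[OF g] by (simp add: m_assoc)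
  then have "r \<otimes> g \<notin> Z" using k(1) r(2) by (auto simp: lsoc_iff)
  then obtain b where b: "b \<in> carrier R" "b \<otimes> (r \<otimes> g) = g"
    using uniform_idempotent_left_local[OF F_uniform[OF g] r(1)] by blast
  have "b \<otimes> (r \<otimes> k) = (b \<otimes> (r \<otimes> g)) \<otimes> k"
    unfolding rk using b(1) r(1) kc F_carrier[OF g] by (simp add: m_assoc)
  then show ?thesis using b k(2) by auto
qed

text \<open>If \<open>vz \<noteq> 0\<close> with \<open>Rv\<close> simple, then \<open>Rv\<close> misses \<open>l(z)\<close>, although \<open>l(z)\<close> is essential.\<close>

lemma lsoc_mult_singular:
  assumes k: "k \<in> lsoc" and z: "z \<in> Z" shows "k \<otimes> z = \<zero>"
proof (rule ccontr)
  assume ne: "k \<otimes> z \<noteq> \<zero>"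
  have c: "k \<in> carrier R" "z \<in> carrier R" using k left_singularD(1)[OF z] by (auto simp: lsoc_iff)
  obtain g where g: "g \<in> F" "g \<otimes> (k \<otimes> z) \<noteq> \<zero>" using exists_component[OF _ ne] c by auto
  have gc: "g \<in> carrier R" by (rule F_carrier[OF g(1)])
  define v where "v = g \<otimes> k"
  have v: "v \<in> carrier R" "v \<in> lsoc" "g \<otimes> v = v" "v \<otimes> z \<noteq> \<zero>"
    using lsoc_mult_left[OF k gc] F_absorb[OF g(1) c(1)] g(2) gc c by (auto simp: v_def m_assoc)
  have "v \<noteq> \<zero>" using v(4) c(2) by auto
  then obtain r where r: "r \<in> carrier R" "r \<otimes> v \<noteq> \<zero>" "r \<otimes> v \<otimes> z = \<zero>"
    using left_singularD(2)[OF z v(1)] by blast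
  obtain b where b: "b \<in> carrier R" "b \<otimes> (r \<otimes> v) = v"
    using nonzero_on_lsoc_local[OF g(1) v(2,3) r(1,2)] by blast
  have "v \<otimes> z = b \<otimes> (r \<otimes> v) \<otimes> z" using b(2) by simp
  also have "\<dots> = b \<otimes> (r \<otimes> v \<otimes> z)" using b(1) r(1) v(1) c(2) by (simp add: m_assoc)
  finally show False using r(3) v(4) b(1) by simp
qed

lemma annihilator_of_component:
  assumes g: "g \<in> F" and k: "k \<in> carrier R" "g \<otimes> k = k" "k \<noteq> \<zero>"
    and x: "x \<in> carrier R" "x \<otimes> k = \<zero>"
  shows "x \<otimes> g \<in> Z"
proof (rule ccontr)
  assume "x \<otimes> g \<notin> Z"
  then obtain b where b: "b \<in> carrier R" "b \<otimes> (x \<otimes> g) = g"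
    using uniform_idempotent_left_local[OF F_uniform[OF g] x(1)] by blast
  have "k = b \<otimes> (x \<otimes> g) \<otimes> k" using b(2) k(2) by simp
  also have "\<dots> = b \<otimes> (x \<otimes> (g \<otimes> k))"
    using b(1) x(1) F_carrier[OF g] k(1) by (simp add: m_assoc)
  also have "\<dots> = \<zero>" using k(2) x(2) b(1) by simp
  finally show False using k(3) by blast
qed

text \<open>All nonzero \<open>k = gk\<close> in the left socle have the same left annihilator \<open>{x. xg \<in> Z}\<close>.\<close>

lemma component_of_lsoc_right_simple:
  assumes g: "g \<in> F" and k: "k \<in> lsoc" "g \<otimes> k = k" "k \<noteq> \<zero>"
    and k': "k' \<in> lsoc" "g \<otimes> k' = k'"
  shows "\<exists>a\<in>carrier R. k' = k \<otimes> a"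
proof (rule p_inj)
  show c: "k \<in> carrier R" "k' \<in> carrier R" using k(1) k'(1) by (auto simp: lsoc_iff)
  fix x assume x: "x \<in> carrier R" "x \<otimes> k = \<zero>"
  have gc: "g \<in> carrier R" by (rule F_carrier[OF g])
  have "x \<otimes> g \<in> Z" by (rule annihilator_of_component[OF g c(1) k(2,3) x])
  then have "(x \<otimes> g) \<otimes> k' = \<zero>" using k'(1) by (simp add: lsoc_iff)
  then show "x \<otimes> k' = \<zero>" using x(1) gc c(2) k'(2) by (simp add: m_assoc)
qed

text \<open>The simple socle of \<open>Rf\<close> is isomorphic to the top \<open>Rg/Zg\<close>.\<close>

definition linked :: "'a \<Rightarrow> 'a \<Rightarrow> bool" where
  "linked f g \<longleftrightarrow> (\<exists>k\<in>lsoc. k \<noteq> \<zero> \<and> g \<otimes> k = k \<and> k \<otimes> f = k)"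

text \<open>\<open>Rf \<cong> Rg\<close>: an element of \<open>fRg\<close> outside \<open>Z\<close> gives mutually inverse right multiplications, because
  \<open>f\<close> and \<open>g\<close> are local.\<close>

definition isomorphic :: "'a \<Rightarrow> 'a \<Rightarrow> bool" where
  "isomorphic f g \<longleftrightarrow> (\<exists>a\<in>carrier R. f \<otimes> a \<otimes> g \<notin> Z)"

lemma linked_exists:
  assumes f: "f \<in> F" shows "\<exists>g\<in>F. linked f g"
proof -
  have fc: "f \<in> carrier R" by (rule F_carrier[OF f])
  have "f \<notin> {\<zero>}" using uniform_idempotentD(3)[OF F_uniform[OF f]] by simp
  then obtain r where r: "r \<in> carrier R" "r \<otimes> f \<notin> {\<zero>}" "\<forall>z\<in>Z. z \<otimes> (r \<otimes> f) \<in> {\<zero>}"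
    using left_loewy[OF left_ideal_zero fc] by blast
  have k: "r \<otimes> f \<in> lsoc" "r \<otimes> f \<noteq> \<zero>" using r fc by (auto simp: lsoc_iff)
  obtain g where g: "g \<in> F" "g \<otimes> (r \<otimes> f) \<noteq> \<zero>" using exists_component[OF _ k(2)] r(1) fc by auto
  have gc: "g \<in> carrier R" by (rule F_carrier[OF g(1)])
  have "g \<otimes> (r \<otimes> f) \<in> lsoc" by (rule lsoc_mult_left[OF k(1) gc])
  moreover have "g \<otimes> (g \<otimes> (r \<otimes> f)) = g \<otimes> (r \<otimes> f)" by (rule F_absorb[OF g(1)]) (use r(1) fc in simp)
  moreover have "g \<otimes> (r \<otimes> f) \<otimes> f = g \<otimes> (r \<otimes> f)" using gc r(1) fc F_idem[OF f] by (simp add: m_assoc)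
  ultimately show ?thesis unfolding linked_def using g by blast
qed

lemma linked_injective:
  assumes fg: "linked f g" "linked f' g" and F: "f \<in> F" "f' \<in> F" "g \<in> F"
  shows "isomorphic f f'"
proof -
  obtain k where k: "k \<in> lsoc" "k \<noteq> \<zero>" "g \<otimes> k = k" "k \<otimes> f = k" using fg(1) unfolding linked_def by blast
  obtain k' where k': "k' \<in> lsoc" "k' \<noteq> \<zero>" "g \<otimes> k' = k'" "k' \<otimes> f' = k'"
    using fg(2) unfolding linked_def by blast
  obtain a where a: "a \<in> carrier R" "k' = k \<otimes> a"
    using component_of_lsoc_right_simple[OF F(3) k(1,3,2) k'(1,3)] by blast
  have kc: "k \<in> carrier R" using k(1) by (simp add: lsoc_iff)
  have "k' = (k \<otimes> f) \<otimes> a \<otimes> f'" using k'(4) a(2) k(4) by simp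
  also have "\<dots> = k \<otimes> (f \<otimes> a \<otimes> f')" using kc a(1) F_carrier F by (simp add: m_assoc)
  finally have "f \<otimes> a \<otimes> f' \<notin> Z" using lsoc_mult_singular[OF k(1)] k'(2) by auto
  then show ?thesis unfolding isomorphic_def using a(1) by blast
qed

lemma linked_isomorphic:
  assumes iso: "isomorphic g g'" and l: "linked f' g'" and F: "f' \<in> F" "g \<in> F" "g' \<in> F"
  shows "linked f' g"
proof -
  obtain a where a: "a \<in> carrier R" "g \<otimes> a \<otimes> g' \<notin> Z" using iso unfolding isomorphic_def by blast
  obtain k where k: "k \<in> lsoc" "k \<noteq> \<zero>" "g' \<otimes> k = k" "k \<otimes> f' = k" using l unfolding linked_def by blast
  have c: "k \<in> carrier R" "g \<in> carrier R" "g' \<in> carrier R" "f' \<in> carrier R"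
    using k(1) F_carrier F by (auto simp: lsoc_iff)
  obtain b where b: "b \<in> carrier R" "b \<otimes> (g \<otimes> a \<otimes> g') = g'"
    using uniform_idempotent_left_local[OF F_uniform[OF F(3)] _ a(2)] a(1) c(2) by auto
  define m where "m = g \<otimes> a \<otimes> k"
  have "b \<otimes> m = b \<otimes> (g \<otimes> a \<otimes> (g' \<otimes> k))" using k(3) by (simp add: m_def)
  also have "\<dots> = b \<otimes> (g \<otimes> a \<otimes> g') \<otimes> k" using b(1) a(1) c by (simp add: m_assoc)
  also have "\<dots> = k" using b(2) k(3) by simp
  finally have "m \<noteq> \<zero>" using k(2) b(1) by auto
  moreover have "m \<in> lsoc" unfolding m_def by (rule lsoc_mult_left[OF k(1)]) (use a(1) c in simp)
  moreover have "g \<otimes> m = m" using F_absorb[OF F(2), of "a \<otimes> k"] a(1) c by (simp add: m_def m_assoc)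
  moreover have "m \<otimes> f' = m" using k(4) a(1) c by (simp add: m_def m_assoc)
  ultimately show ?thesis unfolding linked_def by blast
qed

text \<open>The relation \<open>linked\<close> induces an injective map on the finite set of isomorphism classes; hence it
  is surjective. Without forming classes: iterate a choice function \<open>\<sigma>\<close> from \<open>f\<close> until an index
  repeats, and use injectivity to shift the repetition back to \<open>f\<close>.\<close>

lemma linked_surjective:
  assumes f: "f \<in> F" shows "\<exists>f'\<in>F. linked f' f"
proof -
  obtain \<sigma> where \<sigma>: "\<And>x. x \<in> F \<Longrightarrow> \<sigma> x \<in> F" "\<And>x. x \<in> F \<Longrightarrow> linked x (\<sigma> x)"
    using linked_exists by metis
  define s where "s n = (\<sigma> ^^ n) f" for n
  have s: "s n \<in> F" for n by (induction n) (auto simp: s_def f \<sigma>)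
  have sl: "linked (s n) (s (Suc n))" for n using \<sigma>(2)[OF s[of n]] by (simp add: s_def)
  have "\<not> inj s"
  proof
    assume "inj s"
    moreover have "finite (range s)" using finite_subset[OF _ F_finite, of "range s"] s by blast
    ultimately show False using finite_imageD by blast
  qed
  then obtain p q where pq: "p < q" "s p = s q" unfolding inj_def by (metis linorder_neqE_nat)
  define d where "d = q - p"
  have d: "d > 0" "s p = s (p + d)" using pq by (auto simp: d_def)
  have refl: "isomorphic x x" if "x \<in> F" for x
    unfolding isomorphic_def using F_carrier[OF that] F_idem[OF that]
      uniform_idempotentD(4)[OF F_uniform[OF that]] by (intro bexI[of _ \<one>]) auto
  have "isomorphic (s n) (s (n + d)) \<Longrightarrow> isomorphic (s 0) (s d)" for n
  proof (induction n)
    case (Suc n)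
    have "linked (s (n + d)) (s (Suc n))"
      using linked_isomorphic[OF Suc.prems _ s s s] sl[of "n + d"] by simp
    then show ?case using Suc.IH linked_injective[OF sl _ s s s] by blast
  qed simp
  then have iso: "isomorphic (s 0) (s d)" using refl[OF s] d(2) by metis
  obtain d' where d': "d = Suc d'" using d(1) by (cases d) auto
  have "linked (s d') (s 0)" using linked_isomorphic[OF iso _ s s s] sl[of d'] d' by simp
  then show ?thesis using s[of d'] by (auto simp: s_def)
qed

text \<open>Let \<open>k\<^sub>1 = gkf \<noteq> 0\<close>. The nonzero component \<open>g r(Z)\<close> contains some \<open>s \<noteq> 0\<close>, and \<open>l(k\<^sub>1) \<subseteq> l(s)\<close>, so
  \<open>s \<in> k\<^sub>1R\<close>. As \<open>kZ = 0\<close>, the right ideal \<open>k\<^sub>1R\<close> is simple, and \<open>k\<^sub>1 \<in> sR \<subseteq> r(Z)\<close>.\<close>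

lemma lann_singular_subset_lsoc:
  assumes k: "k \<in> carrier R" "\<And>z. z \<in> Z \<Longrightarrow> k \<otimes> z = \<zero>"
  shows "k \<in> lsoc"
proof -
  have corner: "g \<otimes> k \<otimes> f \<in> lsoc" if f: "f \<in> F" and g: "g \<in> F" for f g
  proof (cases "g \<otimes> k \<otimes> f = \<zero>")
    case True then show ?thesis using lsoc_zero by simp
  next
    case False
    have c: "f \<in> carrier R" "g \<in> carrier R" using f g F_carrier by auto
    define k1 where "k1 = g \<otimes> k \<otimes> f"
    have k1: "k1 \<in> carrier R" "g \<otimes> k1 = k1" "k1 \<noteq> \<zero>"
      using F_absorb[OF g, of "k \<otimes> f"] False c k(1) by (auto simp: k1_def m_assoc)
    obtain s where s: "s \<in> lsoc" "s \<noteq> \<zero>" "g \<otimes> s = s"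
      using linked_surjective[OF g] unfolding linked_def by blast
    have sc: "s \<in> carrier R" using s(1) by (simp add: lsoc_iff)
    have "\<exists>a\<in>carrier R. s = k1 \<otimes> a"
    proof (rule p_inj[OF k1(1) sc])
      fix x assume x: "x \<in> carrier R" "x \<otimes> k1 = \<zero>"
      have "x \<otimes> g \<in> Z" by (rule annihilator_of_component[OF g k1 x])
      then have "(x \<otimes> g) \<otimes> s = \<zero>" using s(1) by (simp add: lsoc_iff)
      then show "x \<otimes> s = \<zero>" using x(1) c sc s(3) by (simp add: m_assoc)
    qed
    then obtain a where a: "a \<in> carrier R" "s = k1 \<otimes> a" by blast
    have sfa: "s = g \<otimes> (k \<otimes> (f \<otimes> a))" using a c k(1) by (simp add: k1_def m_assoc)
    have "f \<otimes> a \<notin> Z" using k(2)[of "f \<otimes> a"] sfa s(2) c by auto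
    then obtain b where b: "b \<in> carrier R" "f \<otimes> a \<otimes> b = f"
      using uniform_idempotent_right_local[OF F_uniform[OF f] a(1)] by blast
    have "s \<otimes> b = g \<otimes> (k \<otimes> (f \<otimes> a \<otimes> b))" unfolding sfa using a(1) b(1) c k(1) by (simp add: m_assoc)
    also have "\<dots> = k1" unfolding b(2) k1_def using c k(1) by (simp add: m_assoc)
    finally have "k1 \<in> lsoc" using lsoc_mult_right[OF s(1) b(1)] by simp
    then show ?thesis by (simp add: k1_def)
  qed
  have "\<one> \<otimes> k \<otimes> f \<in> lsoc" if f: "f \<in> F" for f
    by (rule generated_by_F[of "\<lambda>a. a \<otimes> k \<otimes> f \<in> lsoc"])
      (use corner[OF f] lsoc_zero lsoc_add k(1) F_carrier[OF f] in \<open>auto simp: l_distr\<close>)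
  then have "k \<otimes> f \<in> lsoc" if f: "f \<in> F" for f using that k(1) by simp
  then have "k \<otimes> \<one> \<in> lsoc"
    by (intro generated_by_F[of "\<lambda>a. k \<otimes> a \<in> lsoc"])
      (use lsoc_zero lsoc_add k(1) in \<open>auto simp: r_distr\<close>)
  then show ?thesis using k(1) by simp
qed

text \<open>It suffices to reach the components \<open>gx\<close>. Each \<open>R(gx)\<close> is simple and meets \<open>Rk\<close>, since both lie
  in the uniform left ideal \<open>Rf\<close>.\<close>

lemma component_of_socle_left_simple:
  assumes f: "f \<in> F" and k: "k \<in> carrier R" "k \<otimes> f = k" "k \<noteq> \<zero>"
    and x: "x \<in> lsoc" "x \<otimes> f = x"
  shows "\<exists>r\<in>carrier R. x = r \<otimes> k"
proof -
  have xc: "x \<in> carrier R" using x(1) by (simp add: lsoc_iff)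
  have "\<exists>r\<in>carrier R. \<one> \<otimes> x = r \<otimes> k"
  proof (rule generated_by_F[of "\<lambda>a. \<exists>r\<in>carrier R. a \<otimes> x = r \<otimes> k"])
    show "\<exists>r\<in>carrier R. \<zero> \<otimes> x = r \<otimes> k" using xc k(1) by (intro bexI[of _ \<zero>]) auto
    show "\<exists>r\<in>carrier R. (a \<oplus> b) \<otimes> x = r \<otimes> k"
      if ab: "a \<in> carrier R" "b \<in> carrier R" "\<exists>r\<in>carrier R. a \<otimes> x = r \<otimes> k"
        "\<exists>r\<in>carrier R. b \<otimes> x = r \<otimes> k" for a b
    proof -
      obtain r s where "r \<in> carrier R" "a \<otimes> x = r \<otimes> k" "s \<in> carrier R" "b \<otimes> x = s \<otimes> k"
        using ab(3,4) by blast
      then show ?thesis using ab(1,2) xc k(1) by (intro bexI[of _ "r \<oplus> s"]) (auto simp: l_distr)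
    qed
    fix g assume g: "g \<in> F"
    have gc: "g \<in> carrier R" by (rule F_carrier[OF g])
    show "\<exists>r\<in>carrier R. g \<otimes> x = r \<otimes> k"
    proof (cases "g \<otimes> x = \<zero>")
      case True then show ?thesis using k(1) by (intro bexI[of _ \<zero>]) auto
    next
      case False
      have gxf: "g \<otimes> x \<otimes> f = g \<otimes> x" using x(2) gc xc F_carrier[OF f] by (simp add: m_assoc)
      obtain r s where rs: "r \<in> carrier R" "s \<in> carrier R" "r \<otimes> (g \<otimes> x) = s \<otimes> k"
        "r \<otimes> (g \<otimes> x) \<noteq> \<zero>"
        using uniform_idempotentD(5)[OF F_uniform[OF f] m_closed[OF gc xc] k(1) gxf k(2) False k(3)]
        by blast
      obtain b where b: "b \<in> carrier R" "b \<otimes> (r \<otimes> (g \<otimes> x)) = g \<otimes> x"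
        using nonzero_on_lsoc_local[OF g lsoc_mult_left[OF x(1) gc] F_absorb[OF g xc] rs(1,4)] by blast
      have "g \<otimes> x = (b \<otimes> s) \<otimes> k" using b rs(2,3) k(1) by (simp add: m_assoc)
      then show ?thesis using b(1) rs(2) by blast
    qed
  qed
  then show ?thesis using xc by simp
qed

lemma dual_socle_of_peirce:
  assumes right_loewy: "\<And>K x. left_ideal K (opp_ring R) \<Longrightarrow> x \<in> carrier R \<Longrightarrow> x \<notin> K \<Longrightarrow>
      \<exists>r\<in>carrier R. x \<otimes> r \<notin> K \<and> (\<forall>z\<in>left_singular R. x \<otimes> r \<otimes> z \<in> K)"
  shows "dual_socle R (left_singular R) F"
proof unfold_locales
  show "left_singular R \<subseteq> carrier R" by (rule left_singular_carrier)
  show "F \<subseteq> carrier R" using F_carrier by blast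
  show "z \<otimes> r \<in> Z" "r \<otimes> z \<in> Z" if "z \<in> Z" "r \<in> carrier R" for z r
    using that left_singular_mult_left left_singular_mult_right by blast+
  show "f \<otimes> f = f" if "f \<in> F" for f by (rule F_idem[OF that])
  show "\<one> \<in> K" if "K \<subseteq> carrier R" "\<zero> \<in> K" "\<And>a b. a \<in> K \<Longrightarrow> b \<in> K \<Longrightarrow> a \<oplus> b \<in> K" "F \<subseteq> K" for K
    by (rule generated_by_F[of "\<lambda>a. a \<in> K"]) (use that in auto)
  show "\<exists>r\<in>carrier R. r \<otimes> x \<notin> K \<and> (\<forall>z\<in>Z. z \<otimes> (r \<otimes> x) \<in> K)"
    if "left_ideal K R" "x \<in> carrier R" "x \<notin> K" for K x by (rule left_loewy[OF that])
  show "\<exists>r\<in>carrier R. x \<otimes> r \<notin> K \<and> (\<forall>z\<in>Z. x \<otimes> r \<otimes> z \<in> K)"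
    if "left_ideal K (opp_ring R)" "x \<in> carrier R" "x \<notin> K" for K x by (rule right_loewy[OF that])
  show "\<exists>r\<in>carrier R. k' = k \<otimes> r"
    if "f \<in> F" "k \<in> carrier R" "k' \<in> carrier R" "f \<otimes> k = k" "f \<otimes> k' = k'"
      "\<And>z. z \<in> Z \<Longrightarrow> z \<otimes> k = \<zero>" "\<And>z. z \<in> Z \<Longrightarrow> z \<otimes> k' = \<zero>" "k \<noteq> \<zero>" for f k k'
    using component_of_lsoc_right_simple[of f k k'] that by (simp add: lsoc_iff)
  show "\<exists>r\<in>carrier R. k' = r \<otimes> k"
    if "f \<in> F" "k \<in> carrier R" "k' \<in> carrier R" "k \<otimes> f = k" "k' \<otimes> f = k'"
      "\<And>z. z \<in> Z \<Longrightarrow> k \<otimes> z = \<zero>" "\<And>z. z \<in> Z \<Longrightarrow> k' \<otimes> z = \<zero>" "k \<noteq> \<zero>" for f k k'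
    using component_of_socle_left_simple[of f k k'] lann_singular_subset_lsoc[of k'] that by blast
qed

end

section \<open>Quasi-Frobenius rings\<close>

lemma dual_socle_exists:
  assumes R: "ring R" and two: "left_n_injective R 2"
    and cases: "left_noetherian (opp_ring R) \<and>
        (\<forall>C. complement_left_ideal R C \<and> C \<noteq> {\<zero>\<^bsub>R\<^esub>} \<longrightarrow> \<not> small_left_ideal R C)
      \<or> left_noetherian R \<and> baer_left R"
  shows "\<exists>Z F. dual_socle R Z F"
proof -
  interpret ring R by (rule R)
  interpret left_p_injective R by (rule left_p_injective_of_2_injective[OF two])
  have "\<exists>n. words R (left_singular R) n \<subseteq> {\<zero>\<^bsub>R\<^esub>}"
    using cases left_singular_nilpotent_of_right_noetherian left_singular_nilpotent_of_left_noetherian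
    by metis
  then obtain n where n: "words R (left_singular R) n \<subseteq> {\<zero>\<^bsub>R\<^esub>}" by blast
  have uniform: "\<exists>U. uniform_left R U \<and> U \<subseteq> K" if K: "left_ideal K R" "K \<noteq> {\<zero>\<^bsub>R\<^esub>}" for K
    using cases
  proof (elim disjE conjE)
    assume N: "left_noetherian (opp_ring R)"
    show ?thesis by (rule uniform_ideal_exists_of_right_noetherian[OF N two K]) blast
  next
    assume N: "left_noetherian R"
    show ?thesis by (rule uniform_ideal_exists_of_left_noetherian[OF N K]) blast
  qed
  have summand: "\<exists>g\<in>carrier R. g \<otimes>\<^bsub>R\<^esub> g = g \<and> C = principal_left R g"
    if C: "uniform_left R C" "complement_left_ideal R C" for C
    using cases
  proof (elim disjE conjE)
    assume N: "left_noetherian (opp_ring R)"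
      and ncs: "\<forall>C. complement_left_ideal R C \<and> C \<noteq> {\<zero>\<^bsub>R\<^esub>} \<longrightarrow> \<not> small_left_ideal R C"
    have "\<not> small_left_ideal R C" using ncs C uniform_leftD(2)[OF C(1)] by blast
    then show ?thesis
      by (rule uniform_complement_summand_of_right_noetherian[OF N C(1)]) blast
  next
    assume B: "baer_left R"
    show ?thesis by (rule complement_summand_of_baer[OF B C(2)]) blast
  qed
  obtain F where F: "finite F" "\<And>f. f \<in> F \<Longrightarrow> uniform_idempotent R f"
    "additively_generates R F \<one>\<^bsub>R\<^esub>"
    using uniform_decomposition[OF _ uniform summand] cases by metis
  interpret peirce R F
    by unfold_locales (use F left_loewy_of_nilpotent[OF n] in auto)
  show ?thesis using dual_socle_of_peirce[OF right_loewy_of_nilpotent[OF n]] by blast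
qed

lemma quasi_Frobenius_iff_baer:
  assumes "ring R"
  shows "quasi_Frobenius TYPE('m) R \<longleftrightarrow>
    (left_noetherian R \<or> left_noetherian (opp_ring R)) \<and> (baer_left R \<or> baer_left (opp_ring R))"
  using left_self_injective_iff_baer[OF assms, where 'm = 'm]
    left_self_injective_iff_baer[OF ring_opp_ring[OF assms], where 'm = 'm]
  by (simp add: quasi_Frobenius_def right_noetherian_def right_self_injective_def)

lemma dual_socle_consequences:
  assumes D: "dual_socle R Z F" and N: "left_noetherian R \<or> left_noetherian (opp_ring R)"
  shows "left_noetherian R" "left_noetherian (opp_ring R)" "baer_left R" "baer_left (opp_ring R)"
proof -
  interpret dual_socle R Z F by (rule D)
  interpret opp: dual_socle "opp_ring R" Z F by (rule opp_socle)
  show *: "left_noetherian R" "left_noetherian (opp_ring R)"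
    using N right_noetherian_of_left left_noetherian_of_right by blast+
  show "baer_left R" "baer_left (opp_ring R)"
    by (rule baer_of_noetherian[OF *(1)], rule opp.baer_of_noetherian[OF *(2)])
qed

text \<open>The left-right symmetry of quasi-Frobenius rings; every mixture of sides in the definition
  reduces to this by passing to the opposite ring.\<close>

lemma baer_and_noetherian_two_sided:
  assumes R: "ring R" and baer: "baer_left R"
    and N: "left_noetherian R \<or> left_noetherian (opp_ring R)"
  shows "left_noetherian R" "left_noetherian (opp_ring R)" "baer_left R" "baer_left (opp_ring R)"
proof -
  interpret ring R by (rule R)
  obtain Z F where "dual_socle R Z F"
    using dual_socle_exists[OF R baer_imp_n_injective[OF baer]] N baer
      complement_not_small_of_baer[OF baer] by blast
  from dual_socle_consequences[OF this N]
  show "left_noetherian R" "left_noetherian (opp_ring R)" "baer_left R" "baer_left (opp_ring R)" .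
qed

theorem theorem2p4:
  fixes R :: "('a, 'r) ring_scheme"
  assumes "ring R"
  shows "quasi_Frobenius TYPE('m) R \<longleftrightarrow>
    right_noetherian R \<and> left_n_injective R 2 \<and>
    (\<forall>C. complement_left_ideal R C \<and> C \<noteq> {\<zero>\<^bsub>R\<^esub>} \<longrightarrow> \<not> small_left_ideal R C)"
    (is "_ \<longleftrightarrow> ?rhs")
proof
  interpret ring R by (rule assms)
  assume "quasi_Frobenius TYPE('m) R"
  then have N: "left_noetherian R \<or> left_noetherian (opp_ring R)"
    and B: "baer_left R \<or> baer_left (opp_ring R)"
    using quasi_Frobenius_iff_baer[OF assms, where 'm = 'm] by auto
  have "left_noetherian (opp_ring R) \<and> baer_left R"
    using B
  proof
    assume "baer_left R"
    then show ?thesis using baer_and_noetherian_two_sided[OF assms _ N] by blast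
  next
    assume "baer_left (opp_ring R)"
    then show ?thesis
      using baer_and_noetherian_two_sided[OF ring_opp_ring[OF assms]] N
      unfolding opp_opp_ring by blast
  qed
  then show ?rhs
    using baer_imp_n_injective complement_not_small_of_baer
    by (simp add: right_noetherian_def)
next
  assume rhs: ?rhs
  then obtain Z F where "dual_socle R Z F"
    using dual_socle_exists[OF assms] by (auto simp: right_noetherian_def)
  then show "quasi_Frobenius TYPE('m) R"
    using dual_socle_consequences[of R Z F] rhs quasi_Frobenius_iff_baer[OF assms, where 'm = 'm]
    by (simp add: right_noetherian_def)
qed

end
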